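(* There exists $\varepsilon_0>0$ such that for every $\varepsilon\in(0,\varepsilon_0)$ and every $z\in\mathbb C$ with $|z|\le 1-\varepsilon$ the following holds. Let $d=d(n)$ be positive integers with $d(n)\le Dn$ for a fixed constant $D$, and let $(\varpi_n)$ be any sequence of reals with $\varpi_n\to\infty$. Then there exist a constant $\tilde C$ depending only on $\varepsilon$ (and $D$), constants $c,\bar C,C>0$ (absolute, up to dependence on $D$), and events $\Omega_n$ with $$\mathbb P(\Omega_n^c)\le C\exp(-c(\log n)^2)+\exp(-cd),$$ such that for all large $n$, on $\Omega_n$, $$|\tilde m_n(\xi)-\tilde m_\infty(\xi)|\le \tilde C\max\Big\{\frac1{d^{1/2}},\frac{\log n}{n^{1/4}}\Big\}(\operatorname{Im}\xi)^{-3}$$ for all $\xi\in\mathcal S_{\varepsilon,\varpi}:=\{\xi=\mathrm i\eta:\ \eta\in(0,\bar C],\ \eta^3\min\{d^{1/2},n^{1/4}(\log n)^{-1}\}\ge\varpi_n\}$.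
   Context: $S_n^d=\sum_{\ell=1}^d P_n^\ell$, where $P_n^\ell(i,j)=\mathbf 1(\pi_n^\ell(i)=j)$ for independent uniformly random permutations $\pi_n^1,\dots,\pi_n^d$ of $[n]$. For $\xi\in\mathbb C^+=\{\operatorname{Im}\xi>0\}$, $$\tilde m_n(\xi)=\frac1{2n}\operatorname{Tr}\Big[\xi I_{2n}-\begin{pmatrix}0& zI_n-S_n^d/\sqrt d\\ (zI_n-S_n^d/\sqrt d)^*&0\end{pmatrix}\Big]^{-1}.$$ $\tilde m_\infty(\xi)=\int\frac{d\nu(x)}{\xi-x}$ is the Stieltjes transform of the unique symmetric probability measure $\nu$ on $\mathbb R$ (depending on $z$) such that $\tilde m_\infty(\xi)(\xi-\tilde m_\infty(\xi))^2+\tilde m_\infty(\xi)(1-|z|^2)-\xi=0$ for all $\xi\in\mathbb C^+$. *)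

theory Defs
  imports "HOL-Probability.Probability" "Jordan_Normal_Form.Gauss_Jordan_Elimination"
begin

text \<open>Sample space: d-tuples (indexed by 0..d-1) of permutations of [n] = {0..n-1},
  with the uniform distribution (= d independent uniform permutations).\<close>
definition perm_space :: "nat \<Rightarrow> nat \<Rightarrow> (nat \<Rightarrow> nat \<Rightarrow> nat) set" where
  "perm_space n d = PiE {..<d} (\<lambda>_. {p. p permutes {..<n}})"

definition perm_pmf :: "nat \<Rightarrow> nat \<Rightarrow> (nat \<Rightarrow> nat \<Rightarrow> nat) pmf" where
  "perm_pmf n d = pmf_of_set (perm_space n d)"

definition S_mat :: "nat \<Rightarrow> nat \<Rightarrow> (nat \<Rightarrow> nat \<Rightarrow> nat) \<Rightarrow> complex mat" where
  "S_mat n d \<omega> = mat n n (\<lambda>(i,j). of_nat (card {l \<in> {..<d}. \<omega> l i = j}))"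

definition A_mat :: "nat \<Rightarrow> nat \<Rightarrow> complex \<Rightarrow> (nat \<Rightarrow> nat \<Rightarrow> nat) \<Rightarrow> complex mat" where
  "A_mat n d z \<omega> = z \<cdot>\<^sub>m 1\<^sub>m n - (1 / complex_of_real (sqrt (real d))) \<cdot>\<^sub>m S_mat n d \<omega>"

definition herm_mat :: "nat \<Rightarrow> nat \<Rightarrow> complex \<Rightarrow> (nat \<Rightarrow> nat \<Rightarrow> nat) \<Rightarrow> complex mat" where
  "herm_mat n d z \<omega> = mat (2*n) (2*n) (\<lambda>(i,j).
     if i < n \<and> n \<le> j then A_mat n d z \<omega> $$ (i, j - n)
     else if n \<le> i \<and> j < n then cnj (A_mat n d z \<omega> $$ (j, i - n))
     else 0)"

definition mat_trace :: "complex mat \<Rightarrow> complex" where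
  "mat_trace M = (\<Sum>i<dim_row M. M $$ (i,i))"

definition m_n :: "nat \<Rightarrow> nat \<Rightarrow> complex \<Rightarrow> (nat \<Rightarrow> nat \<Rightarrow> nat) \<Rightarrow> complex \<Rightarrow> complex" where
  "m_n n d z \<omega> \<xi> = mat_trace (the (mat_inverse (\<xi> \<cdot>\<^sub>m 1\<^sub>m (2*n) - herm_mat n d z \<omega>)))
                     / of_nat (2*n)"

definition stieltjes :: "real measure \<Rightarrow> complex \<Rightarrow> complex" where
  "stieltjes \<nu> \<xi> = integral\<^sup>L \<nu> (\<lambda>x. 1 / (\<xi> - complex_of_real x))"

definition m_inf :: "complex \<Rightarrow> complex \<Rightarrow> complex" where
  "m_inf z = (THE m. \<exists>\<nu>. prob_space \<nu> \<and> sets \<nu> = sets borel \<and> distr \<nu> borel uminus = \<nu> \<and>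
       m = stieltjes \<nu> \<and>
       (\<forall>\<xi>. Im \<xi> > 0 \<longrightarrow> m \<xi> * (\<xi> - m \<xi>)^2 + m \<xi> * (1 - complex_of_real ((cmod z)^2)) - \<xi> = 0))"

end

theory Submission
  imports Defs "HOL-Probability.Hoeffding" "Jordan_Normal_Form.Schur_Decomposition"
    "HOL-Complex_Analysis.Conformal_Mappings"
begin

text \<open>On the imaginary axis \<open>\<xi> = \<i>\<eta>\<close> the normalized trace of the resolvent is \<open>-\<i>g\<close> with \<open>g \<ge> 0\<close>.

  A transposition in one of the permutations changes \<open>g\<close> by \<open>O(1 / (n sqrt d \<eta>\<^sup>2))\<close>, so exposing the \<open>nd\<close> values of
  the permutations one by one and applying Hoeffding's lemma concentrates \<open>g\<close> within \<open>log n / (sqrt n \<eta>\<^sup>2)\<close> of its mean.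

  For the mean, expand the resolvent to second order in each single permutation. The resolvent without that
  permutation is independent of it, and averaging over a uniform permutation replaces the quadratic term by a product of
  normalized traces up to \<open>O(1 / sqrt n)\<close>; the third-order remainder contributes \<open>O(1 / (sqrt d \<eta>\<^sup>3))\<close>. Hence
  the mean satisfies the cubic \<open>x (\<eta> + x)\<^sup>2 - (1 - |z|\<^sup>2) x - \<eta> = 0\<close> up to a small error, and for \<open>|z| \<le> 1 - \<epsilon>\<close> this
  cubic is stable near its positive root.

  The measure defining the limit is obtained as a weak limit of the averaged spectral laws with \<open>d = n\<close>; it is unique
  because a symmetric law is determined by its Poisson integrals at \<open>x = 0\<close>.\<close>

section \<open>Averages and concentration over random permutations\<close>

text \<open>The entries of a permutation matrix are neither independent nor centred, so the unit of
  independence is a whole permutation: a perturbation of norm \<open>r = 1 / sqrt d\<close> that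
  moves all \<open>2 * n\<close> indices. The orders balance as follows. Summed over
  \<open>d\<close> permutations with weight \<open>r\<close>, the second order has size
  \<open>d * r * r = 1\<close> and produces the self-consistent product, while the remainder has
  size \<open>d * r * r\<^sup>2 = 1 / sqrt d\<close>. The first order does not vanish, because a
  permutation matrix has mean entries \<open>1 / n\<close>; it pairs with constant vectors only and
  costs \<open>sqrt d / (n * \<eta>)\<close>, which is where \<open>d \<le> D * n\<close> enters.
  For z \<noteq> 0 the equations do not close in the diagonal trace: the normalized trace of the
  lower left block appears too. Two equations determine both, and eliminating the second trace gives
  the cubic. Only the diagonal trace has to concentrate, since it is a factor of both products.
  Finally, \<open>m_inf\<close> is a definite description, so nothing can be said about its value
  before existence and uniqueness of the limit law are established for each z in question.\<close>

definition avg :: "'a set \<Rightarrow> ('a \<Rightarrow> 'b::real_normed_field) \<Rightarrow> 'b" where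
  "avg S f = sum f S / of_nat (card S)"

lemma avg_cong: "(\<And>x. x \<in> S \<Longrightarrow> f x = g x) \<Longrightarrow> avg S f = avg S g"
  by (simp add: avg_def)

lemma avg_add: "avg S (\<lambda>x. f x + g x) = avg S f + avg S g"
  by (simp add: avg_def sum.distrib add_divide_distrib)

lemma avg_diff: "avg S (\<lambda>x. f x - g x) = avg S f - avg S g"
  by (simp add: avg_def sum_subtractf diff_divide_distrib)

lemma avg_mult_left: "avg S (\<lambda>x. c * f x) = c * avg S f"
  by (simp add: avg_def sum_distrib_left)

lemma avg_mult_right: "avg S (\<lambda>x. f x * c) = avg S f * c"
  by (simp add: avg_def sum_distrib_right)

lemma avg_sum: "avg S (\<lambda>x. \<Sum>i\<in>I. f i x) = (\<Sum>i\<in>I. avg S (f i))"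
  unfolding avg_def by (subst sum.swap) (simp add: sum_divide_distrib)

lemma avg_const: "finite S \<Longrightarrow> S \<noteq> {} \<Longrightarrow> avg S (\<lambda>_. c) = c"
  by (simp add: avg_def)

lemma avg_mono:
  fixes f g :: "'a \<Rightarrow> real"
  shows "(\<And>x. x \<in> S \<Longrightarrow> f x \<le> g x) \<Longrightarrow> avg S f \<le> avg S g"
  by (simp add: avg_def divide_right_mono sum_mono)

lemma norm_avg: "norm (avg S f) \<le> avg S (\<lambda>x. norm (f x))"
  by (simp add: avg_def norm_divide divide_right_mono norm_sum)

lemma norm_avg_le:
  assumes "finite S" "S \<noteq> {}" "\<And>x. x \<in> S \<Longrightarrow> norm (f x) \<le> c"
  shows "norm (avg S f) \<le> c"
proof -
  have "norm (avg S f) \<le> avg S (\<lambda>_. c)"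
    using norm_avg avg_mono[of S "\<lambda>x. norm (f x)" "\<lambda>_. c"] assms(3) order_trans by blast
  then show ?thesis using assms by (simp add: avg_const)
qed

lemma avg_reindex: "bij_betw h S T \<Longrightarrow> avg T f = avg S (\<lambda>x. f (h x))"
  unfolding avg_def by (metis bij_betw_same_card sum.reindex_bij_betw)

lemma avg_product: "avg (S \<times> T) f = avg S (\<lambda>x. avg T (\<lambda>y. f (x, y)))"
  by (simp add: avg_def sum_divide_distrib [symmetric] sum.cartesian_product card_cartesian_product field_simps)

lemma expectation_pmf_of_set:
  fixes f :: "'a \<Rightarrow> real"
  shows "finite S \<Longrightarrow> S \<noteq> {} \<Longrightarrow> measure_pmf.expectation (pmf_of_set S) f = avg S f"
  by (simp add: integral_pmf_of_set avg_def)

text \<open>Hoeffding's lemma for the uniform law on \<open>S\<close>. It bounds the centred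
  variable; putting the mean back produces the term \<open>t * avg S h\<close>.\<close>

lemma avg_exp_Hoeffding_pos:
  fixes h :: "'a \<Rightarrow> real"
  assumes S: "finite S" "S \<noteq> {}" and h: "\<And>x. x \<in> S \<Longrightarrow> h x \<in> {a..b}" and t: "t > 0"
  shows "avg S (\<lambda>x. exp (t * h x)) \<le> exp (t * avg S h + t\<^sup>2 * (b - a)\<^sup>2 / 8)"
proof -
  let ?M = "measure_pmf (pmf_of_set S)"
  interpret interval_bounded_random_variable ?M h a b
    by unfold_locales (use S h in \<open>auto simp: AE_measure_pmf_iff\<close>)
  have "ennreal (measure_pmf.expectation (pmf_of_set S) (\<lambda>x. exp (t * (h x - avg S h))))
     = nn_integral ?M (\<lambda>x. exp (t * (h x - avg S h)))"
    by (rule nn_integral_eq_integral[symmetric]) (auto intro!: integrable_measure_pmf_finite simp: S)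
  also have "\<dots> \<le> ennreal (exp (t\<^sup>2 * (b - a)\<^sup>2 / 8))"
    using Hoeffdings_lemma_nn_integral[OF t] S by (simp add: expectation_pmf_of_set)
  finally have "avg S (\<lambda>x. exp (t * (h x - avg S h))) \<le> exp (t\<^sup>2 * (b - a)\<^sup>2 / 8)"
    using S by (simp add: expectation_pmf_of_set)
  moreover have "avg S (\<lambda>x. exp (t * h x)) = avg S (\<lambda>x. exp (t * (h x - avg S h))) * exp (t * avg S h)"
    unfolding avg_mult_right[symmetric] exp_add[symmetric] by (simp add: algebra_simps)
  ultimately show ?thesis
    by (simp add: exp_add mult.commute)
qed

text \<open>Negative \<open>t\<close> reduces to positive \<open>t\<close> by passing to
  \<open>- h\<close>. Both signs are wanted for two-sided deviation bounds.\<close>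

lemma avg_exp_Hoeffding:
  fixes h :: "'a \<Rightarrow> real"
  assumes S: "finite S" "S \<noteq> {}" and h: "\<And>x. x \<in> S \<Longrightarrow> h x \<in> {a..b}"
  shows "avg S (\<lambda>x. exp (t * h x)) \<le> exp (t * avg S h + t\<^sup>2 * (b - a)\<^sup>2 / 8)"
proof -
  consider "t > 0" | "t = 0" | "t < 0" by linarith
  then show ?thesis
  proof cases
    case 1
    then show ?thesis using avg_exp_Hoeffding_pos[OF S, of h a b t] h by blast
  next
    case 2
    then show ?thesis using S by (simp add: avg_const)
  next
    case 3
    have "avg S (\<lambda>x. exp ((-t) * (- h x))) \<le> exp ((-t) * avg S (\<lambda>x. - h x) + (-t)\<^sup>2 * ((-a) - (-b))\<^sup>2 / 8)"
      by (rule avg_exp_Hoeffding_pos) (use S h 3 in auto)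
    moreover have "avg S (\<lambda>x. - h x) = - avg S h"
      by (simp add: avg_def sum_negf)
    ultimately show ?thesis by (simp add: algebra_simps power2_commute)
  qed
qed

section \<open>Bounded differences for independent uniform permutations\<close>

abbreviation perms :: "'a set \<Rightarrow> ('a \<Rightarrow> 'a) set" where
  "perms S \<equiv> {p. p permutes S}"

lemma perms_nonempty: "perms S \<noteq> {}"
  using permutes_id by blast

text \<open>Surjectivity plus equal cardinalities gives bijectivity. As \<open>p\<close> fixes
  \<open>a\<close>, the component \<open>b\<close> is the image of \<open>a\<close>; drawing
  \<open>b\<close> first and then \<open>p\<close> therefore exposes a uniform permutation one value
  at a time.\<close>

lemma bij_betw_perms_insert:
  assumes "finite S" "a \<notin> S"
  shows "bij_betw (\<lambda>(b, p). Transposition.transpose a b \<circ> p) (insert a S \<times> perms S) (perms (insert a S))"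
proof -
  have im: "(\<lambda>(b, p). Transposition.transpose a b \<circ> p) ` (insert a S \<times> perms S) = perms (insert a S)"
    unfolding permutes_insert by (rule arg_cong2[of _ _ _ _ "(`)"]) auto
  have "card (insert a S \<times> perms S) = card (perms (insert a S))"
    using assms by (simp add: card_cartesian_product card_permutations)
  then have "inj_on (\<lambda>(b, p). Transposition.transpose a b \<circ> p) (insert a S \<times> perms S)"
    using assms by (intro eq_card_imp_inj_on) (auto simp: im finite_permutations)
  with im show ?thesis by (simp add: bij_betw_def)
qed

text \<open>A martingale-free form of the bounded-difference inequality: exposing the image of one point
  at a time, each step is Hoeffding's lemma for the conditional averages.\<close>

lemma avg_exp_perms:
  fixes f :: "('a \<Rightarrow> 'a) \<Rightarrow> real"
  assumes "finite S"
    and "\<And>p i j. p permutes S \<Longrightarrow> i \<in> S \<Longrightarrow> j \<in> S \<Longrightarrow> \<bar>f (p \<circ> Transposition.transpose i j) - f p\<bar> \<le> s"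
    and "s \<ge> 0"
  shows "avg (perms S) (\<lambda>p. exp (t * f p)) \<le> exp (t * avg (perms S) f + t\<^sup>2 * (real (card S) * s\<^sup>2 / 2))"
  using assms(1,2)
proof (induction S arbitrary: f rule: finite_induct)
  case empty
  then show ?case by (simp add: avg_def)
next
  case (insert a S)
  let ?P = "perms S" and ?B = "insert a S"
  define h where "h b = avg ?P (\<lambda>q. f (Transposition.transpose a b \<circ> q))" for b
  have fin: "finite ?P" using insert.hyps by (simp add: finite_permutations)
  have avg_eq: "avg (perms ?B) F = avg ?B (\<lambda>b. avg ?P (\<lambda>q. F (Transposition.transpose a b \<circ> q)))" for F :: "_ \<Rightarrow> real"
    by (subst avg_reindex[OF bij_betw_perms_insert[OF insert.hyps(1,2)]])
       (simp add: avg_product)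
  have q_perm: "q permutes ?B" if "q permutes S" for q
    using that permutes_subset by blast
  have inner: "avg ?P (\<lambda>q. exp (t * f (Transposition.transpose a b \<circ> q))) \<le> exp (t * h b + t\<^sup>2 * (real (card S) * s\<^sup>2 / 2))"
    if b: "b \<in> ?B" for b
    unfolding h_def
  proof (rule insert.IH)
    fix q i j assume q: "q permutes S" "i \<in> S" "j \<in> S"
    have "Transposition.transpose a b \<circ> q permutes ?B"
      using b q_perm[OF q(1)] by (intro permutes_compose permutes_swap_id) auto
    then show "\<bar>f (Transposition.transpose a b \<circ> (q \<circ> Transposition.transpose i j)) - f (Transposition.transpose a b \<circ> q)\<bar> \<le> s"
      using insert.prems[of "Transposition.transpose a b \<circ> q" i j] q unfolding comp_assoc by blast
  qed
  \<comment> \<open>The hypothesis concerns transpositions on the right of a permutation;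
    \<open>transpose_comp_eq\<close> moves the left one across \<open>q\<close>. The conditional
    averages thus lie in a window of width \<open>2 * s\<close>, and Hoeffding's
    \<open>(2 * s)\<^sup>2 / 8\<close> is the increment \<open>s\<^sup>2 / 2\<close> for one exposed
    point.\<close>
  have h_bound: "h b \<in> {avg ?P f - s..avg ?P f + s}" if b: "b \<in> ?B" for b
  proof -
    have "\<bar>f (Transposition.transpose a b \<circ> q) - f q\<bar> \<le> s" if q: "q permutes S" for q
    proof -
      have "inv_into UNIV q a \<in> ?B" "inv_into UNIV q b \<in> ?B"
        using b permutes_in_image[OF permutes_inv[OF q_perm[OF q]]] by auto
      then show ?thesis
        using insert.prems[OF q_perm[OF q], of "inv_into UNIV q a" "inv_into UNIV q b"]
        unfolding transpose_comp_eq[OF permutes_bij[OF q], of a b] by blast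
    qed
    then have "norm (avg ?P (\<lambda>q. f (Transposition.transpose a b \<circ> q) - f q)) \<le> s"
      using fin perms_nonempty by (intro norm_avg_le) auto
    then show ?thesis by (auto simp: avg_diff h_def abs_le_iff)
  qed
  have "avg (perms ?B) (\<lambda>p. exp (t * f p)) \<le> avg ?B (\<lambda>b. exp (t * h b + t\<^sup>2 * (real (card S) * s\<^sup>2 / 2)))"
    unfolding avg_eq by (intro avg_mono inner)
  also have "\<dots> = avg ?B (\<lambda>b. exp (t * h b)) * exp (t\<^sup>2 * (real (card S) * s\<^sup>2 / 2))"
    by (simp add: exp_add avg_mult_right)
  also have "\<dots> \<le> exp (t * avg ?B h + t\<^sup>2 * ((avg ?P f + s) - (avg ?P f - s))\<^sup>2 / 8) * exp (t\<^sup>2 * (real (card S) * s\<^sup>2 / 2))"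
    using h_bound insert.hyps by (intro mult_right_mono avg_exp_Hoeffding) auto
  also have "\<dots> = exp (t * avg (perms ?B) f + t\<^sup>2 * (real (card ?B) * s\<^sup>2 / 2))"
    unfolding avg_eq using insert.hyps
    by (simp flip: exp_add h_def add: algebra_simps power2_eq_square add_divide_distrib)
  finally show ?case .
qed

lemma finite_PiE_perms: "finite I \<Longrightarrow> finite S \<Longrightarrow> finite (PiE I (\<lambda>_. perms S))"
  by (simp add: finite_PiE finite_permutations)

lemma PiE_perms_nonempty: "PiE I (\<lambda>_. perms S) \<noteq> {}"
  using perms_nonempty by (metis PiE_eq_empty_iff)

lemma avg_PiE_insert:
  assumes "x \<notin> I"
  shows "avg (PiE (insert x I) (\<lambda>_. T)) f = avg T (\<lambda>p. avg (PiE I (\<lambda>_. T)) (\<lambda>w. f (w(x := p))))"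
proof -
  have "bij_betw (\<lambda>(p, w). w(x := p)) (T \<times> PiE I (\<lambda>_. T)) (PiE (insert x I) (\<lambda>_. T))"
    unfolding bij_betw_def using inj_combinator[OF assms, of "\<lambda>_. T"] PiE_insert_eq[of x I "\<lambda>_. T"] by auto
  from avg_reindex[OF this] show ?thesis by (simp add: avg_product)
qed

text \<open>The permutations are exposed in turn. The average over the earlier ones, as a function
  of the next, inherits the difference bound \<open>s\<close>, so each permutation adds
  \<open>card S * s\<^sup>2 / 2\<close> to the exponent.\<close>

lemma avg_exp_PiE_perms:
  fixes f :: "('b \<Rightarrow> 'a \<Rightarrow> 'a) \<Rightarrow> real"
  assumes "finite I" and "finite S" and "s \<ge> 0"
    and "\<And>w l i j. w \<in> PiE I (\<lambda>_. perms S) \<Longrightarrow> l \<in> I \<Longrightarrow> i \<in> S \<Longrightarrow> j \<in> S \<Longrightarrow>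
      \<bar>f (w(l := w l \<circ> Transposition.transpose i j)) - f w\<bar> \<le> s"
  shows "avg (PiE I (\<lambda>_. perms S)) (\<lambda>w. exp (t * f w))
    \<le> exp (t * avg (PiE I (\<lambda>_. perms S)) f + t\<^sup>2 * (real (card I) * real (card S) * s\<^sup>2 / 2))"
  using assms(1,4)
proof (induction I arbitrary: f rule: finite_induct)
  case empty
  then show ?case by (simp add: avg_def)
next
  case (insert x I)
  let ?P = "perms S" and ?W = "PiE I (\<lambda>_. perms S)"
  define h where "h p = avg ?W (\<lambda>w. f (w(x := p)))" for p
  have w_in: "w(x := p) \<in> PiE (insert x I) (\<lambda>_. ?P)" if "w \<in> ?W" "p \<in> ?P" for w p
    using that by (auto simp: PiE_iff extensional_def)
  have inner: "avg ?W (\<lambda>w. exp (t * f (w(x := p)))) \<le> exp (t * h p + t\<^sup>2 * (real (card I) * real (card S) * s\<^sup>2 / 2))"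
    if p: "p \<in> ?P" for p
    unfolding h_def
  proof (rule insert.IH)
    fix w l i j assume w: "w \<in> ?W" "l \<in> I" "i \<in> S" "j \<in> S"
    have l: "l \<noteq> x" using w insert.hyps by auto
    then have "(w(l := w l \<circ> Transposition.transpose i j))(x := p) =
        (w(x := p))(l := (w(x := p)) l \<circ> Transposition.transpose i j)"
      by (auto simp: fun_eq_iff)
    then show "\<bar>f ((w(l := w l \<circ> Transposition.transpose i j))(x := p)) - f (w(x := p))\<bar> \<le> s"
      using insert.prems[OF w_in[OF w(1) p] insertI2[OF w(2)] w(3,4)] by (simp only:)
  qed
  have "avg (PiE (insert x I) (\<lambda>_. ?P)) (\<lambda>w. exp (t * f w))
      \<le> avg ?P (\<lambda>p. exp (t * h p + t\<^sup>2 * (real (card I) * real (card S) * s\<^sup>2 / 2)))"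
    unfolding avg_PiE_insert[OF insert.hyps(2)] by (intro avg_mono inner)
  also have "\<dots> = avg ?P (\<lambda>p. exp (t * h p)) * exp (t\<^sup>2 * (real (card I) * real (card S) * s\<^sup>2 / 2))"
    by (simp add: exp_add avg_mult_right)
  also have "\<dots> \<le> exp (t * avg ?P h + t\<^sup>2 * (real (card S) * s\<^sup>2 / 2)) * exp (t\<^sup>2 * (real (card I) * real (card S) * s\<^sup>2 / 2))"
  proof (intro mult_right_mono avg_exp_perms assms)
    fix p i j assume p: "p permutes S" "i \<in> S" "j \<in> S"
    have "norm (avg ?W (\<lambda>w. f (w(x := p \<circ> Transposition.transpose i j)) - f (w(x := p)))) \<le> s"
    proof (intro norm_avg_le)
      fix w assume w: "w \<in> ?W"
      show "norm (f (w(x := p \<circ> Transposition.transpose i j)) - f (w(x := p))) \<le> s"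
        using insert.prems[OF w_in[OF w CollectI[of "\<lambda>p. p permutes S", OF p(1)]] insertI1 p(2,3)]
        by (simp only: real_norm_def fun_upd_upd fun_upd_same)
    qed (rule finite_PiE_perms[OF insert.hyps(1) assms(2)], rule PiE_perms_nonempty)
    then show "\<bar>h (p \<circ> Transposition.transpose i j) - h p\<bar> \<le> s"
      by (simp add: h_def avg_diff)
  qed auto
  also have "\<dots> = exp (t * avg (PiE (insert x I) (\<lambda>_. ?P)) f + t\<^sup>2 * (real (card (insert x I)) * real (card S) * s\<^sup>2 / 2))"
    unfolding avg_PiE_insert[OF insert.hyps(2)] using insert.hyps
    by (simp flip: exp_add h_def add: algebra_simps power2_eq_square add_divide_distrib)
  finally show ?case .
qed

text \<open>From \<open>\<bar>u\<bar> \<le> exp u + exp (- u)\<close> at the scale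
  \<open>t = 1 / sqrt V\<close>, where both exponential moments are at most
  \<open>exp 1\<close>.\<close>

lemma avg_abs_le_of_mgf:
  fixes Y :: "'a \<Rightarrow> real"
  assumes mgf: "\<And>t. avg S (\<lambda>x. exp (t * Y x)) \<le> exp (t\<^sup>2 * V)" and V: "V > 0"
  shows "avg S (\<lambda>x. \<bar>Y x\<bar>) \<le> 2 * exp 1 * sqrt V"
proof -
  define t where "t = 1 / sqrt V"
  have t: "t > 0" "t\<^sup>2 * V = 1" "1 / t = sqrt V" using V by (auto simp: t_def power_divide)
  have *: "\<bar>u\<bar> \<le> exp u + exp (- u)" for u :: real
    using exp_ge_add_one_self[of u] exp_ge_add_one_self[of "-u"] exp_gt_zero[of u] exp_gt_zero[of "-u"]
    by linarith
  have "t * \<bar>Y x\<bar> \<le> exp (t * Y x) + exp ((-t) * Y x)" for x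
    using *[of "t * Y x"] t by (simp add: abs_mult)
  then have "avg S (\<lambda>x. t * \<bar>Y x\<bar>) \<le> avg S (\<lambda>x. exp (t * Y x)) + avg S (\<lambda>x. exp ((-t) * Y x))"
    unfolding avg_add[symmetric] by (intro avg_mono) blast
  also have "\<dots> \<le> 2 * exp 1"
    using mgf[of t] mgf[of "-t"] t by simp
  finally have "t * avg S (\<lambda>x. \<bar>Y x\<bar>) \<le> 2 * exp 1" by (simp only: avg_mult_left)
  then show ?thesis using V by (simp add: field_simps t_def)
qed

lemma avg_tail_of_mgf:
  fixes Y :: "'a \<Rightarrow> real"
  assumes mgf: "\<And>t. avg S (\<lambda>x. exp (t * Y x)) \<le> exp (t\<^sup>2 * V)" and V: "V > 0" and u: "u > 0"
  shows "avg S (\<lambda>x. of_bool (\<bar>Y x\<bar> \<ge> u)) \<le> 2 * exp (- (u\<^sup>2 / (4 * V)))"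
proof -
  \<comment> \<open>The Chernoff optimum: this value minimizes
    \<open>t\<^sup>2 * V - t * u\<close>.\<close>
  define t where "t = u / (2 * V)"
  have t: "t > 0" using V u by (auto simp: t_def)
  have eq: "t\<^sup>2 * V - t * u = - (u\<^sup>2 / (4 * V))"
    using V by (simp add: t_def field_simps power2_eq_square)
  have "of_bool (\<bar>Y x\<bar> \<ge> u) \<le> exp (- (t * u)) * (exp (t * Y x) + exp ((-t) * Y x))" for x
  proof (cases "\<bar>Y x\<bar> \<ge> u")
    case True
    then have "t * u \<le> t * Y x \<or> t * u \<le> (-t) * Y x"
      using t mult_left_mono[of u "Y x" t] mult_left_mono[of u "- Y x" t]
      by (cases "Y x \<ge> 0") auto
    then have "exp (t * u) \<le> exp (t * Y x) + exp ((-t) * Y x)"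
      by (smt (verit) exp_gt_zero exp_le_cancel_iff)
    then show ?thesis using True by (simp add: exp_minus field_simps)
  qed auto
  then have "avg S (\<lambda>x. of_bool (\<bar>Y x\<bar> \<ge> u)) \<le> exp (- (t * u)) * (avg S (\<lambda>x. exp (t * Y x)) + avg S (\<lambda>x. exp ((-t) * Y x)))"
    unfolding avg_add[symmetric] avg_mult_left[symmetric] by (intro avg_mono) blast
  also have "\<dots> \<le> exp (- (t * u)) * (2 * exp (t\<^sup>2 * V))"
    using mgf[of t] mgf[of "-t"] by (intro mult_left_mono) auto
  also have "\<dots> = 2 * exp (t\<^sup>2 * V - t * u)"
    by (simp add: exp_diff exp_minus field_simps)
  finally show ?thesis by (simp add: eq)
qed

section \<open>Resolvents of Hermitian matrices\<close>

text \<open>Matrices are treated as functions on indices below \<open>N\<close>; \<open>opb N A c\<close> says that the Euclidean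
  operator norm of the \<open>N \<times> N\<close> matrix \<open>A\<close> is at most \<open>c\<close>.\<close>

definition opb :: "nat \<Rightarrow> (nat \<Rightarrow> nat \<Rightarrow> complex) \<Rightarrow> real \<Rightarrow> bool" where
  "opb N A c \<longleftrightarrow> 0 \<le> c \<and> (\<forall>y. L2_set (\<lambda>a. cmod (\<Sum>b<N. A a b * y b)) {..<N} \<le> c * L2_set (\<lambda>b. cmod (y b)) {..<N})"

lemma opb_nonneg: "opb N A c \<Longrightarrow> 0 \<le> c"
  by (simp add: opb_def)

lemma opbD: "opb N A c \<Longrightarrow>
    L2_set (\<lambda>a. cmod (\<Sum>b<N. A a b * y b)) {..<N} \<le> c * L2_set (\<lambda>b. cmod (y b)) {..<N}"
  by (simp add: opb_def)

lemma L2_set_indicator: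
  fixes N :: nat
  assumes "B \<subseteq> {..<N}"
  shows "L2_set (\<lambda>b. cmod (of_bool (b \<in> B))) {..<N} = sqrt (real (card B))"
proof -
  have "(\<Sum>b<N. (cmod (of_bool (b \<in> B)))\<^sup>2) = (\<Sum>b<N. if b \<in> B then 1 else 0)"
    by (intro sum.cong) auto
  also have "\<dots> = real (card B)"
    using sum.inter_restrict[of "{..<N}" "\<lambda>_. 1::real" B] Int_absorb1[OF assms] by simp
  finally show ?thesis by (simp add: L2_set_def)
qed

text \<open>The operator norm tested on the indicator vector of \<open>B\<close>. The square root of
  the cardinality, gained over entrywise estimates, is what later makes averages over a permutation
  small.\<close>

lemma opb_image_indicator:
  assumes "opb N A c" "B \<subseteq> {..<N}"
  shows "L2_set (\<lambda>a. cmod (\<Sum>b\<in>B. A a b)) {..<N} \<le> c * sqrt (real (card B))"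
proof -
  have "(\<Sum>b<N. A a b * of_bool (b \<in> B)) = (\<Sum>b\<in>B. A a b)" for a
  proof -
    have "(\<Sum>b\<in>B. A a b) = (\<Sum>b\<in>B. A a b * of_bool (b \<in> B))" by (intro sum.cong) auto
    also have "\<dots> = (\<Sum>b<N. A a b * of_bool (b \<in> B))"
      using assms(2) by (intro sum.mono_neutral_left) auto
    finally show ?thesis ..
  qed
  note eq = this
  have "L2_set (\<lambda>a. cmod (\<Sum>b<N. A a b * of_bool (b \<in> B))) {..<N}
      \<le> c * L2_set (\<lambda>b. cmod (of_bool (b \<in> B))) {..<N}"
    by (rule opbD[OF assms(1)])
  then show ?thesis unfolding eq L2_set_indicator[OF assms(2)] .
qed

lemma opb_row_sum:
  assumes "opb N A c" "B \<subseteq> {..<N}" "a < N"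
  shows "cmod (\<Sum>b\<in>B. A a b) \<le> c * sqrt (real (card B))"
  using member_le_L2_set[of "{..<N}" a "\<lambda>a. cmod (\<Sum>b\<in>B. A a b)"] opb_image_indicator[OF assms(1,2)] assms(3)
  by auto

lemma opb_entry: "opb N A c \<Longrightarrow> a < N \<Longrightarrow> b < N \<Longrightarrow> cmod (A a b) \<le> c"
  using opb_row_sum[of N A c "{b}" a] by simp

lemma sum_cmod_le_L2_set:
  fixes N :: nat
  assumes "C \<subseteq> {..<N}"
  shows "(\<Sum>a\<in>C. cmod (f a)) \<le> sqrt (real (card C)) * L2_set (\<lambda>a. cmod (f a)) {..<N}"
proof -
  have fin: "finite C" using assms finite_subset by blast
  have "(\<Sum>a\<in>C. \<bar>1\<bar> * \<bar>cmod (f a)\<bar>) \<le> L2_set (\<lambda>_. 1) C * L2_set (\<lambda>a. cmod (f a)) C"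
    by (rule L2_set_mult_ineq)
  also have "\<dots> \<le> sqrt (real (card C)) * L2_set (\<lambda>a. cmod (f a)) {..<N}"
    using assms by (intro mult_mono) (auto simp: L2_set_def sum_nonneg intro!: sum_mono2)
  finally show ?thesis by simp
qed

lemma opb_block_sum:
  assumes "opb N A c" "C \<subseteq> {..<N}" "B \<subseteq> {..<N}"
  shows "cmod (\<Sum>a\<in>C. \<Sum>b\<in>B. A a b) \<le> sqrt (real (card C)) * (c * sqrt (real (card B)))"
proof -
  have "cmod (\<Sum>a\<in>C. \<Sum>b\<in>B. A a b) \<le> (\<Sum>a\<in>C. cmod (\<Sum>b\<in>B. A a b))" by (rule norm_sum)
  also have "\<dots> \<le> sqrt (real (card C)) * (c * sqrt (real (card B)))"
    using sum_cmod_le_L2_set[OF assms(2)] opb_image_indicator[OF assms(1,3)]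
    by (meson mult_left_mono order_trans real_sqrt_ge_zero of_nat_0_le_iff)
  finally show ?thesis .
qed

text \<open>Cauchy-Schwarz on one column, whose Euclidean norm is at most \<open>c\<close>. Absolute
  values stand inside the sum, unlike in the row and block bounds, so bounded weights may be
  attached to the entries.\<close>

lemma opb_col_abs_sum:
  assumes "opb N A c" "C \<subseteq> {..<N}" "b < N"
  shows "(\<Sum>a\<in>C. cmod (A a b)) \<le> sqrt (real (card C)) * c"
proof -
  have "L2_set (\<lambda>a. cmod (A a b)) {..<N} \<le> c"
    using opb_image_indicator[OF assms(1), of "{b}"] assms(3) by simp
  then show ?thesis
    using sum_cmod_le_L2_set[OF assms(2), of "\<lambda>a. A a b"]
    by (meson mult_left_mono order_trans real_sqrt_ge_zero of_nat_0_le_iff)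
qed

lemma opb_mult:
  assumes A: "opb N A c" and B: "opb N B c'"
  shows "opb N (\<lambda>a b. \<Sum>k<N. A a k * B k b) (c * c')"
  unfolding opb_def
proof (intro conjI allI)
  show "0 \<le> c * c'" using A B by (simp add: opb_nonneg)
  fix y
  have "(\<Sum>b<N. (\<Sum>k<N. A a k * B k b) * y b) = (\<Sum>k<N. A a k * (\<Sum>b<N. B k b * y b))" for a
    by (simp add: sum_distrib_left sum_distrib_right mult.assoc) (rule sum.swap)
  then have "L2_set (\<lambda>a. cmod (\<Sum>b<N. (\<Sum>k<N. A a k * B k b) * y b)) {..<N}
      \<le> c * L2_set (\<lambda>k. cmod (\<Sum>b<N. B k b * y b)) {..<N}"
    by (simp add: opbD[OF A])
  also have "\<dots> \<le> c * (c' * L2_set (\<lambda>b. cmod (y b)) {..<N})"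
    by (intro mult_left_mono opbD[OF B] opb_nonneg[OF A])
  finally show "L2_set (\<lambda>a. cmod (\<Sum>b<N. (\<Sum>k<N. A a k * B k b) * y b)) {..<N} \<le> c * c' * L2_set (\<lambda>b. cmod (y b)) {..<N}"
    by (simp add: mult.assoc)
qed

text \<open>Permuting columns is composition with a unitary. This absorbs the permutation matrices
  that occur inside resolvent expansions.\<close>

lemma opb_permute_cols:
  assumes A: "opb N A c" and bij: "bij_betw \<sigma> {..<N} {..<N}"
  shows "opb N (\<lambda>a b. A a (\<sigma> b)) c"
  unfolding opb_def
proof (intro conjI allI)
  show "0 \<le> c" using A by (simp add: opb_nonneg)
  fix y :: "nat \<Rightarrow> complex"
  define y' where "y' k = y (inv_into {..<N} \<sigma> k)" for k
  have y': "y' (\<sigma> b) = y b" if "b < N" for b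
    using that bij by (simp add: y'_def bij_betw_inv_into_left)
  have eq: "(\<Sum>b<N. A a (\<sigma> b) * y b) = (\<Sum>b<N. A a b * y' b)" for a
    by (subst sum.reindex_bij_betw[OF bij, symmetric]) (simp add: y')
  have "L2_set (\<lambda>b. cmod (y' b)) {..<N} = L2_set (\<lambda>b. cmod (y b)) {..<N}"
    unfolding L2_set_def by (subst sum.reindex_bij_betw[OF bij, symmetric]) (simp add: y')
  moreover have "L2_set (\<lambda>a. cmod (\<Sum>b<N. A a b * y' b)) {..<N} \<le> c * L2_set (\<lambda>b. cmod (y' b)) {..<N}"
    by (rule opbD[OF A])
  ultimately show "L2_set (\<lambda>a. cmod (\<Sum>b<N. A a (\<sigma> b) * y b)) {..<N} \<le> c * L2_set (\<lambda>b. cmod (y b)) {..<N}"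
    by (simp only: eq)
qed

section \<open>Hermitian matrices and their resolvent on the imaginary axis\<close>

definition hermitian :: "nat \<Rightarrow> (nat \<Rightarrow> nat \<Rightarrow> complex) \<Rightarrow> bool" where
  "hermitian N H \<longleftrightarrow> (\<forall>a<N. \<forall>b<N. H a b = cnj (H b a))"

lemma hermitianD: "hermitian N H \<Longrightarrow> a < N \<Longrightarrow> b < N \<Longrightarrow> cnj (H a b) = H b a"
  by (metis hermitian_def)

definition shifted :: "(nat \<Rightarrow> nat \<Rightarrow> complex) \<Rightarrow> real \<Rightarrow> nat \<Rightarrow> nat \<Rightarrow> complex" where
  "shifted H \<eta> a b = (if a = b then \<i> * of_real \<eta> else 0) - H a b"

text \<open>Built on \<open>mat_inverse\<close>, as is \<open>m_n\<close>, so that the two traces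
  agree as soon as the matrix entries do.\<close>

definition resolvent :: "nat \<Rightarrow> (nat \<Rightarrow> nat \<Rightarrow> complex) \<Rightarrow> real \<Rightarrow> nat \<Rightarrow> nat \<Rightarrow> complex" where
  "resolvent N H \<eta> a b = the (mat_inverse (mat N N (\<lambda>(a, b). shifted H \<eta> a b))) $$ (a, b)"

lemma sum_shifted_left: "a < N \<Longrightarrow> (\<Sum>c<N. shifted H \<eta> a c * x c) = \<i> * of_real \<eta> * x a - (\<Sum>c<N. H a c * x c)"
  by (simp add: shifted_def left_diff_distrib sum_subtractf if_distrib[of "\<lambda>u. u * _"] cong: if_cong)

lemma sum_shifted_right: "b < N \<Longrightarrow> (\<Sum>c<N. x c * shifted H \<eta> c b) = \<i> * of_real \<eta> * x b - (\<Sum>c<N. x c * H c b)"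
  by (simp add: shifted_def right_diff_distrib sum_subtractf if_distrib[of "\<lambda>u. _ * u"] mult.commute cong: if_cong)

lemma hermitian_form_real:
  assumes "hermitian N H"
  shows "Im (\<Sum>a<N. \<Sum>c<N. cnj (x a) * H a c * x c) = 0"
proof -
  let ?s = "\<Sum>a<N. \<Sum>c<N. cnj (x a) * H a c * x c"
  have "cnj ?s = (\<Sum>a<N. \<Sum>c<N. cnj (x c) * H c a * x a)"
    by (simp add: hermitianD[OF assms] mult_ac)
  also have "\<dots> = ?s" by (rule sum.swap)
  finally have "Im (cnj ?s) = Im ?s" by (rule arg_cong)
  then show ?thesis unfolding cnj.simps(2) by linarith
qed

text \<open>The quadratic form of \<open>H\<close> is real, so only \<open>\<i> * \<eta>\<close>
  contributes to the imaginary part. Invertibility, the norm bound \<open>1 / \<eta>\<close> and the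
  sign of the resolvent's diagonal all come from this identity.\<close>

lemma hermitian_shifted_form:
  assumes "hermitian N H" "\<And>a. a < N \<Longrightarrow> (\<Sum>c<N. shifted H \<eta> a c * x c) = y a"
  shows "Im (\<Sum>a<N. cnj (x a) * y a) = \<eta> * (\<Sum>a<N. (cmod (x a))\<^sup>2)"
proof -
  have "(\<Sum>a<N. cnj (x a) * y a) = (\<Sum>a<N. cnj (x a) * (\<i> * of_real \<eta> * x a - (\<Sum>c<N. H a c * x c)))"
    using assms(2) by (intro sum.cong) (auto simp flip: sum_shifted_left)
  also have "\<dots> = \<i> * of_real (\<eta> * (\<Sum>a<N. (cmod (x a))\<^sup>2)) - (\<Sum>a<N. \<Sum>c<N. cnj (x a) * H a c * x c)"
  proof -
    have "cnj (x a) * (\<i> * of_real \<eta> * x a - (\<Sum>c<N. H a c * x c))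
        = \<i> * of_real (\<eta> * (cmod (x a))\<^sup>2) - (\<Sum>c<N. cnj (x a) * H a c * x c)" for a
    proof -
      have "cnj (x a) * x a = of_real ((cmod (x a))\<^sup>2)"
        by (simp only: complex_norm_square mult.commute)
      then have "\<i> * of_real \<eta> * (cnj (x a) * x a) = \<i> * of_real (\<eta> * (cmod (x a))\<^sup>2)" by simp
      then show ?thesis by (simp add: right_diff_distrib sum_distrib_left mult_ac)
    qed
    then show ?thesis by (simp add: sum_subtractf sum_distrib_left)
  qed
  finally show ?thesis using hermitian_form_real[OF assms(1), of x] by simp
qed

lemma hermitian_shifted_norm:
  assumes "hermitian N H" "\<eta> > 0" "\<And>a. a < N \<Longrightarrow> (\<Sum>c<N. shifted H \<eta> a c * x c) = y a"
  shows "\<eta> * L2_set (\<lambda>a. cmod (x a)) {..<N} \<le> L2_set (\<lambda>a. cmod (y a)) {..<N}"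
proof -
  let ?X = "L2_set (\<lambda>a. cmod (x a)) {..<N}" and ?Y = "L2_set (\<lambda>a. cmod (y a)) {..<N}"
  have "\<eta> * ?X\<^sup>2 = Im (\<Sum>a<N. cnj (x a) * y a)"
    using hermitian_shifted_form[OF assms(1,3)] by (simp only: L2_set_def real_sqrt_pow2 sum_nonneg zero_le_power2)
  also have "\<dots> \<le> (\<Sum>a<N. \<bar>cmod (x a)\<bar> * \<bar>cmod (y a)\<bar>)"
    by (rule order_trans[OF abs_Im_le_cmod[THEN abs_le_D1] order_trans[OF norm_sum]]) (simp add: norm_mult)
  also have "\<dots> \<le> ?X * ?Y" by (rule L2_set_mult_ineq)
  finally have *: "\<eta> * ?X * ?X \<le> ?Y * ?X" by (simp add: power2_eq_square mult_ac)
  show ?thesis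
  proof (cases "?X = 0")
    case False
    then have "?X > 0" using L2_set_nonneg[of "\<lambda>a. cmod (x a)" "{..<N}"] by linarith
    with * show ?thesis by (rule mult_right_le_imp_le)
  qed (simp add: L2_set_nonneg)
qed

lemma resolvent_inverse_mat:
  assumes "hermitian N H" "\<eta> > 0"
  defines "M \<equiv> mat N N (\<lambda>(a, b). shifted H \<eta> a b)"
  shows "the (mat_inverse M) \<in> carrier_mat N N" "M * the (mat_inverse M) = 1\<^sub>m N" "the (mat_inverse M) * M = 1\<^sub>m N"
proof -
  have M: "M \<in> carrier_mat N N" by (simp add: M_def)
  have "Determinant.det M \<noteq> 0"
  proof
    assume "Determinant.det M = 0"
    then obtain v where v: "v \<in> carrier_vec N" "v \<noteq> 0\<^sub>v N" "M *\<^sub>v v = 0\<^sub>v N"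
      using det_0_iff_vec_prod_zero[OF M] by auto
    have "(\<Sum>c<N. shifted H \<eta> a c * (v $ c)) = 0" if "a < N" for a
    proof -
      have "(M *\<^sub>v v) $ a = 0" using v that by simp
      then show ?thesis using that v(1) by (simp add: M_def scalar_prod_def atLeast0LessThan)
    qed
    from hermitian_shifted_norm[OF assms(1,2), of "\<lambda>a. v $ a" "\<lambda>_. 0", OF this]
    have "\<eta> * L2_set (\<lambda>a. cmod (v $ a)) {..<N} \<le> 0" by (simp add: L2_set_def)
    then have "L2_set (\<lambda>a. cmod (v $ a)) {..<N} = 0"
      using \<open>\<eta> > 0\<close> L2_set_nonneg[of "\<lambda>a. cmod (v $ a)" "{..<N}"] by (simp add: mult_le_0_iff)
    then have "v $ a = 0" if "a < N" for a
      using that by (simp add: L2_set_eq_0_iff)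
    then have "v = 0\<^sub>v N" using v(1) by auto
    with v(2) show False by simp
  qed
  then have "mat_inverse M \<noteq> None"
    using mat_inverse(1)[OF M, where b = "()"] det_non_zero_imp_unit[OF M, where b = "()"] by blast
  then obtain B where "mat_inverse M = Some B" by blast
  then show "the (mat_inverse M) \<in> carrier_mat N N" "M * the (mat_inverse M) = 1\<^sub>m N" "the (mat_inverse M) * M = 1\<^sub>m N"
    using mat_inverse(2)[OF M] by auto
qed

lemma
  assumes "hermitian N H" "\<eta> > 0" "a < N" "b < N"
  shows shifted_resolvent: "(\<Sum>c<N. shifted H \<eta> a c * resolvent N H \<eta> c b) = of_bool (a = b)"
    and resolvent_shifted: "(\<Sum>c<N. resolvent N H \<eta> a c * shifted H \<eta> c b) = of_bool (a = b)"
proof -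
  let ?M = "mat N N (\<lambda>(a, b). shifted H \<eta> a b)"
  let ?R = "the (mat_inverse ?M)"
  note * = resolvent_inverse_mat[OF assms(1,2)]
  have "(?M * ?R) $$ (a, b) = (\<Sum>c<N. shifted H \<eta> a c * resolvent N H \<eta> c b)"
    using *(1) assms by (auto simp: scalar_prod_def resolvent_def atLeast0LessThan)
  moreover have "(?M * ?R) $$ (a, b) = of_bool (a = b)" unfolding *(2) using assms by simp
  ultimately show "(\<Sum>c<N. shifted H \<eta> a c * resolvent N H \<eta> c b) = of_bool (a = b)" by simp
  have "(?R * ?M) $$ (a, b) = (\<Sum>c<N. resolvent N H \<eta> a c * shifted H \<eta> c b)"
    using *(1) assms by (auto simp: scalar_prod_def resolvent_def atLeast0LessThan)
  moreover have "(?R * ?M) $$ (a, b) = of_bool (a = b)" unfolding *(3) using assms by simp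
  ultimately show "(\<Sum>c<N. resolvent N H \<eta> a c * shifted H \<eta> c b) = of_bool (a = b)" by simp
qed

text \<open>Insert \<open>M' R' = 1\<close> to the right of \<open>R\<close> and
  \<open>R M = 1\<close> to the left of \<open>R'\<close>. Stated for one-sided inverses, the
  identity serves uniqueness of the resolvent, its dependence on \<eta> and every perturbation of
  \<open>H\<close>.\<close>

lemma inverse_difference:
  fixes R R' M M' :: "nat \<Rightarrow> nat \<Rightarrow> complex"
  assumes R: "\<And>a b. a < N \<Longrightarrow> b < N \<Longrightarrow> (\<Sum>c<N. R a c * M c b) = of_bool (a = b)"
    and R': "\<And>a b. a < N \<Longrightarrow> b < N \<Longrightarrow> (\<Sum>c<N. M' a c * R' c b) = of_bool (a = b)"
    and ab: "a < N" "b < N"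
  shows "R a b - R' a b = (\<Sum>c<N. \<Sum>d<N. R a c * (M' c d - M c d) * R' d b)"
proof -
  have "(\<Sum>c<N. \<Sum>d<N. R a c * M' c d * R' d b) = (\<Sum>c<N. R a c * of_bool (c = b))"
    using R' ab by (intro sum.cong) (auto simp flip: sum_distrib_left simp: mult.assoc)
  also have "\<dots> = R a b" using ab by simp
  finally have 1: "(\<Sum>c<N. \<Sum>d<N. R a c * M' c d * R' d b) = R a b" .
  have "(\<Sum>c<N. \<Sum>d<N. R a c * M c d * R' d b) = (\<Sum>d<N. \<Sum>c<N. R a c * M c d * R' d b)" by (rule sum.swap)
  also have "\<dots> = (\<Sum>d<N. of_bool (a = d) * R' d b)"
    using R ab by (intro sum.cong) (auto simp flip: sum_distrib_right)
  also have "\<dots> = R' a b" using ab by simp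
  finally have 2: "(\<Sum>c<N. \<Sum>d<N. R a c * M c d * R' d b) = R' a b" .
  have "(\<Sum>c<N. \<Sum>d<N. R a c * (M' c d - M c d) * R' d b)
    = (\<Sum>c<N. \<Sum>d<N. R a c * M' c d * R' d b) - (\<Sum>c<N. \<Sum>d<N. R a c * M c d * R' d b)"
    by (simp add: algebra_simps sum_subtractf)
  then show ?thesis using 1 2 by simp
qed

lemma resolvent_unique:
  assumes "hermitian N H" "\<eta> > 0" "a < N" "b < N"
    and Q: "\<And>a b. a < N \<Longrightarrow> b < N \<Longrightarrow> (\<Sum>c<N. Q a c * shifted H \<eta> c b) = of_bool (a = b)"
  shows "Q a b = resolvent N H \<eta> a b"
  using inverse_difference[of N Q "shifted H \<eta>" "shifted H \<eta>" "resolvent N H \<eta>", OF Q shifted_resolvent] assms by simp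

lemma opb_resolvent:
  assumes "hermitian N H" "\<eta> > 0"
  shows "opb N (resolvent N H \<eta>) (1 / \<eta>)"
  unfolding opb_def
proof (intro conjI allI)
  show "0 \<le> 1 / \<eta>" using assms by simp
  fix y :: "nat \<Rightarrow> complex"
  let ?x = "\<lambda>a. \<Sum>b<N. resolvent N H \<eta> a b * y b"
  have "(\<Sum>c<N. shifted H \<eta> a c * ?x c) = y a" if "a < N" for a
  proof -
    have "(\<Sum>c<N. shifted H \<eta> a c * ?x c) = (\<Sum>b<N. (\<Sum>c<N. shifted H \<eta> a c * resolvent N H \<eta> c b) * y b)"
      by (simp add: sum_distrib_left sum_distrib_right mult.assoc) (rule sum.swap)
    also have "\<dots> = (\<Sum>b<N. of_bool (a = b) * y b)"
      using shifted_resolvent[OF assms that] by (intro sum.cong) auto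
    finally show ?thesis using that by simp
  qed
  from hermitian_shifted_norm[OF assms this]
  show "L2_set (\<lambda>a. cmod (\<Sum>b<N. resolvent N H \<eta> a b * y b)) {..<N} \<le> 1 / \<eta> * L2_set (\<lambda>b. cmod (y b)) {..<N}"
    using assms by (simp add: field_simps)
qed

lemma Im_resolvent_diag:
  assumes "hermitian N H" "\<eta> > 0" "a < N"
  shows "Im (resolvent N H \<eta> a a) \<le> 0"
proof -
  let ?x = "\<lambda>c. resolvent N H \<eta> c a"
  have "Im (\<Sum>b<N. cnj (?x b) * of_bool (b = a)) = \<eta> * (\<Sum>b<N. (cmod (?x b))\<^sup>2)"
    by (rule hermitian_shifted_form[OF assms(1) shifted_resolvent[OF assms(1,2) _ assms(3)]])
  moreover have "(\<Sum>b<N. cnj (?x b) * of_bool (b = a)) = cnj (?x a)"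
    using assms by simp
  moreover have "0 \<le> \<eta> * (\<Sum>b<N. (cmod (?x b))\<^sup>2)" using assms by (simp add: sum_nonneg)
  ultimately show ?thesis by simp
qed

text \<open>Carries estimates from a finite grid of values of \<eta> to all of them, and supplies
  the continuity behind the stability argument.\<close>

lemma resolvent_lipschitz:
  assumes H: "hermitian N H" and "\<eta> > 0" "\<eta>' > 0" "a < N" "b < N"
  shows "cmod (resolvent N H \<eta> a b - resolvent N H \<eta>' a b) \<le> \<bar>\<eta> - \<eta>'\<bar> / (\<eta> * \<eta>')"
proof -
  have "resolvent N H \<eta> a b - resolvent N H \<eta>' a b
    = (\<Sum>c<N. \<Sum>d<N. resolvent N H \<eta> a c * (shifted H \<eta>' c d - shifted H \<eta> c d) * resolvent N H \<eta>' d b)"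
    by (rule inverse_difference) (use assms resolvent_shifted shifted_resolvent in auto)
  also have "\<dots> = (\<Sum>c<N. \<Sum>d<N. if c = d then \<i> * of_real (\<eta>' - \<eta>) * (resolvent N H \<eta> a c * resolvent N H \<eta>' c b) else 0)"
    by (intro sum.cong) (auto simp: shifted_def algebra_simps)
  also have "\<dots> = \<i> * of_real (\<eta>' - \<eta>) * (\<Sum>c<N. resolvent N H \<eta> a c * resolvent N H \<eta>' c b)"
    by (simp add: sum_distrib_left)
  also have "cmod \<dots> \<le> \<bar>\<eta> - \<eta>'\<bar> * (1 / \<eta> * (1 / \<eta>'))"
    unfolding norm_mult using assms
    by (intro mult_mono opb_entry[OF opb_mult[OF opb_resolvent opb_resolvent]])
       (auto simp del: of_real_diff simp: abs_minus_commute)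
  finally show ?thesis by simp
qed

definition chiral :: "nat \<Rightarrow> (nat \<Rightarrow> nat \<Rightarrow> complex) \<Rightarrow> bool" where
  "chiral n H \<longleftrightarrow> (\<forall>a b. (a < n \<longleftrightarrow> b < n) \<longrightarrow> H a b = 0)"

lemma sum_lessThan_double: "(\<Sum>a<2*n. f a) = (\<Sum>i<n. f i) + (\<Sum>i<n. f (n + i))" for n :: nat
proof -
  have "(\<Sum>a<2*n. f a) = (\<Sum>a<n. f a) + (\<Sum>a=n..<2*n. f a)"
    by (metis atLeast0LessThan le_add1 mult_2 sum.atLeastLessThan_concat zero_le)
  also have "(\<Sum>a=n..<2*n. f a) = (\<Sum>i<n. f (n + i))"
    using sum.shift_bounds_nat_ivl[of f 0 n n] by (simp add: atLeast0LessThan mult_2 add.commute)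
  finally show ?thesis .
qed

text \<open>The upper diagonal entries of \<open>(\<i> \<eta> - H) R = 1\<close> and the lower ones
  of \<open>R (\<i> \<eta> - H) = 1\<close>, when summed, involve the same double sum
  \<open>?s\<close>; chirality leaves no other interaction term.\<close>

lemma resolvent_block_traces_eq:
  assumes H: "hermitian (2*n) H" "chiral n H" and \<eta>: "\<eta> > 0"
  shows "(\<Sum>i<n. resolvent (2*n) H \<eta> i i) = (\<Sum>i<n. resolvent (2*n) H \<eta> (n+i) (n+i))"
proof -
  let ?R = "resolvent (2*n) H \<eta>"
  let ?s = "\<Sum>i<n. \<Sum>j<n. H i (n+j) * ?R (n+j) i"
  have "\<i> * of_real \<eta> * ?R i i - (\<Sum>j<n. H i (n+j) * ?R (n+j) i) = 1" if "i < n" for i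
    using trans[OF sum_shifted_left[of i "2*n" H \<eta> "\<lambda>c. ?R c i", symmetric] shifted_resolvent[OF H(1) \<eta>, of i i]] that H(2)
    by (simp add: sum_lessThan_double chiral_def)
  then have "(\<Sum>i<n. \<i> * of_real \<eta> * ?R i i - (\<Sum>j<n. H i (n+j) * ?R (n+j) i)) = of_nat n" by simp
  then have 1: "\<i> * of_real \<eta> * (\<Sum>i<n. ?R i i) - ?s = of_nat n"
    by (simp add: sum_subtractf sum_distrib_left)
  have "\<i> * of_real \<eta> * ?R (n+j) (n+j) - (\<Sum>i<n. ?R (n+j) i * H i (n+j)) = 1" if "j < n" for j
    using trans[OF sum_shifted_right[of "n+j" "2*n" "?R (n+j)" H \<eta>, symmetric] resolvent_shifted[OF H(1) \<eta>, of "n+j" "n+j"]] that H(2)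
    by (simp add: sum_lessThan_double chiral_def)
  then have "(\<Sum>j<n. \<i> * of_real \<eta> * ?R (n+j) (n+j) - (\<Sum>i<n. ?R (n+j) i * H i (n+j))) = of_nat n" by simp
  then have "\<i> * of_real \<eta> * (\<Sum>j<n. ?R (n+j) (n+j)) - (\<Sum>j<n. \<Sum>i<n. H i (n+j) * ?R (n+j) i) = of_nat n"
    by (simp add: sum_subtractf sum_distrib_left mult.commute)
  then have 2: "\<i> * of_real \<eta> * (\<Sum>j<n. ?R (n+j) (n+j)) - ?s = of_nat n"
    by (subst (asm) sum.swap)
  from 1 2 have "\<i> * of_real \<eta> * (\<Sum>i<n. ?R i i) = \<i> * of_real \<eta> * (\<Sum>j<n. ?R (n+j) (n+j))" by (simp add: algebra_simps)
  then show ?thesis using \<eta> by simp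
qed

text \<open>Conjugating by the signature \<open>diag(1, -1)\<close> turns \<open>H\<close> into \<open>-H\<close>, hence the resolvent at \<open>\<i>\<eta>\<close>
  into minus its own adjoint.\<close>

lemma Re_resolvent_diag:
  assumes H: "hermitian (2*n) H" "chiral n H" and \<eta>: "\<eta> > 0" and a: "a < 2*n"
  shows "Re (resolvent (2*n) H \<eta> a a) = 0"
proof -
  let ?R = "resolvent (2*n) H \<eta>"
  define s :: "nat \<Rightarrow> complex" where "s a = (if a < n then 1 else -1)" for a
  have ss: "s a * s a = 1" "cnj (s a) = s a" for a by (auto simp: s_def)
  define Q where "Q a b = - s a * s b * cnj (?R b a)" for a b
  have sH: "s b * H c b = - s c * H c b" for b c
    using H(2) by (auto simp: s_def chiral_def)
  have "(\<Sum>c<2*n. Q a c * shifted H \<eta> c b) = of_bool (a = b)" if ab: "a < 2*n" "b < 2*n" for a b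
  proof -
    have "Q a c * shifted H \<eta> c b = cnj (s a * s b * (shifted H \<eta> b c * ?R c a))" if "c < 2*n" for c
    proof -
      have "cnj (H c b) = H b c" using hermitianD[OF H(1) that ab(2)] .
      then have "- s c * cnj (shifted H \<eta> c b) = s b * shifted H \<eta> b c"
        using sH[of c b] by (auto simp: shifted_def algebra_simps)
      then have "s a * (- s c * cnj (shifted H \<eta> c b)) * ?R c a = s a * (s b * shifted H \<eta> b c) * ?R c a" by simp
      then have "cnj (s a * (- s c * cnj (shifted H \<eta> c b)) * ?R c a) = cnj (s a * (s b * shifted H \<eta> b c) * ?R c a)" by simp
      then show ?thesis by (simp add: Q_def ss mult_ac)
    qed
    then have "(\<Sum>c<2*n. Q a c * shifted H \<eta> c b) = (\<Sum>c<2*n. cnj (s a * s b * (shifted H \<eta> b c * ?R c a)))" by simp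
    also have "\<dots> = cnj (s a * s b * (\<Sum>c<2*n. shifted H \<eta> b c * ?R c a))"
      by (simp only: cnj_sum sum_distrib_left)
    also have "\<dots> = cnj (s a * s b * of_bool (b = a))"
      by (simp only: shifted_resolvent[OF H(1) \<eta> ab(2,1)])
    also have "\<dots> = of_bool (a = b)" by (auto simp: ss)
    finally show ?thesis .
  qed
  from resolvent_unique[OF H(1) \<eta> a a this] have "?R a a = - cnj (?R a a)"
    by (simp add: Q_def ss)
  then have "Re (?R a a) = Re (- cnj (?R a a))" by simp
  then show ?thesis by simp
qed

section \<open>Averages over one permutation\<close>

text \<open>Exchanging \<open>w l\<close> with a fresh \<open>p\<close> is an involution of the
  product, so it preserves the law. In this form any function of the other coordinates is constant
  under the inner average.\<close>

lemma avg_PiE_resample: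
  fixes f :: "('i \<Rightarrow> 'b) \<Rightarrow> 'c::real_normed_field"
  assumes l: "l \<in> I" and fin: "finite T" "T \<noteq> {}"
  shows "avg (PiE I (\<lambda>_. T)) f = avg (PiE I (\<lambda>_. T)) (\<lambda>w. avg T (\<lambda>p. f (w(l := p))))"
proof -
  let ?W = "PiE I (\<lambda>_. T)"
  define h where "h = (\<lambda>(w :: 'i \<Rightarrow> 'b, p). (w(l := p), w l))"
  have h_in: "h x \<in> ?W \<times> T" if "x \<in> ?W \<times> T" for x
    using that l by (auto simp: h_def PiE_iff extensional_def)
  have hh: "h (h x) = x" for x by (cases x) (simp add: h_def)
  have bij: "bij_betw h (?W \<times> T) (?W \<times> T)"
    by (rule bij_betwI[where g = h]) (use h_in hh in auto)
  have "avg ?W f = avg ?W (\<lambda>w. avg T (\<lambda>p. f w))" using fin by (simp add: avg_const)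
  also have "\<dots> = avg (?W \<times> T) (\<lambda>x. f (fst x))" by (simp add: avg_product)
  also have "\<dots> = avg (?W \<times> T) (\<lambda>x. f (fst (h x)))" by (rule avg_reindex[OF bij])
  also have "\<dots> = avg ?W (\<lambda>w. avg T (\<lambda>p. f (w(l := p))))" by (simp add: avg_product h_def)
  finally show ?thesis .
qed

lemma avg_perms_compose_left:
  "q permutes S \<Longrightarrow> avg (perms S) (\<lambda>p. f (q \<circ> p)) = avg (perms S) f"
  unfolding avg_def by (simp flip: setum_permutations_compose_left)

lemma avg_perms_inv: "avg (perms S) (\<lambda>p. f (inv_into UNIV p)) = avg (perms S) f"
  unfolding avg_def by (simp flip: sum_permutations_inverse)

lemma eq_one_divideI: "1 = a * c \<Longrightarrow> c = 1 / a" for a c :: "'a::field"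
  by (cases "a = 0") (simp_all add: eq_divide_eq mult.commute)

text \<open>By left invariance all values of \<open>p i\<close> are equally likely, and their
  probabilities add up to 1.\<close>

lemma avg_perms_apply:
  fixes f :: "'a \<Rightarrow> 'b::real_normed_field"
  assumes S: "finite S" and i: "i \<in> S"
  shows "avg (perms S) (\<lambda>p. f (p i)) = sum f S / of_nat (card S)"
proof -
  define c where "c k = avg (perms S) (\<lambda>p. of_bool (p i = k) :: 'b)" for k
  have fin: "finite (perms S)" using S by (rule finite_permutations)
  have expand: "f (p i) = (\<Sum>k\<in>S. of_bool (p i = k) * f k)" if "p \<in> perms S" for p and f :: "'a \<Rightarrow> 'b"
  proof -
    have "p i \<in> S" using that i by (simp add: permutes_in_image)
    then show ?thesis using S by (simp add: of_bool_def if_distrib[of "\<lambda>u. u * _"] cong: if_cong)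
  qed
  have avg_f: "avg (perms S) (\<lambda>p. f (p i)) = (\<Sum>k\<in>S. c k * f k)" for f
  proof -
    have "avg (perms S) (\<lambda>p. f (p i)) = avg (perms S) (\<lambda>p. \<Sum>k\<in>S. of_bool (p i = k) * f k)"
      by (rule avg_cong[OF expand])
    then show ?thesis by (simp add: avg_sum avg_mult_right c_def)
  qed
  have c_eq: "c k = c i" if "k \<in> S" for k
  proof -
    have "c i = avg (perms S) (\<lambda>p. of_bool ((Transposition.transpose i k \<circ> p) i = i))"
      unfolding c_def using i that
      by (intro avg_perms_compose_left[symmetric, of _ _ "\<lambda>p. of_bool (p i = i)"] permutes_swap_id) auto
    also have "\<dots> = c k"
      unfolding c_def by (intro avg_cong) (auto simp: transpose_eq_iff)
    finally show ?thesis ..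
  qed
  have "1 = (\<Sum>k\<in>S. c k * 1)"
    unfolding avg_f[symmetric] by (rule avg_const[OF fin perms_nonempty, symmetric])
  also have "\<dots> = of_nat (card S) * c i" using c_eq by simp
  finally have "c i = 1 / of_nat (card S)"
    by (rule eq_one_divideI)
  then show ?thesis unfolding avg_f using c_eq
    by (simp add: sum_divide_distrib)
qed

lemma avg_perms_apply2:
  fixes f :: "'a \<Rightarrow> 'a \<Rightarrow> 'b::real_normed_field"
  assumes S: "finite S" and i: "i \<in> S" "j \<in> S" "i \<noteq> j"
  shows "avg (perms S) (\<lambda>p. f (p i) (p j)) =
    (\<Sum>k\<in>S. \<Sum>l\<in>S. of_bool (k \<noteq> l) * f k l) / of_nat (card S * (card S - 1))"
proof -
  define c where "c k l = avg (perms S) (\<lambda>p. of_bool (p i = k \<and> p j = l) :: 'b)" for k l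
  have fin: "finite (perms S)" using S by (rule finite_permutations)
  have expand: "f (p i) (p j) = (\<Sum>k\<in>S. \<Sum>l\<in>S. of_bool (p i = k \<and> p j = l) * f k l)"
    if "p \<in> perms S" for p and f :: "'a \<Rightarrow> 'a \<Rightarrow> 'b"
  proof -
    have "p i \<in> S" "p j \<in> S" using that i by (simp_all add: permutes_in_image)
    moreover have "(\<Sum>l\<in>S. of_bool (p i = k \<and> p j = l) * f k l) = of_bool (p i = k) * f k (p j)" for k
      using S \<open>p j \<in> S\<close> by (cases "p i = k") (auto simp: of_bool_def if_distrib[of "\<lambda>u. u * _"] cong: if_cong)
    ultimately show ?thesis using S by (simp add: of_bool_def if_distrib[of "\<lambda>u. u * _"] cong: if_cong)
  qed
  have avg_f: "avg (perms S) (\<lambda>p. f (p i) (p j)) = (\<Sum>k\<in>S. \<Sum>l\<in>S. c k l * f k l)" for f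
  proof -
    have "avg (perms S) (\<lambda>p. f (p i) (p j)) = avg (perms S) (\<lambda>p. \<Sum>k\<in>S. \<Sum>l\<in>S. of_bool (p i = k \<and> p j = l) * f k l)"
      by (rule avg_cong[OF expand])
    then show ?thesis by (simp add: avg_sum avg_mult_right c_def)
  qed
  have c_diag: "c k k = 0" for k
  proof -
    have "c k k = avg (perms S) (\<lambda>p. 0)"
      unfolding c_def using i by (intro avg_cong) (auto dest: permutes_inj injD)
    then show ?thesis by (simp add: avg_def)
  qed
  have c_eq: "c k l = c i j" if "k \<in> S" "l \<in> S" "k \<noteq> l" for k l
  proof -
    \<comment> \<open>First \<open>k\<close> goes to \<open>i\<close>, then the image of
      \<open>l\<close> goes to \<open>j\<close>; the second swap leaves \<open>i\<close> alone
      because \<open>l \<noteq> k\<close> and \<open>j \<noteq> i\<close>.\<close>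
    define q where "q = Transposition.transpose (Transposition.transpose k i l) j \<circ> Transposition.transpose k i"
    have q: "q permutes S" unfolding q_def using i that
      by (intro permutes_compose permutes_swap_id) (auto simp: Transposition.transpose_def)
    have "q k = i" "q l = j" using i that by (auto simp: q_def Transposition.transpose_def)
    moreover have "inj q" using q permutes_inj by blast
    ultimately have q_iff: "q x = i \<longleftrightarrow> x = k" "q x = j \<longleftrightarrow> x = l" for x by (auto dest: injD)
    have "c i j = avg (perms S) (\<lambda>p. of_bool ((q \<circ> p) i = i \<and> (q \<circ> p) j = j))"
      unfolding c_def by (rule avg_perms_compose_left[OF q, symmetric])
    also have "\<dots> = c k l" unfolding c_def by (simp add: q_iff)
    finally show ?thesis ..
  qed
  have c_form: "c k l = of_bool (k \<noteq> l) * c i j" if "k \<in> S" "l \<in> S" for k l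
    using c_eq[OF that] c_diag by auto
  have card: "(\<Sum>k\<in>S. \<Sum>l\<in>S. of_bool (k \<noteq> l) :: 'b) = of_nat (card S * (card S - 1))"
  proof -
    have "(\<Sum>l\<in>S. of_bool (k \<noteq> l) :: 'b) = of_nat (card S - 1)" if "k \<in> S" for k
    proof -
      have "(\<Sum>l\<in>S. of_bool (k \<noteq> l) :: 'b) = (\<Sum>l\<in>S - {k}. 1)"
        using S that by (intro sum.mono_neutral_cong_right) auto
      then show ?thesis using S that by simp
    qed
    then show ?thesis by simp
  qed
  have "1 = (\<Sum>k\<in>S. \<Sum>l\<in>S. c k l * 1)"
    unfolding avg_f[symmetric] by (rule avg_const[OF fin perms_nonempty, symmetric])
  also have "\<dots> = (\<Sum>k\<in>S. \<Sum>l\<in>S. of_bool (k \<noteq> l)) * c i j"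
    by (simp add: c_form sum_distrib_right)
  finally have "1 = of_nat (card S * (card S - 1)) * c i j" unfolding card .
  then have "c i j = 1 / of_nat (card S * (card S - 1))"
    by (rule eq_one_divideI)
  then show ?thesis unfolding avg_f
    by (simp add: c_form sum_divide_distrib)
qed

text \<open>The Hermitization of the permutation matrix of \<open>p\<close> is itself the permutation matrix of the
  involution \<open>rho n p\<close> on \<open>2n\<close> points.\<close>

definition rho :: "nat \<Rightarrow> (nat \<Rightarrow> nat) \<Rightarrow> nat \<Rightarrow> nat" where
  "rho n p a = (if a < n then n + p a else inv_into UNIV p (a - n))"

lemma rho_low: "i < n \<Longrightarrow> rho n p i = n + p i"
  by (simp add: rho_def)

lemma rho_high: "rho n p (n + i) = inv_into UNIV p i"
  by (simp add: rho_def)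

lemma
  assumes p: "p permutes {..<n}" and a: "a < 2 * n"
  shows rho_less: "rho n p a < 2 * n" and rho_rho: "rho n p (rho n p a) = a"
proof -
  have "p i < n \<longleftrightarrow> i < n" "inv_into UNIV p i < n \<longleftrightarrow> i < n" for i
    using permutes_in_image[OF p] permutes_in_image[OF permutes_inv[OF p]] by auto
  then have "a < n \<Longrightarrow> p a < n" "\<not> a < n \<Longrightarrow> inv_into UNIV p (a - n) < n"
    using a by simp_all
  then show "rho n p a < 2 * n" "rho n p (rho n p a) = a"
    using permutes_inverses[OF p] by (cases "a < n"; simp add: rho_def)+
qed

lemma bij_betw_rho: "p permutes {..<n} \<Longrightarrow> bij_betw (rho n p) {..<2*n} {..<2*n}"
  by (rule bij_betwI[where g = "rho n p"]) (auto simp: rho_less rho_rho)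

lemma rho_eq_iff: "p permutes {..<n} \<Longrightarrow> a < 2*n \<Longrightarrow> b < 2*n \<Longrightarrow> rho n p a = b \<longleftrightarrow> rho n p b = a"
  using rho_rho by metis

text \<open>The offset \<kappa> selects a half of the indices and \<open>n - \<kappa>\<close> is the
  offset of the other half. On the lower half \<open>rho\<close> is the inverse permutation, which
  is uniform as well.\<close>

lemma avg_rho:
  fixes f :: "nat \<Rightarrow> complex"
  assumes "\<kappa> = 0 \<or> \<kappa> = n" "i < n"
  shows "avg (perms {..<n}) (\<lambda>p. f (rho n p (\<kappa> + i))) = (\<Sum>k<n. f (n - \<kappa> + k)) / of_nat n"
  using assms(1)
proof
  assume "\<kappa> = 0"
  then show ?thesis using assms(2) avg_perms_apply[of "{..<n}" i "\<lambda>k. f (n + k)"] by (simp add: rho_low)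
next
  assume \<kappa>: "\<kappa> = n"
  have "avg (perms {..<n}) (\<lambda>p. f (rho n p (\<kappa> + i))) = avg (perms {..<n}) (\<lambda>p. f (inv_into UNIV p i))"
    by (simp add: \<kappa> rho_high)
  also have "\<dots> = avg (perms {..<n}) (\<lambda>p. f (p i))"
    by (rule avg_perms_inv[of _ "\<lambda>p. f (p i)"])
  finally show ?thesis using \<kappa> assms(2) avg_perms_apply[of "{..<n}" i f] by simp
qed

lemma sum_offset: "(\<Sum>k<n. f (\<alpha> + k)) = (\<Sum>a\<in>{\<alpha>..<\<alpha>+n}. f a)" for \<alpha> n :: nat
  using sum.shift_bounds_nat_ivl[of f 0 \<alpha> n] by (simp add: atLeast0LessThan add.commute)

text \<open>Indicators of half blocks: \<open>n * n\<close> entries of size \<open>c\<close> sum to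
  \<open>c * n\<close> only. Rows and columns obey \<open>c * sqrt n\<close>, relaxed here to
  \<open>c * n\<close>, the form in which the two counting lemmas below consume them.\<close>

lemma
  assumes A: "opb (2*n) A c" and \<alpha>: "\<alpha> = 0 \<or> \<alpha> = n" and \<beta>: "\<beta> = 0 \<or> \<beta> = n"
  shows block_sum_le: "cmod (\<Sum>k<n. \<Sum>l<n. A (\<alpha> + k) (\<beta> + l)) \<le> c * n"
    and block_row_le: "k < n \<Longrightarrow> cmod (\<Sum>l<n. A (\<alpha> + k) (\<beta> + l)) \<le> c * n"
    and block_col_le: "l < n \<Longrightarrow> cmod (\<Sum>k<n. A (\<alpha> + k) (\<beta> + l)) \<le> c * n"
    and block_entry_le: "k < n \<Longrightarrow> l < n \<Longrightarrow> cmod (A (\<alpha> + k) (\<beta> + l)) \<le> c"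
proof -
  have sub: "{\<alpha>..<\<alpha>+n} \<subseteq> {..<2*n}" "{\<beta>..<\<beta>+n} \<subseteq> {..<2*n}" using \<alpha> \<beta> by auto
  have c: "c \<ge> 0" using A by (rule opb_nonneg)
  have sq: "sqrt (real n) \<le> real n"
    by (cases "n = 0") (auto intro!: real_le_lsqrt simp: power2_eq_square)
  have "(\<Sum>k<n. \<Sum>l<n. A (\<alpha> + k) (\<beta> + l)) = (\<Sum>a\<in>{\<alpha>..<\<alpha>+n}. \<Sum>b\<in>{\<beta>..<\<beta>+n}. A a b)"
    by (simp only: sum_offset[of "A _"] sum_offset[of "\<lambda>a. \<Sum>b\<in>{\<beta>..<\<beta>+n}. A a b"])
  then show "cmod (\<Sum>k<n. \<Sum>l<n. A (\<alpha> + k) (\<beta> + l)) \<le> c * n"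
    using opb_block_sum[OF A sub] by (simp add: mult_ac)
  show "cmod (\<Sum>l<n. A (\<alpha> + k) (\<beta> + l)) \<le> c * n" if "k < n"
  proof -
    have "cmod (\<Sum>l<n. A (\<alpha> + k) (\<beta> + l)) \<le> c * sqrt (real n)"
      unfolding sum_offset[of "A _"] using opb_row_sum[OF A sub(2), of "\<alpha> + k"] that \<alpha> by auto
    also have "\<dots> \<le> c * n" using sq c by (rule mult_left_mono)
    finally show ?thesis .
  qed
  show "cmod (\<Sum>k<n. A (\<alpha> + k) (\<beta> + l)) \<le> c * n" if "l < n"
  proof -
    have "cmod (\<Sum>k<n. A (\<alpha> + k) (\<beta> + l)) \<le> (\<Sum>a\<in>{\<alpha>..<\<alpha>+n}. cmod (A a (\<beta> + l)))"
      unfolding sum_offset[of "\<lambda>a. A a _"] by (rule norm_sum)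
    also have "\<dots> \<le> sqrt (real n) * c"
      using opb_col_abs_sum[OF A sub(1), of "\<beta> + l"] that \<beta> by auto
    also have "\<dots> \<le> c * n" using sq c by (simp add: mult.commute mult_left_mono)
    finally show ?thesis .
  qed
  show "cmod (A (\<alpha> + k) (\<beta> + l)) \<le> c" if "k < n" "l < n"
    using opb_entry[OF A, of "\<alpha> + k" "\<beta> + l"] that \<alpha> \<beta> by auto
qed

lemma sum_offdiag:
  fixes B :: "nat \<Rightarrow> nat \<Rightarrow> complex"
  shows "(\<Sum>k<n. \<Sum>l<n. of_bool (k \<noteq> l) * B k l) = (\<Sum>k<n. \<Sum>l<n. B k l) - (\<Sum>k<n. B k k)"
proof -
  have "(\<Sum>l<n. of_bool (k \<noteq> l) * B k l) = (\<Sum>l<n. B k l) - B k k" if "k < n" for k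
  proof -
    have "(\<Sum>l<n. of_bool (k \<noteq> l) * B k l) = (\<Sum>l<n. B k l - of_bool (k = l) * B k l)"
      by (intro sum.cong) auto
    also have "\<dots> = (\<Sum>l<n. B k l) - B k k" using that by (simp add: sum_subtractf)
    finally show ?thesis .
  qed
  then show ?thesis by (simp add: sum_subtractf)
qed

text \<open>The pair of images is uniform over \<open>n * (n - 1)\<close> off-diagonal positions,
  while \<open>B\<close> sums over them to at most \<open>2 * c * n\<close>. This would give
  \<open>4 * c / n\<close>; the constant 9 is that of the mixed case.\<close>

lemma avg_perms_pair_le:
  fixes B :: "nat \<Rightarrow> nat \<Rightarrow> complex"
  assumes n: "n \<ge> 2" and ij: "i < n" "j < n" "i \<noteq> j" and c: "c \<ge> 0"
    and tot: "cmod (\<Sum>k<n. \<Sum>l<n. B k l) \<le> c * n"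
    and entry: "\<And>k l. k < n \<Longrightarrow> l < n \<Longrightarrow> cmod (B k l) \<le> c"
  shows "cmod (avg (perms {..<n}) (\<lambda>p. B (p i) (p j))) \<le> 9 * c / n"
proof -
  have "cmod (\<Sum>k<n. B k k) \<le> (\<Sum>k<n. c)"
    by (rule order_trans[OF norm_sum sum_mono]) (use entry in auto)
  then have "cmod (\<Sum>k<n. B k k) \<le> c * n" by (simp add: mult.commute)
  then have "cmod ((\<Sum>k<n. \<Sum>l<n. B k l) - (\<Sum>k<n. B k k)) \<le> 2 * c * n"
    using norm_triangle_ineq4[of "\<Sum>k<n. \<Sum>l<n. B k l" "\<Sum>k<n. B k k"] tot by linarith
  then have "cmod (avg (perms {..<n}) (\<lambda>p. B (p i) (p j))) \<le> 2 * c * n / (real n * (real n - 1))"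
  proof -
    assume *: "cmod ((\<Sum>k<n. \<Sum>l<n. B k l) - (\<Sum>k<n. B k k)) \<le> 2 * c * n"
    have "avg (perms {..<n}) (\<lambda>p. B (p i) (p j)) = ((\<Sum>k<n. \<Sum>l<n. B k l) - (\<Sum>k<n. B k k)) / of_nat (n * (n - 1))"
      using avg_perms_apply2[of "{..<n}" i j B] ij unfolding sum_offdiag by simp
    moreover have "cmod (of_nat (n * (n - 1))) = real n * (real n - 1)"
      using n unfolding norm_of_nat by (simp add: of_nat_diff)
    ultimately show ?thesis
      using * n by (simp only: norm_divide) (rule divide_right_mono, auto)
  qed
  also have "\<dots> \<le> 9 * c / n"
    using n c by (simp add: divide_simps) (simp add: algebra_simps mult_left_mono)
  finally show ?thesis .
qed

text \<open>Splitting by the point \<open>l\<close> with \<open>p l = j\<close> turns the inverse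
  into a second image. The case \<open>l = i\<close> has probability \<open>1 / n\<close> and costs
  \<open>c / n\<close>. For \<open>l \<noteq> i\<close>, inclusion-exclusion leaves the total, a
  row, a column and an entry, each at most \<open>c * n\<close>, over \<open>n * (n - 1)\<close>;
  this costs \<open>8 * c / n\<close>.\<close>

lemma avg_perms_mixed_le:
  fixes B :: "nat \<Rightarrow> nat \<Rightarrow> complex"
  assumes n: "n \<ge> 2" and ij: "i < n" "j < n" and c: "c \<ge> 0"
    and tot: "cmod (\<Sum>k<n. \<Sum>l<n. B k l) \<le> c * n"
    and row: "\<And>k. k < n \<Longrightarrow> cmod (\<Sum>l<n. B k l) \<le> c * n"
    and col: "\<And>l. l < n \<Longrightarrow> cmod (\<Sum>k<n. B k l) \<le> c * n"
    and entry: "\<And>k l. k < n \<Longrightarrow> l < n \<Longrightarrow> cmod (B k l) \<le> c"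
  shows "cmod (avg (perms {..<n}) (\<lambda>p. B (p i) (inv_into UNIV p j))) \<le> 9 * c / n"
proof -
  let ?P = "perms {..<n}"
  let ?N = "of_nat (n * (n - 1)) :: complex"
  have expand: "B (p i) (inv_into UNIV p j) = (\<Sum>l<n. of_bool (p l = j) * B (p i) l)" if "p \<in> ?P" for p
  proof -
    have p: "p permutes {..<n}" using that by simp
    then have "inv_into UNIV p j < n" using permutes_in_image[OF permutes_inv[OF p]] ij by auto
    moreover have "of_bool (p l = j) * B (p i) l = (if l = inv_into UNIV p j then B (p i) l else 0)" for l
      using permutes_inverses[OF p] by auto
    ultimately show ?thesis by simp
  qed
  have one: "avg ?P (\<lambda>p. of_bool (p i = j) * B (p i) i) = B j i / of_nat n"
    using avg_perms_apply[of "{..<n}" i "\<lambda>k. of_bool (k = j) * B k i"] ij by simp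
  have two: "avg ?P (\<lambda>p. of_bool (p l = j) * B (p i) l) = ((\<Sum>k<n. B k l) - B j l) / ?N"
    if l: "l < n" "l \<noteq> i" for l
  proof -
    have "avg ?P (\<lambda>p. of_bool (p l = j) * B (p i) l)
        = (\<Sum>k<n. \<Sum>m<n. of_bool (k \<noteq> m) * (of_bool (m = j) * B k l)) / ?N"
      using avg_perms_apply2[of "{..<n}" i l "\<lambda>k m. of_bool (m = j) * B k l"] l ij by simp
    also have "\<dots> = ((\<Sum>k<n. B k l) - B j l) / ?N"
      unfolding sum_offdiag[where n = n and B = "\<lambda>k m. of_bool (m = j) * B k l"] using ij by simp
    finally show ?thesis .
  qed
  have "avg ?P (\<lambda>p. B (p i) (inv_into UNIV p j)) = (\<Sum>l<n. avg ?P (\<lambda>p. of_bool (p l = j) * B (p i) l))"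
    unfolding avg_sum[symmetric] by (rule avg_cong[OF expand])
  also have "\<dots> = avg ?P (\<lambda>p. of_bool (p i = j) * B (p i) i) + (\<Sum>l\<in>{..<n}-{i}. avg ?P (\<lambda>p. of_bool (p l = j) * B (p i) l))"
    using ij by (simp add: sum.remove[of "{..<n}" i])
  also have "\<dots> = B j i / of_nat n + (\<Sum>l\<in>{..<n}-{i}. ((\<Sum>k<n. B k l) - B j l) / ?N)"
    using two by (simp add: one)
  also have "(\<Sum>l\<in>{..<n}-{i}. ((\<Sum>k<n. B k l) - B j l) / ?N)
      = ((\<Sum>l<n. \<Sum>k<n. B k l) - (\<Sum>l<n. B j l) - (\<Sum>k<n. B k i) + B j i) / ?N"
    using ij by (simp add: sum_diff1 sum_subtractf sum_divide_distrib[symmetric] diff_divide_distrib add_divide_distrib)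
  also have "(\<Sum>l<n. \<Sum>k<n. B k l) = (\<Sum>k<n. \<Sum>l<n. B k l)" by (rule sum.swap)
  finally have eq: "avg ?P (\<lambda>p. B (p i) (inv_into UNIV p j)) = B j i / of_nat n +
      ((\<Sum>k<n. \<Sum>l<n. B k l) - (\<Sum>l<n. B j l) - (\<Sum>k<n. B k i) + B j i) / ?N" .
  have cn: "c \<le> c * n" using c n by (simp add: mult_le_cancel_left1)
  have "cmod ((\<Sum>k<n. \<Sum>l<n. B k l) - (\<Sum>l<n. B j l) - (\<Sum>k<n. B k i) + B j i) \<le> c * n + c * n + c * n + c * n"
    by (intro order_trans[OF norm_triangle_ineq] order_trans[OF norm_triangle_ineq4] add_mono tot row col ij
        order_trans[OF entry cn] order_refl)
  then have "cmod (((\<Sum>k<n. \<Sum>l<n. B k l) - (\<Sum>l<n. B j l) - (\<Sum>k<n. B k i) + B j i) / ?N) \<le> 4 * (c * n) / (real n * (real n - 1))"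
  proof -
    assume *: "cmod ((\<Sum>k<n. \<Sum>l<n. B k l) - (\<Sum>l<n. B j l) - (\<Sum>k<n. B k i) + B j i) \<le> c * n + c * n + c * n + c * n"
    have "cmod (of_nat (n * (n - 1))) = real n * (real n - 1)"
      using n unfolding norm_of_nat by (simp add: of_nat_diff)
    then show ?thesis
      using * n by (simp only: norm_divide) (rule divide_right_mono, auto)
  qed
  also have "\<dots> \<le> 8 * c / n"
    using n c by (simp add: divide_simps) (simp add: algebra_simps mult_left_mono)
  finally have "cmod (avg ?P (\<lambda>p. B (p i) (inv_into UNIV p j))) \<le> c / n + 8 * c / n"
    unfolding eq using entry[of j i] ij
    by (intro order_trans[OF norm_triangle_ineq] add_mono) (auto simp: norm_divide divide_right_mono)
  then show ?thesis by (simp add: add_divide_distrib[symmetric])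
qed

text \<open>Four cases: with both indices in one half, both images come from \<open>p\<close> or
  both from its inverse; otherwise there is one of each.\<close>

lemma avg_rho_offdiag_le:
  assumes n: "n \<ge> 2" and A: "opb (2*n) A c" and ab: "a < 2*n" "b < 2*n" "a \<noteq> b"
  shows "cmod (avg (perms {..<n}) (\<lambda>p. A (rho n p a) (rho n p b))) \<le> 9 * c / n"
proof -
  note c = opb_nonneg[OF A]
  note bounds = block_sum_le[OF A] block_row_le[OF A] block_col_le[OF A] block_entry_le[OF A]
  obtain \<alpha> i where a: "a = \<alpha> + i" "i < n" "\<alpha> = 0 \<or> \<alpha> = n"
    using ab(1) by (metis add_0 less_diff_conv2 mult_2 not_less ordered_cancel_comm_monoid_diff_class.add_diff_inverse)
  obtain \<beta> j where b: "b = \<beta> + j" "j < n" "\<beta> = 0 \<or> \<beta> = n"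
    using ab(2) by (metis add_0 less_diff_conv2 mult_2 not_less ordered_cancel_comm_monoid_diff_class.add_diff_inverse)
  consider "\<alpha> = 0" "\<beta> = 0" | "\<alpha> = n" "\<beta> = n" | "\<alpha> = 0" "\<beta> = n" | "\<alpha> = n" "\<beta> = 0"
    using a b by blast
  then show ?thesis
  proof cases
    case 1
    have "cmod (avg (perms {..<n}) (\<lambda>p. A (n + p i) (n + p j))) \<le> 9 * c / n"
      using a b ab 1 bounds[of n n] by (intro avg_perms_pair_le[OF n _ _ _ c, where B = "\<lambda>k l. A (n + k) (n + l)"]) auto
    then show ?thesis using a b 1 by (simp add: rho_low)
  next
    case 2
    have "cmod (avg (perms {..<n}) (\<lambda>p. A (p i) (p j))) \<le> 9 * c / n"
      using a b ab 2 bounds[of 0 0] by (intro avg_perms_pair_le[OF n _ _ _ c]) auto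
    moreover have "avg (perms {..<n}) (\<lambda>p. A (rho n p a) (rho n p b)) = avg (perms {..<n}) (\<lambda>p. A (p i) (p j))"
      using avg_perms_inv[of "{..<n}" "\<lambda>p. A (p i) (p j)"] a b 2 by (simp add: rho_high)
    ultimately show ?thesis by simp
  next
    case 3
    have "cmod (avg (perms {..<n}) (\<lambda>p. A (n + p i) (inv_into UNIV p j))) \<le> 9 * c / n"
      using a b ab 3 bounds[of n 0] by (intro avg_perms_mixed_le[OF n _ _ c, where B = "\<lambda>k l. A (n + k) l"]) auto
    then show ?thesis using a b 3 by (simp add: rho_low rho_high)
  next
    case 4
    have "cmod (avg (perms {..<n}) (\<lambda>p. (\<lambda>k l. A l (n + k)) (p j) (inv_into UNIV p i))) \<le> 9 * c / n"
      using a b ab 4 bounds[of 0 n]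
      by (intro avg_perms_mixed_le[OF n _ _ c]) (auto simp: sum.swap[of "\<lambda>k l. A l (n + k)"])
    then show ?thesis using a b 4 by (simp add: rho_low rho_high)
  qed
qed

section \<open>The self-consistent equations\<close>

lemma avg_divide: "avg S (\<lambda>x. f x / c) = avg S f / c"
  by (simp add: avg_def sum_divide_distrib[symmetric] mult.commute)

text \<open>For \<open>L = {..<d}\<close> and \<open>r = 1 / sqrt d\<close> this is the Hermitization in the statement; a smaller \<open>L\<close>
  omits some of the permutations.\<close>

definition hfun :: "nat \<Rightarrow> nat set \<Rightarrow> real \<Rightarrow> complex \<Rightarrow> (nat \<Rightarrow> nat \<Rightarrow> nat) \<Rightarrow> nat \<Rightarrow> nat \<Rightarrow> complex" where
  "hfun n L r z w a b = (if a < n \<and> b = n + a then z else if b < n \<and> a = n + b then cnj z else 0)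
     - of_real r * (\<Sum>l\<in>L. of_bool (a < 2*n \<and> rho n (w l) a = b))"

definition green :: "nat \<Rightarrow> nat set \<Rightarrow> real \<Rightarrow> complex \<Rightarrow> (nat \<Rightarrow> nat \<Rightarrow> nat) \<Rightarrow> real \<Rightarrow> nat \<Rightarrow> nat \<Rightarrow> complex" where
  "green n L r z w \<eta> = resolvent (2*n) (hfun n L r z w) \<eta>"

lemma hermitian_hfun:
  assumes "\<And>l. l \<in> L \<Longrightarrow> w l permutes {..<n}"
  shows "hermitian (2*n) (hfun n L r z w)"
  unfolding hermitian_def
proof (intro allI impI)
  fix a b assume ab: "a < 2*n" "b < 2*n"
  have "(\<Sum>l\<in>L. of_bool (a < 2*n \<and> rho n (w l) a = b) :: complex) = (\<Sum>l\<in>L. of_bool (b < 2*n \<and> rho n (w l) b = a))"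
    using assms ab rho_eq_iff by (intro sum.cong) auto
  moreover have "cnj (of_bool Q) = of_bool Q" for Q by (cases Q) auto
  ultimately show "hfun n L r z w a b = cnj (hfun n L r z w b a)"
    by (simp add: hfun_def)
qed

lemma chiral_hfun:
  assumes "\<And>l. l \<in> L \<Longrightarrow> w l permutes {..<n}"
  shows "chiral n (hfun n L r z w)"
  unfolding chiral_def
proof (intro allI impI)
  fix a b assume ab: "(a < n) = (b < n)"
  have "\<not> (a < 2*n \<and> rho n (w l) a = b)" if "l \<in> L" for l
  proof -
    have "inv_into UNIV (w l) (a - n) < n" if "a < 2*n" "\<not> a < n"
    proof -
      have "a - n < n" using that by simp
      then show ?thesis using permutes_in_image[OF permutes_inv[OF assms[OF \<open>l \<in> L\<close>]]] by auto
    qed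
    then show ?thesis using ab by (auto simp: rho_def)
  qed
  then have "(\<Sum>l\<in>L. of_bool (a < 2*n \<and> rho n (w l) a = b) :: complex) = 0"
    by (intro sum.neutral) auto
  then show "hfun n L r z w a b = 0" using ab by (auto simp: hfun_def)
qed

lemma sum_hfun_left:
  assumes "\<And>l. l \<in> L \<Longrightarrow> w l permutes {..<n}" "a < 2*n" "finite L"
  shows "(\<Sum>c<2*n. hfun n L r z w a c * x c)
    = (if a < n then z * x (n + a) else cnj z * x (a - n)) - of_real r * (\<Sum>l\<in>L. x (rho n (w l) a))"
proof -
  have 1: "(\<Sum>c<2*n. (if a < n \<and> c = n + a then z else if c < n \<and> a = n + c then cnj z else 0) * x c)
      = (if a < n then z * x (n + a) else cnj z * x (a - n))"
  proof (cases "a < n")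
    case True
    have "(\<Sum>c<2*n. (if a < n \<and> c = n + a then z else if c < n \<and> a = n + c then cnj z else 0) * x c)
      = (\<Sum>c<2*n. if c = n + a then z * x c else 0)"
      using True by (intro sum.cong) auto
    then show ?thesis using True by simp
  next
    case False
    have "(\<Sum>c<2*n. (if a < n \<and> c = n + a then z else if c < n \<and> a = n + c then cnj z else 0) * x c)
      = (\<Sum>c<2*n. if c = a - n then cnj z * x c else 0)"
      using False assms(2) by (intro sum.cong) auto
    then show ?thesis using False assms(2) by simp
  qed
  have "(\<Sum>c<2*n. (\<Sum>l\<in>L. of_bool (a < 2*n \<and> rho n (w l) a = c)) * x c)
      = (\<Sum>l\<in>L. \<Sum>c<2*n. of_bool (rho n (w l) a = c) * x c)"
    unfolding sum_distrib_right using assms(2) by (subst sum.swap) (simp only: simp_thms)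
  also have "\<dots> = (\<Sum>l\<in>L. x (rho n (w l) a))"
    using rho_less[OF assms(1) assms(2)] by (intro sum.cong) auto
  finally have 2: "(\<Sum>c<2*n. (\<Sum>l\<in>L. of_bool (a < 2*n \<and> rho n (w l) a = c)) * x c) = (\<Sum>l\<in>L. x (rho n (w l) a))" .
  show ?thesis
    unfolding hfun_def left_diff_distrib sum_subtractf 1 by (simp only: mult.assoc sum_distrib_left[symmetric] 2)
qed

text \<open>The upper right entries count \<open>w l a = b - n\<close>, the lower left ones
  \<open>w l b = a - n\<close>; the latter are the inverse-permutation branch of
  \<open>rho\<close>.\<close>

lemma m_n_green:
  assumes w: "w \<in> perm_space n d" and \<eta>: "\<eta> > 0"
  shows "m_n n d z w (\<i> * of_real \<eta>) = (\<Sum>a<2*n. green n {..<d} (1 / sqrt (real d)) z w \<eta> a a) / of_nat (2*n)"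
    (is "_ = (\<Sum>a<2*n. green _ _ ?r _ _ _ _ _) / _")
proof -
  have p: "w l permutes {..<n}" if "l < d" for l
    using w that by (auto simp: perm_space_def PiE_iff)
  have card: "card {l. l < d \<and> P l} = card ({..<d} \<inter> {l. P l})" for P
    by (rule arg_cong[of _ _ card]) auto
  have hm: "herm_mat n d z w $$ (a, b) = hfun n {..<d} ?r z w a b" if ab: "a < 2*n" "b < 2*n" for a b
  proof -
    consider "a < n" "b < n" | "\<not> a < n" "\<not> b < n" | "a < n" "\<not> b < n" | "\<not> a < n" "b < n" by blast
    then show ?thesis
    proof cases
      case 3
      have "(\<Sum>l<d. of_bool (w l a = b - n) :: complex) = (\<Sum>l<d. of_bool (a < 2*n \<and> rho n (w l) a = b))"
        using 3 ab by (intro sum.cong) (auto simp: rho_def)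
      then show ?thesis using 3 ab
        unfolding herm_mat_def hfun_def A_mat_def S_mat_def by (auto simp: card)
    next
      case 4
      have "(\<Sum>l<d. of_bool (w l b = a - n) :: complex) = (\<Sum>l<d. of_bool (a < 2*n \<and> rho n (w l) a = b))"
      proof (intro sum.cong refl)
        fix l assume "l \<in> {..<d}"
        then have "w l b = a - n \<longleftrightarrow> inv_into UNIV (w l) (a - n) = b"
          using permutes_inverses[OF p[of l]] by (metis lessThan_iff)
        then show "(of_bool (w l b = a - n) :: complex) = of_bool (a < 2*n \<and> rho n (w l) a = b)"
          using 4 ab by (simp add: rho_def)
      qed
      then show ?thesis using 4 ab
        unfolding herm_mat_def hfun_def A_mat_def S_mat_def by (auto simp: card)
    qed (use ab chiral_hfun[of "{..<d}" w n ?r z] p in \<open>auto simp: herm_mat_def chiral_def\<close>)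
  qed
  have "(\<i> * of_real \<eta>) \<cdot>\<^sub>m 1\<^sub>m (2*n) - herm_mat n d z w
      = mat (2*n) (2*n) (\<lambda>(a, b). shifted (hfun n {..<d} ?r z w) \<eta> a b)" (is "_ = ?M")
  proof (rule eq_matI)
    fix a b assume "a < dim_row ?M" "b < dim_col ?M"
    then have ab: "a < 2*n" "b < 2*n" by simp_all
    have dims: "dim_row (herm_mat n d z w) = 2*n" "dim_col (herm_mat n d z w) = 2*n"
      by (simp_all add: herm_mat_def)
    have "((\<i> * of_real \<eta>) \<cdot>\<^sub>m 1\<^sub>m (2*n) - herm_mat n d z w) $$ (a, b)
        = ((\<i> * of_real \<eta>) \<cdot>\<^sub>m 1\<^sub>m (2*n)) $$ (a, b) - herm_mat n d z w $$ (a, b)"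
      using ab dims by (intro index_minus_mat) simp_all
    then show "((\<i> * of_real \<eta>) \<cdot>\<^sub>m 1\<^sub>m (2*n) - herm_mat n d z w) $$ (a, b) = ?M $$ (a, b)"
      using ab by (simp add: hm[OF ab] shifted_def)
  qed (simp_all add: herm_mat_def)
  then have "m_n n d z w (\<i> * of_real \<eta>) = mat_trace (the (mat_inverse ?M)) / of_nat (2*n)"
    by (simp only: m_n_def)
  moreover have "dim_row (the (mat_inverse ?M)) = 2*n"
    using resolvent_inverse_mat(1)[OF hermitian_hfun, of "{..<d}" w n \<eta> ?r z] p \<eta> by auto
  ultimately show ?thesis
    unfolding mat_trace_def green_def resolvent_def
    by simp
qed

section \<open>Expansion of the resolvent in one permutation and the averaged equations\<close>

locale perm_model =
  fixes n d :: nat and z :: complex and \<eta> :: real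
  assumes n: "n \<ge> 2" and d: "d \<ge> 1" and \<eta>: "\<eta> > 0"
begin

definition r :: real where "r = 1 / sqrt (real d)"

abbreviation P :: "(nat \<Rightarrow> nat) set" where "P \<equiv> perms {..<n}"
abbreviation W :: "(nat \<Rightarrow> nat \<Rightarrow> nat) set" where "W \<equiv> PiE {..<d} (\<lambda>_. P)"

definition G :: "(nat \<Rightarrow> nat \<Rightarrow> nat) \<Rightarrow> nat \<Rightarrow> nat \<Rightarrow> complex" where
  "G w = green n {..<d} r z w \<eta>"

text \<open>The resolvent with permutation \<open>l\<close> omitted from the sum; no row or column
  is removed, despite the name.\<close>

definition minor :: "nat \<Rightarrow> (nat \<Rightarrow> nat \<Rightarrow> nat) \<Rightarrow> nat \<Rightarrow> nat \<Rightarrow> complex" where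
  "minor l w = green n ({..<d} - {l}) r z w \<eta>"

text \<open>For \<kappa> = 0 the normalized trace of the upper left block, for \<kappa> = n that of
  the lower left block.\<close>

definition T :: "nat \<Rightarrow> (nat \<Rightarrow> nat \<Rightarrow> complex) \<Rightarrow> complex" where
  "T \<kappa> A = (\<Sum>i<n. A (\<kappa> + i) i) / of_nat n"

lemma r: "r > 0" "r\<^sup>2 * d = 1" "r * d = sqrt d" "r\<^sup>2 = 1 / d"
  using d by (auto simp: r_def power_divide real_div_sqrt)

lemma finite_P: "finite P" by (simp add: finite_permutations)

lemma finite_W: "finite W" by (simp add: finite_PiE_perms)

lemma W_perm: "w \<in> W \<Longrightarrow> l < d \<Longrightarrow> w l permutes {..<n}"
  by (auto simp: PiE_iff)

lemma W_upd: "w \<in> W \<Longrightarrow> l < d \<Longrightarrow> p \<in> P \<Longrightarrow> w(l := p) \<in> W"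
  by (auto simp: PiE_iff extensional_def)

lemma opb_green:
  assumes "w \<in> W" "L \<subseteq> {..<d}"
  shows "opb (2*n) (green n L r z w \<eta>) (1 / \<eta>)"
  unfolding green_def by (intro opb_resolvent hermitian_hfun) (use assms \<eta> W_perm in auto)

lemma opb_G: "w \<in> W \<Longrightarrow> opb (2*n) (G w) (1 / \<eta>)"
  unfolding G_def by (rule opb_green) auto

lemma opb_minor: "w \<in> W \<Longrightarrow> opb (2*n) (minor l w) (1 / \<eta>)"
  unfolding minor_def by (rule opb_green) auto

lemma minor_upd: "minor l (w(l := p)) = minor l w"
proof -
  have "hfun n ({..<d} - {l}) r z (w(l := p)) = hfun n ({..<d} - {l}) r z w"
    by (intro ext) (auto simp: hfun_def intro!: sum.cong)
  then show ?thesis by (simp add: minor_def green_def)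
qed

lemma cmod_T_le:
  assumes "\<And>a b. a < 2*n \<Longrightarrow> b < 2*n \<Longrightarrow> cmod (A a b) \<le> c" "\<kappa> = 0 \<or> \<kappa> = n"
  shows "cmod (T \<kappa> A) \<le> c"
proof -
  have "cmod (\<Sum>i<n. A (\<kappa> + i) i) \<le> (\<Sum>i<n. c)"
    by (rule order_trans[OF norm_sum sum_mono]) (use assms in auto)
  then show ?thesis using n by (simp add: T_def norm_divide divide_simps mult.commute)
qed

lemma T_diff: "T \<kappa> A - T \<kappa> B = T \<kappa> (\<lambda>a b. A a b - B a b)"
  by (simp add: T_def sum_subtractf diff_divide_distrib)

text \<open>The two inverted matrices differ by \<open>r\<close> times the permutation matrix of
  \<open>rho n (w l)\<close>. Reindexing by this involution moves it onto the columns of the minor,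
  where \<open>opb_permute_cols\<close> keeps the bound \<open>1 / \<eta>\<close>.\<close>

lemma G_expand:
  assumes w: "w \<in> W" and l: "l < d" and ab: "a < 2*n" "b < 2*n"
  shows "G w a b = minor l w a b - r * (\<Sum>c<2*n. minor l w a (rho n (w l) c) * G w c b)"
proof -
  let ?H = "hfun n {..<d} r z w" and ?H' = "hfun n ({..<d} - {l}) r z w"
  let ?\<rho> = "rho n (w l)"
  have p: "w l permutes {..<n}" using w l by (rule W_perm)
  have H: "hermitian (2*n) ?H" "hermitian (2*n) ?H'"
    using W_perm[OF w] by (auto intro: hermitian_hfun)
  have diff: "shifted ?H \<eta> c e - shifted ?H' \<eta> c e = r * of_bool (?\<rho> c = e)" if "c < 2*n" for c e
  proof -
    have "(\<Sum>l'<d. of_bool (c < 2*n \<and> rho n (w l') c = e) :: complex)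
        = of_bool (?\<rho> c = e) + (\<Sum>l'\<in>{..<d} - {l}. of_bool (c < 2*n \<and> rho n (w l') c = e))"
      using l that by (subst sum.remove[of "{..<d}" l]) auto
    then show ?thesis by (simp add: shifted_def hfun_def algebra_simps)
  qed
  have "minor l w a b - G w a b = (\<Sum>c<2*n. \<Sum>e<2*n. minor l w a c * (shifted ?H \<eta> c e - shifted ?H' \<eta> c e) * G w e b)"
    unfolding minor_def G_def green_def
    by (rule inverse_difference) (use ab H \<eta> resolvent_shifted shifted_resolvent in auto)
  also have "\<dots> = (\<Sum>c<2*n. r * (minor l w a c * G w (?\<rho> c) b))"
  proof (intro sum.cong refl)
    fix c assume "c \<in> {..<2*n}"
    then have c: "c < 2*n" by simp
    have "(\<Sum>e<2*n. minor l w a c * (shifted ?H \<eta> c e - shifted ?H' \<eta> c e) * G w e b)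
        = (\<Sum>e<2*n. if e = ?\<rho> c then r * (minor l w a c * G w e b) else 0)"
      using c by (intro sum.cong) (auto simp: diff)
    then show "(\<Sum>e<2*n. minor l w a c * (shifted ?H \<eta> c e - shifted ?H' \<eta> c e) * G w e b) = r * (minor l w a c * G w (?\<rho> c) b)"
      using rho_less[OF p c] by simp
  qed
  also have "\<dots> = r * (\<Sum>c<2*n. minor l w a c * G w (?\<rho> c) b)" by (simp add: sum_distrib_left)
  also have "(\<Sum>c<2*n. minor l w a c * G w (?\<rho> c) b) = (\<Sum>c<2*n. minor l w a (?\<rho> c) * G w c b)"
    by (subst sum.reindex_bij_betw[OF bij_betw_rho[OF p], symmetric]) (simp add: rho_rho[OF p])
  finally show ?thesis by (simp add: algebra_simps)
qed

lemma G_minor_diff: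
  assumes w: "w \<in> W" and l: "l < d" and ab: "a < 2*n" "b < 2*n"
  shows "cmod (G w a b - minor l w a b) \<le> r / \<eta>\<^sup>2"
proof -
  have "cmod (\<Sum>c<2*n. minor l w a (rho n (w l) c) * G w c b) \<le> 1 / \<eta> * (1 / \<eta>)"
    using opb_entry[OF opb_mult[OF opb_permute_cols[OF opb_minor[OF w] bij_betw_rho[OF W_perm[OF w l]]] opb_G[OF w]] ab] .
  then have "r * cmod (\<Sum>c<2*n. minor l w a (rho n (w l) c) * G w c b) \<le> r * (1 / \<eta> * (1 / \<eta>))"
    using r(1) by (intro mult_left_mono) auto
  then show ?thesis using r(1) by (simp add: G_expand[OF w l ab] norm_mult power2_eq_square)
qed

text \<open>One iteration of \<open>G_expand\<close>. The remainder is \<open>r\<^sup>2\<close>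
  times a product of two column-permuted minors and one \<open>G\<close>, each of norm at most
  \<open>1 / \<eta>\<close>.\<close>

lemma G_expand2:
  assumes w: "w \<in> W" and l: "l < d" and ab: "a < 2*n" "b < 2*n"
  shows "cmod (G w a b - (minor l w a b - r * (\<Sum>c<2*n. minor l w a (rho n (w l) c) * minor l w c b))) \<le> r\<^sup>2 / \<eta>^3"
proof -
  let ?A = "minor l w" and ?A' = "\<lambda>a c. minor l w a (rho n (w l) c)"
  have opb_A': "opb (2*n) ?A' (1 / \<eta>)"
    by (rule opb_permute_cols[OF opb_minor[OF w] bij_betw_rho[OF W_perm[OF w l]]])
  have "(\<Sum>c<2*n. ?A' a c * G w c b) = (\<Sum>c<2*n. ?A' a c * (?A c b - r * (\<Sum>e<2*n. ?A' c e * G w e b)))"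
    by (intro sum.cong refl arg_cong2[of _ _ _ _ "(*)"] G_expand[OF w l]) (use ab in auto)
  also have "\<dots> = (\<Sum>c<2*n. ?A' a c * ?A c b) - r * (\<Sum>c<2*n. ?A' a c * (\<Sum>e<2*n. ?A' c e * G w e b))"
    by (simp add: right_diff_distrib sum_subtractf sum_distrib_left mult_ac)
  finally have X: "(\<Sum>c<2*n. ?A' a c * G w c b)
      = (\<Sum>c<2*n. ?A' a c * ?A c b) - r * (\<Sum>c<2*n. ?A' a c * (\<Sum>e<2*n. ?A' c e * G w e b))" .
  have "G w a b - (?A a b - r * (\<Sum>c<2*n. ?A' a c * ?A c b))
      = r\<^sup>2 * (\<Sum>c<2*n. ?A' a c * (\<Sum>e<2*n. ?A' c e * G w e b))"
    unfolding G_expand[OF w l ab] X by (simp add: algebra_simps power2_eq_square)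
  then have "cmod (G w a b - (?A a b - r * (\<Sum>c<2*n. ?A' a c * ?A c b)))
      = r\<^sup>2 * cmod (\<Sum>c<2*n. ?A' a c * (\<Sum>e<2*n. ?A' c e * G w e b))"
    by (simp add: norm_mult norm_power)
  also have "\<dots> \<le> r\<^sup>2 * (1 / \<eta> * (1 / \<eta> * (1 / \<eta>)))"
    using opb_entry[OF opb_mult[OF opb_A' opb_mult[OF opb_A' opb_G[OF w]]] ab] by (intro mult_left_mono) auto
  finally show ?thesis by (simp add: power3_eq_cube)
qed

lemma T_minor_traces: 
  assumes w: "w \<in> W" and \<kappa>: "\<kappa> = 0 \<or> \<kappa> = n"
  shows "(\<Sum>k<n. minor l w (\<kappa> + k) (\<kappa> + k)) / of_nat n = T 0 (minor l w)"
proof -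
  have "(\<Sum>i<n. minor l w i i) = (\<Sum>i<n. minor l w (n+i) (n+i))"
    unfolding minor_def green_def
    by (intro resolvent_block_traces_eq hermitian_hfun chiral_hfun) (use \<eta> W_perm[OF w] in auto)
  then show ?thesis using \<kappa> by (auto simp: T_def)
qed

text \<open>A block of the normalized trace of the permutation matrix times \<open>G\<close>, that
  is, what permutation \<open>l\<close> contributes to the traced equations below.\<close>

definition U :: "nat \<Rightarrow> nat \<Rightarrow> (nat \<Rightarrow> nat \<Rightarrow> nat) \<Rightarrow> complex" where
  "U \<kappa> l w = (\<Sum>i<n. G w (rho n (w l) (\<kappa> + i)) i) / of_nat n"

text \<open>Entries \<open>(i, i)\<close> and \<open>(n + i, i)\<close> of
  \<open>(\<i> \<eta> - H) G = 1\<close>, averaged over \<open>i\<close>.\<close>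

lemma row_equation:
  assumes w: "w \<in> W"
  shows "\<i> * \<eta> * T 0 (G w) - z * T n (G w) + r * (\<Sum>l<d. U 0 l w) = 1"
    and "\<i> * \<eta> * T n (G w) - cnj z * T 0 (G w) + r * (\<Sum>l<d. U n l w) = 0"
proof -
  let ?H = "hfun n {..<d} r z w"
  have H: "hermitian (2*n) ?H" using W_perm[OF w] by (auto intro: hermitian_hfun)
  have row: "\<i> * \<eta> * G w a b - ((if a < n then z * G w (n + a) b else cnj z * G w (a - n) b)
      - of_real r * (\<Sum>l<d. G w (rho n (w l) a) b)) = of_bool (a = b)" if ab: "a < 2*n" "b < 2*n" for a b
    using shifted_resolvent[OF H \<eta> ab] W_perm[OF w]
    unfolding sum_shifted_left[OF ab(1)] G_def green_def
    by (subst (asm) sum_hfun_left[OF _ ab(1)]) auto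
  have U_sum: "(\<Sum>l<d. U \<kappa> l w) = (\<Sum>i<n. \<Sum>l<d. G w (rho n (w l) (\<kappa> + i)) i) / of_nat n" for \<kappa>
    unfolding U_def by (subst sum.swap) (simp add: sum_divide_distrib)
  have nn: "of_nat n \<noteq> (0::complex)" using n by simp
  have "(\<Sum>i<n. \<i> * \<eta> * G w i i - z * G w (n + i) i + of_real r * (\<Sum>l<d. G w (rho n (w l) i) i)) = of_nat n"
  proof -
    have "\<i> * \<eta> * G w i i - z * G w (n + i) i + of_real r * (\<Sum>l<d. G w (rho n (w l) i) i) = 1" if "i < n" for i
      using row[of i i] that by (simp add: algebra_simps)
    then show ?thesis by simp
  qed
  then have "\<i> * \<eta> * (\<Sum>i<n. G w i i) - z * (\<Sum>i<n. G w (n + i) i) + r * (\<Sum>i<n. \<Sum>l<d. G w (rho n (w l) i) i) = of_nat n"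
    by (simp add: sum.distrib sum_subtractf sum_distrib_left)
  then show "\<i> * \<eta> * T 0 (G w) - z * T n (G w) + r * (\<Sum>l<d. U 0 l w) = 1"
    using nn unfolding U_sum T_def by (simp add: field_simps)
  have "(\<Sum>i<n. \<i> * \<eta> * G w (n + i) i - cnj z * G w i i + of_real r * (\<Sum>l<d. G w (rho n (w l) (n + i)) i)) = 0"
  proof -
    have "\<i> * \<eta> * G w (n + i) i - cnj z * G w i i + of_real r * (\<Sum>l<d. G w (rho n (w l) (n + i)) i) = 0" if "i < n" for i
      using row[of "n + i" i] that by (simp add: algebra_simps)
    then show ?thesis by simp
  qed
  then have "\<i> * \<eta> * (\<Sum>i<n. G w (n + i) i) - cnj z * (\<Sum>i<n. G w i i) + r * (\<Sum>i<n. \<Sum>l<d. G w (rho n (w l) (n + i)) i) = 0"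
    by (simp add: sum.distrib sum_subtractf sum_distrib_left)
  then show "\<i> * \<eta> * T n (G w) - cnj z * T 0 (G w) + r * (\<Sum>l<d. U n l w) = 0"
    using nn unfolding U_sum T_def by (simp add: field_simps)
qed

text \<open>In order: the first-order mean, with \<open>r * d = sqrt d\<close>; the off-diagonal
  part of the second order, with \<open>9 * sqrt 2 \<le> 13\<close>; and 3 = 1 + 2, namely the
  expansion remainder plus the passage from the minor to \<open>G\<close> in both factors of the
  product of traces.\<close>

definition err :: real where
  "err = sqrt d / (n * \<eta>) + 13 / (sqrt n * \<eta>\<^sup>2) + 3 / (sqrt d * \<eta>^3)"

text \<open>On average a permutation matrix has constant entries \<open>1 / n\<close> in its blocks,
  so only the total of a block of the minor survives, and that is at most
  \<open>n / \<eta>\<close>.\<close>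

lemma avg_first_order:
  assumes w: "w \<in> W" and \<kappa>: "\<kappa> = 0 \<or> \<kappa> = n"
  shows "cmod (avg P (\<lambda>p. (\<Sum>i<n. minor l w (rho n p (\<kappa> + i)) i) / of_nat n)) \<le> 1 / (n * \<eta>)"
proof -
  have "avg P (\<lambda>p. (\<Sum>i<n. minor l w (rho n p (\<kappa> + i)) i) / of_nat n)
      = (\<Sum>i<n. avg P (\<lambda>p. minor l w (rho n p (\<kappa> + i)) i)) / of_nat n"
    unfolding avg_sum[symmetric] by (simp only: avg_divide)
  also have "(\<Sum>i<n. avg P (\<lambda>p. minor l w (rho n p (\<kappa> + i)) i)) = (\<Sum>i<n. (\<Sum>k<n. minor l w (n - \<kappa> + k) i) / of_nat n)"
    using \<kappa> by (intro sum.cong refl avg_rho[of _ _ _ "\<lambda>a. minor l w a _"]) auto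
  also have "\<dots> = (\<Sum>k<n. \<Sum>i<n. minor l w (n - \<kappa> + k) (0 + i)) / of_nat n"
    by (subst sum.swap) (simp add: sum_divide_distrib)
  finally have "cmod (avg P (\<lambda>p. (\<Sum>i<n. minor l w (rho n p (\<kappa> + i)) i) / of_nat n))
      = cmod (\<Sum>k<n. \<Sum>i<n. minor l w (n - \<kappa> + k) (0 + i)) / (real n * real n)"
    by (simp add: norm_divide norm_mult)
  also have "\<dots> \<le> (1 / \<eta> * n) / (real n * real n)"
    using \<kappa> by (intro divide_right_mono block_sum_le[OF opb_minor[OF w]]) auto
  finally show ?thesis using n by (simp add: field_simps)
qed

text \<open>The terms \<open>c = \<kappa> + i\<close> produce the product of traces. In all others a
  weight of size \<open>9 / (n * \<eta>)\<close> meets a column of the minor, whose absolute sum is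
  at most \<open>sqrt (2 * n) / \<eta>\<close>.\<close>

lemma avg_second_order:
  assumes w: "w \<in> W" and \<kappa>: "\<kappa> = 0 \<or> \<kappa> = n"
  shows "cmod (avg P (\<lambda>p. (\<Sum>i<n. \<Sum>c<2*n. minor l w (rho n p (\<kappa> + i)) (rho n p c) * minor l w c i) / of_nat n)
      - T 0 (minor l w) * T \<kappa> (minor l w)) \<le> 13 / (sqrt n * \<eta>\<^sup>2)"
proof -
  let ?A = "minor l w"
  define E where "E a c = avg P (\<lambda>p. ?A (rho n p a) (rho n p c))" for a c
  \<comment> \<open>The image is uniform in the opposite half, whose normalized trace is the same by
    chirality.\<close>
  have E_diag: "E (\<kappa> + i) (\<kappa> + i) = T 0 ?A" if "i < n" for i
    unfolding E_def using avg_rho[OF \<kappa> that, of "\<lambda>a. ?A a a"] T_minor_traces[OF w, of "n - \<kappa>" l] \<kappa> by auto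
  have E_off: "cmod (E a c) \<le> 9 * (1 / \<eta>) / n" if "a < 2*n" "c < 2*n" "a \<noteq> c" for a c
    unfolding E_def by (rule avg_rho_offdiag_le[OF n opb_minor[OF w] that])
  have "avg P (\<lambda>p. (\<Sum>i<n. \<Sum>c<2*n. ?A (rho n p (\<kappa> + i)) (rho n p c) * ?A c i) / of_nat n)
      = (\<Sum>i<n. \<Sum>c<2*n. E (\<kappa> + i) c * ?A c i) / of_nat n"
    unfolding E_def avg_sum[symmetric] avg_mult_right[symmetric] by (simp only: avg_divide)
  also have "(\<Sum>i<n. \<Sum>c<2*n. E (\<kappa> + i) c * ?A c i)
      = (\<Sum>i<n. T 0 ?A * ?A (\<kappa> + i) i + (\<Sum>c\<in>{..<2*n} - {\<kappa> + i}. E (\<kappa> + i) c * ?A c i))"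
  proof (intro sum.cong refl)
    fix i assume "i \<in> {..<n}"
    then have i: "i < n" "\<kappa> + i \<in> {..<2*n}" using \<kappa> by auto
    show "(\<Sum>c<2*n. E (\<kappa> + i) c * ?A c i) = T 0 ?A * ?A (\<kappa> + i) i + (\<Sum>c\<in>{..<2*n} - {\<kappa> + i}. E (\<kappa> + i) c * ?A c i)"
      unfolding sum.remove[OF finite_lessThan i(2)] E_diag[OF i(1)] ..
  qed
  also have "\<dots> / of_nat n = T 0 ?A * T \<kappa> ?A + (\<Sum>i<n. \<Sum>c\<in>{..<2*n} - {\<kappa> + i}. E (\<kappa> + i) c * ?A c i) / of_nat n"
    by (simp add: sum.distrib sum_distrib_left T_def add_divide_distrib)
  finally have "avg P (\<lambda>p. (\<Sum>i<n. \<Sum>c<2*n. ?A (rho n p (\<kappa> + i)) (rho n p c) * ?A c i) / of_nat n) - T 0 ?A * T \<kappa> ?A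
      = (\<Sum>i<n. \<Sum>c\<in>{..<2*n} - {\<kappa> + i}. E (\<kappa> + i) c * ?A c i) / of_nat n" by simp
  also have "cmod \<dots> \<le> (\<Sum>i<n. 9 * (1 / \<eta>) / n * (sqrt (2 * n) * (1 / \<eta>))) / n"
  proof -
    have "cmod (\<Sum>i<n. \<Sum>c\<in>{..<2*n} - {\<kappa> + i}. E (\<kappa> + i) c * ?A c i) \<le> (\<Sum>i<n. 9 * (1 / \<eta>) / n * (sqrt (2 * n) * (1 / \<eta>)))"
    proof (rule order_trans[OF norm_sum sum_mono])
      fix i assume "i \<in> {..<n}"
      then have i: "i < n" by simp
      have "cmod (\<Sum>c\<in>{..<2*n} - {\<kappa> + i}. E (\<kappa> + i) c * ?A c i) \<le> (\<Sum>c\<in>{..<2*n} - {\<kappa> + i}. 9 * (1 / \<eta>) / n * cmod (?A c i))"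
        by (rule order_trans[OF norm_sum sum_mono], unfold norm_mult, intro mult_right_mono E_off) (use i \<kappa> in auto)
      also have "\<dots> \<le> (\<Sum>c<2*n. 9 * (1 / \<eta>) / n * cmod (?A c i))"
        using \<eta> by (intro sum_mono2) auto
      also have "\<dots> = 9 * (1 / \<eta>) / n * (\<Sum>c<2*n. cmod (?A c i))" by (simp only: sum_distrib_left)
      also have "\<dots> \<le> 9 * (1 / \<eta>) / n * (sqrt (2 * n) * (1 / \<eta>))"
        using opb_col_abs_sum[OF opb_minor[OF w], of "{..<2*n}" i l] i \<eta> by (intro mult_left_mono) auto
      finally show "cmod (\<Sum>c\<in>{..<2*n} - {\<kappa> + i}. E (\<kappa> + i) c * ?A c i) \<le> 9 * (1 / \<eta>) / n * (sqrt (2 * n) * (1 / \<eta>))" .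
    qed
    then show ?thesis by (simp only: norm_divide norm_of_nat) (rule divide_right_mono, auto)
  qed
  also have "\<dots> = 9 * sqrt 2 / (sqrt n * \<eta>\<^sup>2)"
    using n \<eta> by (simp add: real_sqrt_mult field_simps power2_eq_square)
  also have "\<dots> \<le> 13 / (sqrt n * \<eta>\<^sup>2)"
  proof -
    have "sqrt 2 \<le> 13 / 9" by (rule real_le_lsqrt) (auto simp: power2_eq_square)
    then show ?thesis using \<eta> n by (intro divide_right_mono) auto
  qed
  finally show ?thesis .
qed

text \<open>Resampling permutation \<open>l\<close> with the minor frozen splits the error into the
  first-order mean, the expansion remainder \<open>X\<close>, the exchange \<open>Y\<close> of
  traces of \<open>G\<close> for traces of the minor, and the off-diagonal second order.\<close>

lemma avg_U:
  assumes l: "l < d" and \<kappa>: "\<kappa> = 0 \<or> \<kappa> = n"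
  shows "cmod (avg W (\<lambda>w. U \<kappa> l w + r * (T 0 (G w) * T \<kappa> (G w)))) \<le> 1 / (n * \<eta>) + r * (13 / (sqrt n * \<eta>\<^sup>2)) + 3 * r\<^sup>2 / \<eta>^3"
proof -
  have "avg W (\<lambda>w. U \<kappa> l w + r * (T 0 (G w) * T \<kappa> (G w)))
      = avg W (\<lambda>w. avg P (\<lambda>p. U \<kappa> l (w(l := p)) + r * (T 0 (G (w(l := p))) * T \<kappa> (G (w(l := p))))))"
    using l finite_P by (intro avg_PiE_resample perms_nonempty) auto
  also have "cmod \<dots> \<le> 1 / (n * \<eta>) + r * (13 / (sqrt n * \<eta>\<^sup>2)) + 3 * r\<^sup>2 / \<eta>^3"
  proof (rule norm_avg_le[OF finite_W PiE_perms_nonempty])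
    fix w assume w: "w \<in> W"
    let ?A = "minor l w"
    let ?F = "\<lambda>p. (\<Sum>i<n. ?A (rho n p (\<kappa> + i)) i) / of_nat n"
    let ?S = "\<lambda>p. (\<Sum>i<n. \<Sum>c<2*n. ?A (rho n p (\<kappa> + i)) (rho n p c) * ?A c i) / of_nat n"
    let ?TT = "\<lambda>p. T 0 (G (w(l := p))) * T \<kappa> (G (w(l := p)))"
    define X where "X p = U \<kappa> l (w(l := p)) - (?F p - r * ?S p)" for p
    define Y where "Y p = ?TT p - T 0 ?A * T \<kappa> ?A" for p
    have X: "cmod (X p) \<le> r\<^sup>2 / \<eta>^3" if p: "p \<in> P" for p
    proof -
      have w': "w(l := p) \<in> W" using W_upd[OF w l p] .
      have "X p = (\<Sum>i<n. G (w(l := p)) (rho n p (\<kappa> + i)) i - (?A (rho n p (\<kappa> + i)) i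
          - r * (\<Sum>c<2*n. ?A (rho n p (\<kappa> + i)) (rho n p c) * ?A c i))) / of_nat n"
        unfolding X_def U_def
        by (simp add: sum_subtractf sum_distrib_left diff_divide_distrib sum_divide_distrib)
      moreover have "cmod (\<Sum>i<n. G (w(l := p)) (rho n p (\<kappa> + i)) i - (?A (rho n p (\<kappa> + i)) i
          - r * (\<Sum>c<2*n. ?A (rho n p (\<kappa> + i)) (rho n p c) * ?A c i))) \<le> (\<Sum>i<n. r\<^sup>2 / \<eta>^3)"
      proof (rule order_trans[OF norm_sum sum_mono])
        fix i assume "i \<in> {..<n}"
        then have "rho n p (\<kappa> + i) < 2*n" "i < 2*n" using \<kappa> p by (auto intro!: rho_less)
        from G_expand2[OF w' l this]
        show "cmod (G (w(l := p)) (rho n p (\<kappa> + i)) i - (?A (rho n p (\<kappa> + i)) i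
          - r * (\<Sum>c<2*n. ?A (rho n p (\<kappa> + i)) (rho n p c) * ?A c i))) \<le> r\<^sup>2 / \<eta>^3"
          by (simp add: minor_upd)
      qed
      ultimately have "cmod (X p) \<le> (\<Sum>i<n. r\<^sup>2 / \<eta>^3) / n"
        by (simp only: norm_divide norm_of_nat) (rule divide_right_mono, auto)
      then show ?thesis using n by simp
    qed
    have Y: "cmod (Y p) \<le> 2 * r / \<eta>^3" if p: "p \<in> P" for p
    proof -
      have w': "w(l := p) \<in> W" using W_upd[OF w l p] .
      let ?B = "G (w(l := p))"
      have diff: "cmod (T k ?B - T k ?A) \<le> r / \<eta>\<^sup>2" if "k = 0 \<or> k = n" for k
        unfolding T_diff using G_minor_diff[OF w' l] that by (intro cmod_T_le) (auto simp: minor_upd)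
      have "Y p = (T 0 ?B - T 0 ?A) * T \<kappa> ?B + T 0 ?A * (T \<kappa> ?B - T \<kappa> ?A)"
        by (simp add: Y_def algebra_simps)
      also have "cmod \<dots> \<le> r / \<eta>\<^sup>2 * (1 / \<eta>) + 1 / \<eta> * (r / \<eta>\<^sup>2)"
        by (rule order_trans[OF norm_triangle_ineq], unfold norm_mult,
            intro add_mono mult_mono diff cmod_T_le opb_entry[OF opb_G[OF w']] opb_entry[OF opb_minor[OF w]])
           (use \<kappa> r \<eta> in auto)
      also have "\<dots> = 2 * r / \<eta>^3" using \<eta> by (simp add: field_simps power2_eq_square power3_eq_cube)
      finally show ?thesis .
    qed
    have "U \<kappa> l (w(l := p)) + r * ?TT p = ?F p + (X p + (r * Y p - r * (?S p - T 0 ?A * T \<kappa> ?A)))" for p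
      by (simp add: X_def Y_def algebra_simps)
    then have eq: "avg P (\<lambda>p. U \<kappa> l (w(l := p)) + r * ?TT p)
        = avg P ?F + (avg P X + (r * avg P Y - r * (avg P ?S - T 0 ?A * T \<kappa> ?A)))"
      by (simp only: avg_add avg_diff avg_mult_left avg_const[OF finite_P perms_nonempty])
    have F_le: "cmod (avg P ?F) \<le> 1 / (n * \<eta>)" by (rule avg_first_order[OF w \<kappa>])
    have X_le: "cmod (avg P X) \<le> r\<^sup>2 / \<eta>^3" by (rule norm_avg_le[OF finite_P perms_nonempty X])
    have "cmod (avg P Y) \<le> 2 * r / \<eta>^3" by (rule norm_avg_le[OF finite_P perms_nonempty Y])
    then have Y_le: "cmod (r * avg P Y) \<le> r * (2 * r / \<eta>^3)" using r(1) by (simp only: norm_mult) (rule mult_mono, auto)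
    have S_le: "cmod (r * (avg P ?S - T 0 ?A * T \<kappa> ?A)) \<le> r * (13 / (sqrt n * \<eta>\<^sup>2))"
      using avg_second_order[OF w \<kappa>, of l] r(1) by (simp only: norm_mult) (rule mult_mono, auto)
    have "cmod (a + (b + (c - e))) \<le> cmod a + (cmod b + (cmod c + cmod e))" for a b c e
      by (intro order_trans[OF norm_triangle_ineq] add_mono order_refl norm_triangle_ineq4)
    from this[of "avg P ?F" "avg P X" "r * avg P Y" "r * (avg P ?S - T 0 ?A * T \<kappa> ?A)"]
    have le: "cmod (avg P (\<lambda>p. U \<kappa> l (w(l := p)) + r * ?TT p))
        \<le> 1 / (n * \<eta>) + (r\<^sup>2 / \<eta>^3 + (r * (2 * r / \<eta>^3) + r * (13 / (sqrt n * \<eta>\<^sup>2))))"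
      unfolding eq using F_le X_le Y_le S_le by linarith
    have "r * (2 * r / \<eta>^3) = 2 * (r\<^sup>2 / \<eta>^3)" "3 * r\<^sup>2 / \<eta>^3 = 3 * (r\<^sup>2 / \<eta>^3)"
      by (simp_all add: power2_eq_square)
    then show "cmod (avg P (\<lambda>p. U \<kappa> l (w(l := p)) + r * ?TT p))
        \<le> 1 / (n * \<eta>) + r * (13 / (sqrt n * \<eta>\<^sup>2)) + 3 * r\<^sup>2 / \<eta>^3"
      using le by linarith
  qed
  finally show ?thesis .
qed

text \<open>Since \<open>r\<^sup>2 * d = 1\<close>, the \<open>d\<close> copies of
  \<open>r * (T 0 * T \<kappa>)\<close>, weighted by another \<open>r\<close>, add up to exactly one
  product.\<close>

lemma avg_interaction:
  assumes \<kappa>: "\<kappa> = 0 \<or> \<kappa> = n"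
  shows "cmod (avg W (\<lambda>w. r * (\<Sum>l<d. U \<kappa> l w)) + avg W (\<lambda>w. T 0 (G w) * T \<kappa> (G w))) \<le> err"
proof -
  let ?t = "\<lambda>w. T 0 (G w) * T \<kappa> (G w)"
  let ?b = "1 / (n * \<eta>) + r * (13 / (sqrt n * \<eta>\<^sup>2)) + 3 * r\<^sup>2 / \<eta>^3"
  have "of_real r * of_real r * of_nat d = (1 :: complex)"
    using arg_cong[OF r(2), of complex_of_real] by (simp add: power2_eq_square)
  then have "r * (\<Sum>l<d. U \<kappa> l w) + ?t w = r * (\<Sum>l<d. U \<kappa> l w + r * ?t w)" for w
    by (simp add: sum.distrib distrib_left mult_ac)
  then have eq: "avg W (\<lambda>w. r * (\<Sum>l<d. U \<kappa> l w)) + avg W ?t = r * (\<Sum>l<d. avg W (\<lambda>w. U \<kappa> l w + r * ?t w))"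
    unfolding avg_add[symmetric] by (simp only: avg_mult_left[symmetric] avg_sum[symmetric])
  have "cmod (\<Sum>l<d. avg W (\<lambda>w. U \<kappa> l w + r * ?t w)) \<le> (\<Sum>l<d. ?b)"
    by (rule order_trans[OF norm_sum sum_mono], rule avg_U[OF _ \<kappa>]) simp
  then have le: "cmod (avg W (\<lambda>w. r * (\<Sum>l<d. U \<kappa> l w)) + avg W ?t) \<le> r * (d * ?b)"
    unfolding eq norm_mult using r(1) by (intro mult_mono) auto
  have "r * (d * (x + r * y + 3 * r\<^sup>2 / v)) = (r * d) * x + (r\<^sup>2 * d) * y + (r\<^sup>2 * d) * (3 * r / v)" for x y v :: real
    by (simp add: power2_eq_square algebra_simps)
  from this[of "1 / (n * \<eta>)" "13 / (sqrt n * \<eta>\<^sup>2)" "\<eta>^3"] have "r * (d * ?b) = err"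
    unfolding r(2,3) err_def by (simp only:) (simp add: r_def)
  with le show ?thesis by simp
qed

definition \<phi> :: "nat \<Rightarrow> complex" where "\<phi> \<kappa> = avg W (\<lambda>w. T \<kappa> (G w))"

lemma averaged_equations:
  "cmod (\<i> * \<eta> * \<phi> 0 - z * \<phi> n - avg W (\<lambda>w. T 0 (G w) * T 0 (G w)) - 1) \<le> err"
  "cmod (\<i> * \<eta> * \<phi> n - cnj z * \<phi> 0 - avg W (\<lambda>w. T 0 (G w) * T n (G w))) \<le> err"
proof -
  have "avg W (\<lambda>w. \<i> * \<eta> * T 0 (G w) - z * T n (G w) + r * (\<Sum>l<d. U 0 l w)) = avg W (\<lambda>_. 1)"
    by (intro avg_cong row_equation(1))
  then have 1: "\<i> * \<eta> * \<phi> 0 - z * \<phi> n + avg W (\<lambda>w. r * (\<Sum>l<d. U 0 l w)) = 1"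
    by (simp only: avg_add avg_diff avg_mult_left \<phi>_def avg_const[OF finite_W PiE_perms_nonempty])
  have "avg W (\<lambda>w. \<i> * \<eta> * T n (G w) - cnj z * T 0 (G w) + r * (\<Sum>l<d. U n l w)) = avg W (\<lambda>_. 0)"
    by (intro avg_cong row_equation(2))
  then have 2: "\<i> * \<eta> * \<phi> n - cnj z * \<phi> 0 + avg W (\<lambda>w. r * (\<Sum>l<d. U n l w)) = 0"
    by (simp only: avg_add avg_diff avg_mult_left \<phi>_def avg_const[OF finite_W PiE_perms_nonempty])
  have "\<i> * \<eta> * \<phi> 0 - z * \<phi> n - avg W (\<lambda>w. T 0 (G w) * T 0 (G w)) - 1
      = - (avg W (\<lambda>w. r * (\<Sum>l<d. U 0 l w)) + avg W (\<lambda>w. T 0 (G w) * T 0 (G w)))"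
    using 1 by (simp add: algebra_simps)
  then show "cmod (\<i> * \<eta> * \<phi> 0 - z * \<phi> n - avg W (\<lambda>w. T 0 (G w) * T 0 (G w)) - 1) \<le> err"
    using avg_interaction[of 0] by (simp only: norm_minus_cancel) simp
  have "\<i> * \<eta> * \<phi> n - cnj z * \<phi> 0 - avg W (\<lambda>w. T 0 (G w) * T n (G w))
      = - (avg W (\<lambda>w. r * (\<Sum>l<d. U n l w)) + avg W (\<lambda>w. T 0 (G w) * T n (G w)))"
    using 2 by (simp add: algebra_simps)
  then show "cmod (\<i> * \<eta> * \<phi> n - cnj z * \<phi> 0 - avg W (\<lambda>w. T 0 (G w) * T n (G w))) \<le> err"
    using avg_interaction[of n] by (simp only: norm_minus_cancel) simp
qed

end

section \<open>Concentration of the trace and the approximate cubic for its mean\<close>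

context perm_model
begin

definition g :: "(nat \<Rightarrow> nat \<Rightarrow> nat) \<Rightarrow> real" where "g w = - Im (T 0 (G w))"

definition gbar :: real where "gbar = avg W g"

lemma H_props:
  assumes "w \<in> W"
  shows "hermitian (2*n) (hfun n {..<d} r z w)" "chiral n (hfun n {..<d} r z w)"
  using W_perm[OF assms] by (auto intro: hermitian_hfun chiral_hfun)

lemma T_G_eq: "w \<in> W \<Longrightarrow> T 0 (G w) = - (\<i> * g w)"
proof -
  assume w: "w \<in> W"
  have "Re (G w i i) = 0" if "i < n" for i
    unfolding G_def green_def by (rule Re_resolvent_diag[OF H_props[OF w] \<eta>]) (use that in auto)
  then have "Re (T 0 (G w)) = 0" by (simp add: T_def)
  then show ?thesis by (simp add: g_def complex_eq_iff)
qed

lemma g_nonneg: "w \<in> W \<Longrightarrow> g w \<ge> 0"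
proof -
  assume w: "w \<in> W"
  have "Im (G w i i) \<le> 0" if "i < n" for i
    unfolding G_def green_def by (rule Im_resolvent_diag[OF H_props(1)[OF w] \<eta>]) (use that in auto)
  then have "(\<Sum>i<n. Im (G w i i)) \<le> 0" by (intro sum_nonpos) auto
  then show ?thesis by (simp add: g_def T_def divide_le_0_iff)
qed

lemma gbar_nonneg: "gbar \<ge> 0"
  unfolding gbar_def avg_def using g_nonneg by (simp add: sum_nonneg)

lemma \<phi>_0: "\<phi> 0 = - (\<i> * gbar)"
proof -
  have "\<phi> 0 = avg W (\<lambda>w. (- \<i>) * of_real (g w))"
    unfolding \<phi>_def by (intro avg_cong) (simp add: T_G_eq)
  also have "\<dots> = (- \<i>) * avg W (\<lambda>w. of_real (g w))" by (rule avg_mult_left)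
  also have "avg W (\<lambda>w. complex_of_real (g w)) = of_real gbar" by (simp add: gbar_def avg_def)
  finally show ?thesis by simp
qed

lemma T_full_trace: "w \<in> W \<Longrightarrow> (\<Sum>a<2*n. G w a a) / of_nat (2*n) = T 0 (G w)"
proof -
  assume w: "w \<in> W"
  have "(\<Sum>i<n. G w i i) = (\<Sum>i<n. G w (n+i) (n+i))"
    unfolding G_def green_def by (rule resolvent_block_traces_eq[OF H_props[OF w] \<eta>])
  then have "(\<Sum>a<2*n. G w a a) = 2 * (\<Sum>i<n. G w i i)" by (simp add: sum_lessThan_double)
  then show ?thesis by (simp add: T_def)
qed

lemma W_perm_space: "perm_space n d = W"
  by (simp add: perm_space_def)

lemma m_n_eq: "w \<in> W \<Longrightarrow> m_n n d z w (\<i> * of_real \<eta>) = - (\<i> * g w)"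
  using m_n_green[of w n d \<eta> z] \<eta> T_full_trace[of w] T_G_eq[of w]
  by (simp add: W_perm_space G_def r_def)

lemma W_transpose:
  assumes w: "w \<in> W" and "l < d" "i < n" "j < n"
  shows "w(l := w l \<circ> Transposition.transpose i j) \<in> W"
proof -
  have "w l \<circ> Transposition.transpose i j permutes {..<n}"
    using assms W_perm[OF w] by (intro permutes_compose permutes_swap_id) auto
  then show ?thesis using W_upd[OF w assms(2)] by blast
qed

text \<open>A transposition alters \<open>H\<close> in at most eight entries, each by \<open>r\<close>.\<close>

lemma g_transpose_diff:
  assumes w: "w \<in> W" and l: "l < d" and i: "i < n" and j: "j < n"
  shows "\<bar>g (w(l := w l \<circ> Transposition.transpose i j)) - g w\<bar> \<le> 4 * r / (n * \<eta>\<^sup>2)"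
proof -
  define p where "p = w l"
  define p' where "p' = p \<circ> Transposition.transpose i j"
  define w' where "w' = w(l := p')"
  \<comment> \<open>The indices at which \<open>rho\<close> can change: \<open>i\<close> and
    \<open>j\<close> in the upper half, their images in the lower half.\<close>
  define D where "D = {i, j, n + p i, n + p j}"
  let ?H = "hfun n {..<d} r z w" and ?H' = "hfun n {..<d} r z w'"
  have w': "w' \<in> W" using W_transpose[OF assms] by (simp add: w'_def p'_def p_def)
  have p: "p permutes {..<n}" using W_perm[OF w l] by (simp add: p_def)
  have p': "p' permutes {..<n}" using W_perm[OF w' l] by (simp add: w'_def)
  have D: "D \<subseteq> {..<2*n}" using i j permutes_in_image[OF p] by (auto simp: D_def)
  have rho_eq: "rho n p' c = rho n p c" if "c \<notin> D" for c
  proof (cases "c < n")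
    case True
    then show ?thesis using that by (simp add: rho_def p'_def D_def Transposition.transpose_def)
  next
    case False
    let ?k = "inv_into UNIV p (c - n)"
    have pk: "p ?k = c - n" using permutes_inverses(1)[OF p] .
    then have "?k \<noteq> i" "?k \<noteq> j" using that False by (auto simp: D_def)
    then have "p' ?k = c - n" using pk by (simp add: p'_def Transposition.transpose_def)
    then have "inv_into UNIV p' (c - n) = ?k" using permutes_inverses(2)[OF p'] by metis
    then show ?thesis using False by (simp add: rho_def)
  qed
  have diff: "shifted ?H' \<eta> c e - shifted ?H \<eta> c e = of_real r * (of_bool (rho n p' c = e) - of_bool (rho n p c = e))"
    if "c < 2*n" for c e
  proof -
    have "(\<Sum>l'<d. of_bool (c < 2*n \<and> rho n (v l') c = e) :: complex)
        = of_bool (rho n (v l) c = e) + (\<Sum>l'\<in>{..<d} - {l}. of_bool (c < 2*n \<and> rho n (v l') c = e))" for v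
      using l that by (subst sum.remove[of "{..<d}" l]) auto
    from this[of w] this[of w'] have "(\<Sum>l'<d. of_bool (c < 2*n \<and> rho n (w' l') c = e) :: complex)
        - (\<Sum>l'<d. of_bool (c < 2*n \<and> rho n (w l') c = e)) = of_bool (rho n p' c = e) - of_bool (rho n p c = e)"
      by (simp add: w'_def p_def)
    moreover have "(i - (a - r * X)) - (i - (a - r * Y)) = r * (X - Y)" for i a X Y :: complex
      by (simp add: algebra_simps)
    ultimately show ?thesis unfolding shifted_def hfun_def by (simp only:)
  qed
  \<comment> \<open>Cycling the trace tests the perturbation against entries of \<open>G w'\<close>
    times \<open>G w\<close>, each at most \<open>1 / \<eta>\<^sup>2\<close>. Four rows with two
    changed entries give \<open>8 * r / \<eta>\<^sup>2\<close>; normalizing by \<open>2 * n\<close>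
    gives the bound.\<close>
  define C where "C e c = (\<Sum>a<2*n. G w' e a * G w a c)" for e c
  have C: "cmod (C e c) \<le> 1 / \<eta>\<^sup>2" if "e < 2*n" "c < 2*n" for e c
    using opb_entry[OF opb_mult[OF opb_G[OF w'] opb_G[OF w]] that] by (simp add: C_def power2_eq_square)
  have "(\<Sum>a<2*n. G w a a) - (\<Sum>a<2*n. G w' a a)
      = (\<Sum>a<2*n. \<Sum>c<2*n. \<Sum>e<2*n. G w a c * (shifted ?H' \<eta> c e - shifted ?H \<eta> c e) * G w' e a)"
    unfolding sum_subtractf[symmetric] G_def green_def
    by (intro sum.cong refl inverse_difference)
       (use H_props(1)[OF w] H_props(1)[OF w'] \<eta> resolvent_shifted shifted_resolvent in auto)
  also have "\<dots> = (\<Sum>c<2*n. \<Sum>a<2*n. \<Sum>e<2*n. G w a c * (shifted ?H' \<eta> c e - shifted ?H \<eta> c e) * G w' e a)"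
    by (rule sum.swap)
  also have "\<dots> = (\<Sum>c<2*n. \<Sum>e<2*n. \<Sum>a<2*n. G w a c * (shifted ?H' \<eta> c e - shifted ?H \<eta> c e) * G w' e a)"
    by (intro sum.cong refl sum.swap)
  also have "\<dots> = (\<Sum>c<2*n. \<Sum>e<2*n. (shifted ?H' \<eta> c e - shifted ?H \<eta> c e) * C e c)"
    by (simp add: C_def sum_distrib_left mult_ac)
  also have "\<dots> = (\<Sum>c<2*n. r * (C (rho n p' c) c - C (rho n p c) c))"
  proof (intro sum.cong refl)
    fix c assume "c \<in> {..<2*n}"
    then have c: "c < 2*n" by simp
    have "(\<Sum>e<2*n. (shifted ?H' \<eta> c e - shifted ?H \<eta> c e) * C e c)
        = r * ((\<Sum>e<2*n. of_bool (rho n p' c = e) * C e c) - (\<Sum>e<2*n. of_bool (rho n p c = e) * C e c))"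
      by (simp only: diff[OF c] sum_subtractf[symmetric] sum_distrib_left left_diff_distrib mult.assoc)
    also have "(\<Sum>e<2*n. of_bool (rho n p' c = e) * C e c) = C (rho n p' c) c"
      using rho_less[OF p' c] by simp
    also have "(\<Sum>e<2*n. of_bool (rho n p c = e) * C e c) = C (rho n p c) c"
      using rho_less[OF p c] by simp
    finally show "(\<Sum>e<2*n. (shifted ?H' \<eta> c e - shifted ?H \<eta> c e) * C e c) = r * (C (rho n p' c) c - C (rho n p c) c)" .
  qed
  also have "\<dots> = (\<Sum>c\<in>D. r * (C (rho n p' c) c - C (rho n p c) c))"
    using D by (intro sum.mono_neutral_right) (auto simp: rho_eq)
  finally have tr: "(\<Sum>a<2*n. G w a a) - (\<Sum>a<2*n. G w' a a) = (\<Sum>c\<in>D. r * (C (rho n p' c) c - C (rho n p c) c))" .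
  have "cmod (\<Sum>c\<in>D. r * (C (rho n p' c) c - C (rho n p c) c)) \<le> (\<Sum>c\<in>D. 2 * r / \<eta>\<^sup>2)"
  proof (rule order_trans[OF norm_sum sum_mono])
    fix c assume "c \<in> D"
    then have c: "c < 2*n" using D by auto
    have "cmod (C (rho n p' c) c - C (rho n p c) c) \<le> 1 / \<eta>\<^sup>2 + 1 / \<eta>\<^sup>2"
      by (intro order_trans[OF norm_triangle_ineq4] add_mono C c rho_less[OF p c] rho_less[OF p' c])
    then have "r * cmod (C (rho n p' c) c - C (rho n p c) c) \<le> r * (1 / \<eta>\<^sup>2 + 1 / \<eta>\<^sup>2)"
      using r(1) by (intro mult_left_mono) auto
    then show "cmod (r * (C (rho n p' c) c - C (rho n p c) c)) \<le> 2 * r / \<eta>\<^sup>2"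
      using r(1) by (simp add: norm_mult mult.commute)
  qed
  also have "\<dots> = card D * (2 * r / \<eta>\<^sup>2)" by simp
  also have "\<dots> \<le> 4 * (2 * r / \<eta>\<^sup>2)"
  proof (intro mult_right_mono)
    have "card D \<le> 4"
      unfolding D_def by (intro order_trans[OF card_insert_le_m1]) auto
    then show "real (card D) \<le> 4" by simp
  qed (use r(1) in auto)
  finally have tr_le: "cmod ((\<Sum>a<2*n. G w a a) - (\<Sum>a<2*n. G w' a a)) \<le> 8 * r / \<eta>\<^sup>2" by (simp add: tr)
  have "\<bar>g w' - g w\<bar> \<le> cmod (T 0 (G w) - T 0 (G w'))"
    using abs_Im_le_cmod[of "T 0 (G w) - T 0 (G w')"] by (simp add: g_def)
  also have "\<dots> = cmod ((\<Sum>a<2*n. G w a a) - (\<Sum>a<2*n. G w' a a)) / (2 * n)"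
    unfolding T_full_trace[OF w, symmetric] T_full_trace[OF w', symmetric] diff_divide_distrib[symmetric] norm_divide norm_of_nat
    by simp
  also have "\<dots> \<le> 8 * r / \<eta>\<^sup>2 / (2 * n)"
    using tr_le by (intro divide_right_mono) auto
  finally show ?thesis by (simp add: w'_def p'_def p_def)
qed

text \<open>The exponent is \<open>d * n * s\<^sup>2 / 2\<close> with \<open>s\<close> from
  \<open>g_transpose_diff\<close>; because \<open>r\<^sup>2 * d = 1\<close> it is independent of
  \<open>d\<close>.\<close>

lemma g_mgf: "avg W (\<lambda>w. exp (t * (g w - gbar))) \<le> exp (t\<^sup>2 * (8 / (n * \<eta>^4)))"
proof -
  let ?s = "4 * r / (n * \<eta>\<^sup>2)"
  have "avg W (\<lambda>w. exp (t * g w)) \<le> exp (t * avg W g + t\<^sup>2 * (real (card {..<d}) * real (card {..<n}) * ?s\<^sup>2 / 2))"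
    by (rule avg_exp_PiE_perms) (use g_transpose_diff r(1) in auto)
  also have "real (card {..<d}) * real (card {..<n}) * ?s\<^sup>2 / 2 = 8 * (r\<^sup>2 * d) / (n * \<eta>^4)"
    using n by (simp add: power_divide power_mult_distrib field_simps power2_eq_square numeral_eq_Suc)
  finally have "avg W (\<lambda>w. exp (t * g w)) \<le> exp (t * gbar) * exp (t\<^sup>2 * (8 / (n * \<eta>^4)))"
    unfolding r(2) by (simp add: gbar_def exp_add)
  then have "avg W (\<lambda>w. exp (t * g w)) * exp (- (t * gbar)) \<le> exp (t\<^sup>2 * (8 / (n * \<eta>^4)))"
    by (simp add: exp_minus field_simps)
  then show ?thesis
    by (simp only: avg_mult_right[symmetric] exp_add[symmetric] right_diff_distrib add_uminus_conv_diff)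
qed

lemma g_abs_dev: "avg W (\<lambda>w. \<bar>g w - gbar\<bar>) \<le> 17 / (sqrt n * \<eta>\<^sup>2)"
proof -
  have "avg W (\<lambda>w. \<bar>g w - gbar\<bar>) \<le> 2 * exp 1 * sqrt (8 / (n * \<eta>^4))"
    using n \<eta> by (intro avg_abs_le_of_mgf g_mgf) auto
  also have "sqrt (8 / (n * \<eta>^4)) = sqrt 8 / (sqrt n * \<eta>\<^sup>2)"
    by (simp add: real_sqrt_divide real_sqrt_mult power4_eq_xxxx power2_eq_square)
       (simp add: real_sqrt_mult[symmetric] mult.assoc)
  also have "2 * exp 1 * (sqrt 8 / (sqrt n * \<eta>\<^sup>2)) \<le> 17 / (sqrt n * \<eta>\<^sup>2)"
  proof -
    have "sqrt 8 \<le> 17 / 6" by (rule real_le_lsqrt) (auto simp: power2_eq_square)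
    then have "2 * exp 1 * sqrt 8 \<le> 2 * 3 * (17 / 6)"
      using exp_le by (intro mult_mono) auto
    then show ?thesis using divide_right_mono[of "2 * exp 1 * sqrt 8" 17 "sqrt n * \<eta>\<^sup>2"] by simp
  qed
  finally show ?thesis .
qed

lemma g_tail:
  assumes "u > 0"
  shows "avg W (\<lambda>w. of_bool (\<bar>g w - gbar\<bar> \<ge> u)) \<le> 2 * exp (- (u\<^sup>2 * n * \<eta>^4 / 32))"
proof -
  have "avg W (\<lambda>w. of_bool (\<bar>g w - gbar\<bar> \<ge> u)) \<le> 2 * exp (- (u\<^sup>2 / (4 * (8 / (n * \<eta>^4)))))"
    using n \<eta> assms by (intro avg_tail_of_mgf g_mgf) auto
  then show ?thesis by (simp add: field_simps)
qed

definition err' :: real where "err' = err + 17 / (sqrt n * \<eta>^3)"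

text \<open>A covariance with one centred factor: \<open>T 0 - \<phi> 0\<close> is small in mean
  absolute value and \<open>T \<kappa>\<close> is bounded by \<open>1 / \<eta>\<close>, so
  concentration of \<open>T 0\<close> settles both values of \<kappa>.\<close>

lemma product_decouple:
  assumes \<kappa>: "\<kappa> = 0 \<or> \<kappa> = n"
  shows "cmod (avg W (\<lambda>w. T 0 (G w) * T \<kappa> (G w)) - \<phi> 0 * \<phi> \<kappa>) \<le> 17 / (sqrt n * \<eta>^3)"
proof -
  have eq: "avg W (\<lambda>w. T 0 (G w) * T \<kappa> (G w)) - \<phi> 0 * \<phi> \<kappa> = avg W (\<lambda>w. (T 0 (G w) - \<phi> 0) * T \<kappa> (G w))"
    unfolding left_diff_distrib avg_diff avg_mult_left \<phi>_def ..
  have "cmod (avg W (\<lambda>w. (T 0 (G w) - \<phi> 0) * T \<kappa> (G w))) \<le> avg W (\<lambda>w. \<bar>g w - gbar\<bar> * (1 / \<eta>))"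
  proof (rule order_trans[OF norm_avg avg_mono])
    fix w assume w: "w \<in> W"
    have "T 0 (G w) - \<phi> 0 = - (\<i> * of_real (g w - gbar))"
      by (simp add: T_G_eq[OF w] \<phi>_0 algebra_simps)
    then have "cmod (T 0 (G w) - \<phi> 0) = \<bar>g w - gbar\<bar>" by (simp only: norm_minus_cancel norm_mult norm_ii norm_of_real mult_1_left)
    then show "cmod ((T 0 (G w) - \<phi> 0) * T \<kappa> (G w)) \<le> \<bar>g w - gbar\<bar> * (1 / \<eta>)"
      unfolding norm_mult using \<kappa> by (intro mult_mono cmod_T_le opb_entry[OF opb_G[OF w]]) auto
  qed
  also have "\<dots> = avg W (\<lambda>w. \<bar>g w - gbar\<bar>) * (1 / \<eta>)" by (rule avg_mult_right)
  also have "\<dots> \<le> 17 / (sqrt n * \<eta>\<^sup>2) * (1 / \<eta>)"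
    using g_abs_dev \<eta> by (intro mult_right_mono) auto
  finally show ?thesis unfolding eq by (simp add: power2_eq_square power3_eq_cube mult.assoc)
qed

text \<open>Eliminates \<open>\<phi> n\<close> by adding \<open>\<i> * \<eta> - \<phi> 0\<close>
  times the first equation and \<open>z\<close> times the second. The errors acquire these factors,
  of modulus \<open>\<eta> + gbar\<close> and \<open>cmod z\<close>.\<close>

lemma gbar_cubic:
  "\<bar>gbar * (\<eta> + gbar)\<^sup>2 - (1 - (cmod z)\<^sup>2) * gbar - \<eta>\<bar> \<le> err' * (\<eta> + gbar + cmod z)"
proof -
  define \<epsilon>1 where "\<epsilon>1 = \<i> * \<eta> * \<phi> 0 - z * \<phi> n - \<phi> 0 * \<phi> 0 - 1"
  define \<epsilon>2 where "\<epsilon>2 = \<i> * \<eta> * \<phi> n - cnj z * \<phi> 0 - \<phi> 0 * \<phi> n"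
  have e1_eq: "\<epsilon>1 = (\<i> * \<eta> * \<phi> 0 - z * \<phi> n - avg W (\<lambda>w. T 0 (G w) * T 0 (G w)) - 1)
      + (avg W (\<lambda>w. T 0 (G w) * T 0 (G w)) - \<phi> 0 * \<phi> 0)" by (simp add: \<epsilon>1_def)
  have e1: "cmod \<epsilon>1 \<le> err'"
    unfolding e1_eq err'_def by (rule norm_triangle_mono[OF averaged_equations(1) product_decouple]) simp
  have e2_eq: "\<epsilon>2 = (\<i> * \<eta> * \<phi> n - cnj z * \<phi> 0 - avg W (\<lambda>w. T 0 (G w) * T n (G w)))
      + (avg W (\<lambda>w. T 0 (G w) * T n (G w)) - \<phi> 0 * \<phi> n)" by (simp add: \<epsilon>2_def)
  have e2: "cmod \<epsilon>2 \<le> err'"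
    unfolding e2_eq err'_def by (rule norm_triangle_mono[OF averaged_equations(2) product_decouple]) simp
  have "\<phi> 0 * (\<i> * \<eta> - \<phi> 0)\<^sup>2 + (1 - z * cnj z) * \<phi> 0 - \<i> * \<eta> = \<epsilon>1 * (\<i> * \<eta> - \<phi> 0) + z * \<epsilon>2"
    by (simp add: \<epsilon>1_def \<epsilon>2_def algebra_simps power2_eq_square)
  moreover have "\<phi> 0 * (\<i> * \<eta> - \<phi> 0)\<^sup>2 + (1 - z * cnj z) * \<phi> 0 - \<i> * \<eta>
      = \<i> * of_real (gbar * (\<eta> + gbar)\<^sup>2 - (1 - (cmod z)\<^sup>2) * gbar - \<eta>)"
    unfolding \<phi>_0 complex_norm_square[symmetric]
    by (simp add: complex_eq_iff power2_eq_square algebra_simps)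
  moreover have "cmod (\<i> * \<eta> - \<phi> 0) = \<eta> + gbar"
  proof -
    have "\<i> * \<eta> - \<phi> 0 = \<i> * of_real (\<eta> + gbar)" by (simp add: \<phi>_0 algebra_simps)
    then show ?thesis using \<eta> gbar_nonneg by (simp only: norm_mult norm_ii norm_of_real) simp
  qed
  ultimately have "\<bar>gbar * (\<eta> + gbar)\<^sup>2 - (1 - (cmod z)\<^sup>2) * gbar - \<eta>\<bar> = cmod (\<epsilon>1 * (\<i> * \<eta> - \<phi> 0) + z * \<epsilon>2)"
    by (metis norm_mult norm_ii norm_of_real mult_1)
  also have "\<dots> \<le> err' * (\<eta> + gbar) + cmod z * err'"
    by (rule order_trans[OF norm_triangle_ineq], unfold norm_mult \<open>cmod (\<i> * \<eta> - \<phi> 0) = \<eta> + gbar\<close>)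
       (intro add_mono mult_mono e1 e2, use \<eta> gbar_nonneg order_trans[OF norm_ge_zero e1] in auto)
  finally show ?thesis by (simp add: algebra_simps)
qed

end

lemma g_lipschitz:
  assumes "n \<ge> 2" "d \<ge> 1" "\<eta> > 0" "\<eta>' > 0" "w \<in> PiE {..<d} (\<lambda>_. perms {..<n})"
  shows "\<bar>perm_model.g n d z \<eta> w - perm_model.g n d z \<eta>' w\<bar> \<le> \<bar>\<eta> - \<eta>'\<bar> / (\<eta> * \<eta>')"
proof -
  interpret A: perm_model n d z \<eta> by unfold_locales (use assms in auto)
  interpret B: perm_model n d z \<eta>' by unfold_locales (use assms in auto)
  have "cmod (A.T 0 (\<lambda>a b. A.G w a b - B.G w a b)) \<le> \<bar>\<eta> - \<eta>'\<bar> / (\<eta> * \<eta>')"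
    unfolding A.G_def B.G_def green_def
    by (intro A.cmod_T_le resolvent_lipschitz) (use assms A.H_props(1) in auto)
  moreover have "A.T 0 (\<lambda>a b. A.G w a b - B.G w a b) = A.T 0 (A.G w) - A.T 0 (B.G w)" by (simp add: A.T_diff)
  ultimately show ?thesis
    using abs_Im_le_cmod[of "A.T 0 (A.G w) - A.T 0 (B.G w)"] by (simp add: A.g_def B.g_def)
qed

lemma gbar_lipschitz:
  assumes "n \<ge> 2" "d \<ge> 1" "\<eta> > 0" "\<eta>' > 0"
  shows "\<bar>perm_model.gbar n d z \<eta> - perm_model.gbar n d z \<eta>'\<bar> \<le> \<bar>\<eta> - \<eta>'\<bar> / (\<eta> * \<eta>')"
proof -
  interpret A: perm_model n d z \<eta> by unfold_locales (use assms in auto)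
  interpret B: perm_model n d z \<eta>' by unfold_locales (use assms in auto)
  have "norm (avg A.W (\<lambda>w. A.g w - B.g w)) \<le> \<bar>\<eta> - \<eta>'\<bar> / (\<eta> * \<eta>')"
    by (rule norm_avg_le[OF A.finite_W PiE_perms_nonempty]) (use g_lipschitz[OF assms] in auto)
  then show ?thesis by (simp add: avg_diff A.gbar_def B.gbar_def)
qed

section \<open>The cubic and its probabilistic solution\<close>

text \<open>The equation of the limit at \<open>\<xi> = \<i> * \<eta>\<close>,
  \<open>m = - \<i> * x\<close>, divided by \<open>\<i>\<close>, with \<open>a\<close> in the role
  of \<open>1 - (cmod z)\<^sup>2\<close>.\<close>

definition cubic :: "real \<Rightarrow> real \<Rightarrow> real \<Rightarrow> real" where
  "cubic a \<eta> x = x * (\<eta> + x)\<^sup>2 - a * x - \<eta>"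

definition cubic_root :: "real \<Rightarrow> real \<Rightarrow> real" where
  "cubic_root a \<eta> = (SOME x. x > 0 \<and> cubic a \<eta> x = 0)"

lemma cubic_root:
  assumes "\<eta> > 0"
  shows "cubic_root a \<eta> > 0" "cubic a \<eta> (cubic_root a \<eta>) = 0"
proof -
  \<comment> \<open>Large enough for \<open>(\<eta> + M)\<^sup>2 - a \<ge> 1\<close> and
    \<open>M \<ge> \<eta>\<close>, so that the cubic is nonnegative at \<open>M\<close>.\<close>
  define M where "M = 1 + \<bar>a\<bar> + \<eta>"
  have M: "M \<ge> 1" "M \<ge> 1 + a" "M \<ge> \<eta> + 1" using assms by (auto simp: M_def)
  have "M \<le> M * M" using M(1) by (simp add: mult_le_cancel_left1)
  also have "\<dots> \<le> (\<eta> + M)\<^sup>2" using M assms unfolding power2_eq_square by (intro mult_mono) auto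
  finally have "1 \<le> (\<eta> + M)\<^sup>2 - a" using M by linarith
  then have "M * 1 \<le> M * ((\<eta> + M)\<^sup>2 - a)" using M(1) by (intro mult_left_mono) auto
  then have "cubic a \<eta> M \<ge> 0" using M(3) by (simp add: cubic_def algebra_simps)
  moreover have "cubic a \<eta> 0 \<le> 0" using assms by (simp add: cubic_def)
  moreover have "continuous_on {0..M} (cubic a \<eta>)"
    unfolding cubic_def by (intro continuous_intros)
  ultimately obtain x where x: "0 \<le> x" "x \<le> M" "cubic a \<eta> x = 0"
    using IVT'[of "cubic a \<eta>" 0 0 M] M(1) by auto
  moreover have "x \<noteq> 0" using x assms by (auto simp: cubic_def)
  ultimately have "\<exists>x. x > 0 \<and> cubic a \<eta> x = 0" by (intro exI[of _ x]) auto
  from someI_ex[OF this] show "cubic_root a \<eta> > 0" "cubic a \<eta> (cubic_root a \<eta>) = 0"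
    by (simp_all add: cubic_root_def)
qed

text \<open>The root \<open>h\<close> eliminates
  \<open>a = (\<eta> + h)\<^sup>2 - \<eta> / h\<close>. For \<eta> > 0 and \<open>x \<ge> 0\<close>
  the second factor is then visibly positive whatever the sign of \<open>a\<close>, which makes the
  positive root unique.\<close>

lemma cubic_factor:
  assumes "h > 0" "cubic a \<eta> h = 0"
  shows "cubic a \<eta> x = (x - h) * (x * (2 * \<eta> + x + h) + \<eta> / h)"
proof -
  have "a * h = h * (\<eta> + h)\<^sup>2 - \<eta>" using assms by (simp add: cubic_def)
  then have a: "a = (\<eta> + h)\<^sup>2 - \<eta> / h" using assms by (simp add: field_simps)
  show ?thesis using assms(1) unfolding cubic_def a
    by (simp add: field_simps power2_eq_square)
qed

text \<open>Two lower bounds for the second factor of \<open>cubic_factor\<close>. The first stays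
  useful as \<eta> tends to 0, provided \<open>x\<close> is bounded below; the second serves at
  fixed \<eta> for every nonnegative \<open>x\<close>.\<close>

lemma cubic_stability:
  assumes \<eta>: "\<eta> > 0" and x: "x \<ge> 0" and h: "h > 0" "cubic a \<eta> h = 0"
  shows "\<bar>x - h\<bar> * x\<^sup>2 \<le> \<bar>cubic a \<eta> x\<bar>" "\<bar>x - h\<bar> * (\<eta> / h) \<le> \<bar>cubic a \<eta> x\<bar>"
proof -
  have "0 \<le> x * (2 * \<eta> + h)" "0 \<le> \<eta> / h" using assms by auto
  then have "x\<^sup>2 \<le> \<bar>x * (2 * \<eta> + x + h) + \<eta> / h\<bar>" "\<eta> / h \<le> \<bar>x * (2 * \<eta> + x + h) + \<eta> / h\<bar>"
    by (auto simp: power2_eq_square algebra_simps)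
       (smt (verit) zero_le_square)
  note bounds = this
  show "\<bar>x - h\<bar> * x\<^sup>2 \<le> \<bar>cubic a \<eta> x\<bar>"
    unfolding cubic_factor[OF h] abs_mult by (rule mult_left_mono[OF bounds(1) abs_ge_zero])
  show "\<bar>x - h\<bar> * (\<eta> / h) \<le> \<bar>cubic a \<eta> x\<bar>"
    unfolding cubic_factor[OF h] abs_mult by (rule mult_left_mono[OF bounds(2) abs_ge_zero])
qed

lemma cubic_root_unique:
  assumes "\<eta> > 0" "x > 0" "cubic a \<eta> x = 0"
  shows "x = cubic_root a \<eta>"
  using cubic_stability(1)[OF assms(1) less_imp_le[OF assms(2)] cubic_root[OF assms(1), of a]] assms
  by (simp add: mult_le_0_iff)

text \<open>A barrier: at height \<open>\<epsilon> / 4\<close> the cubic is below a fixed negative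
  number for all \<open>s\<close> in [0, 1], so a sufficiently accurate approximate solution that is
  continuous in \<open>s\<close> cannot cross this height.\<close>

lemma cubic_at_threshold:
  assumes "0 \<le> s" "s \<le> 1" "0 < \<epsilon>" "\<epsilon> \<le> 1" "\<epsilon> \<le> a"
  shows "cubic a s (\<epsilon> / 4) \<le> - (3 / 4 * (\<epsilon> / 4) * \<epsilon>)"
proof -
  define t where "t = \<epsilon> / 4"
  have t: "0 < t" "t \<le> 1 / 4" "\<epsilon> = 4 * t" using assms by (auto simp: t_def)
  have "s * s \<le> s" using assms by (simp add: mult_left_le)
  then have 1: "t * (s * s) \<le> s / 4" using t mult_mono[of t "1/4" "s * s" s] assms by simp
  have 2: "t * t \<le> 1 / 16" using mult_mono[of t "1/4" t "1/4"] t by simp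
  then have 3: "2 * s * (t * t) \<le> s / 8" using mult_left_mono[of "t * t" "1/16" "2 * s"] assms by simp
  have 4: "t * (t * t) \<le> t * t / 4" using mult_right_mono[of t "1/4" "t * t"] t by simp
  have 5: "t * (4 * t) \<le> a * t" using assms t by (simp add: mult.commute mult_right_mono)
  have "cubic a s t = t * (s * s) + 2 * s * (t * t) + t * (t * t) - a * t - s"
    by (simp add: cubic_def power2_eq_square algebra_simps)
  also have "\<dots> \<le> - (3 * (t * t))"
    using 1 3 4 5 assms(1) zero_le_square[of t] by linarith
  finally show ?thesis by (simp add: t_def power2_eq_square)
qed

text \<open>Near \<open>\<eta> = 0\<close> the perturbed cubic could also have a solution close to \<open>0\<close>; continuity in \<open>\<eta>\<close>,
  starting from \<open>\<eta> = 1\<close> where there is no such solution, rules it out.\<close>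

lemma cubic_bulk_stability:
  fixes x e :: "real \<Rightarrow> real"
  assumes \<eta>: "0 < \<eta>" "\<eta> \<le> 1" and \<epsilon>: "0 < \<epsilon>" "\<epsilon> \<le> 1" "\<epsilon> \<le> a"
    and cont: "continuous_on {\<eta>..1} x" and nonneg: "\<And>s. s \<in> {\<eta>..1} \<Longrightarrow> x s \<ge> 0"
    and approx: "\<And>s. s \<in> {\<eta>..1} \<Longrightarrow> \<bar>cubic a s (x s)\<bar> \<le> e s * (s + x s + 1)"
    and small: "\<And>s. s \<in> {\<eta>..1} \<Longrightarrow> 0 \<le> e s \<and> e s < \<epsilon>\<^sup>2 / 32"
  shows "\<bar>x \<eta> - cubic_root a \<eta>\<bar> \<le> e \<eta> * (48 / \<epsilon>\<^sup>2)"
proof -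
  define t where "t = \<epsilon> / 4"
  have t: "0 < t" "t \<le> 1 / 4" using \<epsilon> by (auto simp: t_def)
  \<comment> \<open>The factor 3 bounds \<open>s + t + 1\<close>; then
    \<open>3 * \<epsilon>\<^sup>2 / 32\<close> is below the barrier depth
    \<open>3 * \<epsilon>\<^sup>2 / 16\<close>.\<close>
  have e_small: "e s * 3 < 3 / 4 * t * \<epsilon>" "e s \<ge> 0" "e s \<le> 1 / 32" if "s \<in> {\<eta>..1}" for s
    using small[OF that] \<epsilon> power_le_one[of \<epsilon> 2] by (auto simp: t_def power2_eq_square)
  have ne: "x s \<noteq> t" if s: "s \<in> {\<eta>..1}" for s
  proof
    assume eq: "x s = t"
    have "cubic a s t \<le> - (3 / 4 * t * \<epsilon>)"
      unfolding t_def by (rule cubic_at_threshold) (use s \<eta> \<epsilon> in auto)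
    then have "3 / 4 * t * \<epsilon> \<le> e s * (s + t + 1)"
      using approx[OF s] by (simp add: eq)
    also have "\<dots> \<le> e s * 3" using e_small(2)[OF s] s t by (intro mult_left_mono) auto
    finally show False using e_small(1)[OF s] by linarith
  qed
  \<comment> \<open>At \<open>s = 1\<close> a value up to 1/4 makes the cubic at most
    \<open>1/4 * (5/4)\<^sup>2 - 1 < - 1/2\<close>, more than the allowed error 3/32.\<close>
  have "x 1 > t"
  proof (rule ccontr)
    assume "\<not> x 1 > t"
    then have x1: "x 1 \<le> 1 / 4" "0 \<le> x 1" using t nonneg[of 1] \<eta> by auto
    have "x 1 * (1 + x 1)\<^sup>2 \<le> 1 / 4 * (1 + 1 / 4)\<^sup>2"
      using x1 by (intro mult_mono power_mono) auto
    moreover have "0 \<le> a * x 1" using x1 \<epsilon> by simp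
    ultimately have "cubic a 1 (x 1) \<le> - 1 / 2" by (simp add: cubic_def power2_eq_square)
    then have "1 / 2 \<le> e 1 * (1 + x 1 + 1)" using approx[of 1] \<eta> by auto
    also have "\<dots> \<le> 1 / 32 * 3" using e_small[of 1] x1 \<eta> by (intro mult_mono) auto
    finally show False by simp
  qed
  have x_gt: "x \<eta> > t"
  proof (rule ccontr)
    assume "\<not> x \<eta> > t"
    then obtain s where "s \<in> {\<eta>..1}" "x s = t"
      using IVT'[of x \<eta> t 1] \<open>x 1 > t\<close> cont \<eta> by auto
    then show False using ne by blast
  qed
  have e\<eta>: "e \<eta> \<ge> 0" using small[of \<eta>] \<eta> by auto
  have "\<bar>x \<eta> - cubic_root a \<eta>\<bar> * (x \<eta>)\<^sup>2 \<le> \<bar>cubic a \<eta> (x \<eta>)\<bar>"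
    using x_gt t \<eta> by (intro cubic_stability cubic_root) auto
  also have "\<dots> \<le> e \<eta> * (\<eta> + x \<eta> + 1)" using approx[of \<eta>] \<eta> by auto
  also have "\<dots> \<le> e \<eta> * (2 + x \<eta>)" using \<eta> e\<eta> by (intro mult_left_mono) auto
  finally have "\<bar>x \<eta> - cubic_root a \<eta>\<bar> \<le> e \<eta> * (2 + x \<eta>) / (x \<eta>)\<^sup>2"
    using x_gt t by (simp add: field_simps)
  also have "\<dots> = e \<eta> * (2 / (x \<eta>)\<^sup>2 + 1 / x \<eta>)"
    using x_gt t by (simp add: field_simps power2_eq_square)
  also have "\<dots> \<le> e \<eta> * (2 / t\<^sup>2 + 1 / t)"
    using x_gt t e\<eta> by (intro mult_left_mono add_mono divide_left_mono power_mono mult_pos_pos zero_less_power) auto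
  also have "\<dots> \<le> e \<eta> * (48 / \<epsilon>\<^sup>2)"
  proof (intro mult_left_mono e\<eta>)
    have "1 / t \<le> 1 / t\<^sup>2" using t by (intro divide_left_mono) (auto simp: power2_eq_square mult_left_le)
    then have "2 / t\<^sup>2 + 1 / t \<le> 3 / t\<^sup>2" by (simp add: field_simps)
    also have "3 / t\<^sup>2 = 48 / \<epsilon>\<^sup>2" by (simp add: t_def power2_eq_square field_simps)
    finally show "2 / t\<^sup>2 + 1 / t \<le> 48 / \<epsilon>\<^sup>2" .
  qed
  finally show ?thesis .
qed

section \<open>Poisson kernels, Stieltjes transforms and continuation from the imaginary
  axis\<close>

definition poisson :: "real \<Rightarrow> real \<Rightarrow> real" where
  "poisson \<eta> x = \<eta> / (\<eta>\<^sup>2 + x\<^sup>2)"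

lemma poisson_bounds: "\<eta> > 0 \<Longrightarrow> 0 < poisson \<eta> x \<and> poisson \<eta> x \<le> 1 / \<eta>"
  unfolding poisson_def by (auto simp: field_simps power2_eq_square add_pos_nonneg)

lemma symmetric_integral:
  fixes f :: "real \<Rightarrow> real"
  assumes "distr \<nu> borel uminus = \<nu>" "sets \<nu> = sets borel" and [measurable]: "f \<in> borel_measurable borel"
  shows "integral\<^sup>L \<nu> (\<lambda>x. f (- x)) = integral\<^sup>L \<nu> f"
proof -
  have [measurable_cong]: "sets \<nu> = sets borel" by fact
  have "integral\<^sup>L \<nu> f = integral\<^sup>L (distr \<nu> borel uminus) f" by (simp add: assms(1))
  also have "\<dots> = integral\<^sup>L \<nu> (\<lambda>x. f (- x))" by (rule integral_distr) auto
  finally show ?thesis ..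
qed

text \<open>The real part of the kernel is odd in \<open>x\<close> and integrates to 0 by symmetry;
  the imaginary part is minus the Poisson kernel.\<close>

lemma stieltjes_imaginary:
  assumes \<nu>: "prob_space \<nu>" "sets \<nu> = sets borel" "distr \<nu> borel uminus = \<nu>" and \<eta>: "\<eta> > 0"
  shows "stieltjes \<nu> (\<i> * of_real \<eta>) = - (\<i> * of_real (integral\<^sup>L \<nu> (poisson \<eta>)))"
proof -
  interpret prob_space \<nu> by fact
  have [measurable_cong]: "sets \<nu> = sets borel" by fact
  define q where "q x = x / (\<eta>\<^sup>2 + x\<^sup>2)" for x :: real
  have [measurable]: "q \<in> borel_measurable borel" "poisson \<eta> \<in> borel_measurable borel"
    unfolding q_def poisson_def by measurable
  have pos: "\<eta>\<^sup>2 + x\<^sup>2 > 0" for x using \<eta> by (simp add: add_pos_nonneg)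
  have q_le: "\<bar>q x\<bar> \<le> 1 / \<eta>" for x
  proof -
    have "0 \<le> (\<bar>x\<bar> - \<eta>)\<^sup>2" by simp
    then have "\<bar>x\<bar> * \<eta> * 2 \<le> \<eta>\<^sup>2 + x\<^sup>2" by (simp add: power2_diff algebra_simps)
    moreover have "0 \<le> \<bar>x\<bar> * \<eta>" using \<eta> by simp
    ultimately have "\<bar>x\<bar> * \<eta> \<le> \<eta>\<^sup>2 + x\<^sup>2" by linarith
    then show ?thesis using \<eta> pos[of x] by (simp add: q_def abs_divide field_simps)
  qed
  have int_q: "integrable \<nu> q" by (rule integrable_const_bound[of _ "1 / \<eta>"]) (use q_le in auto)
  have int_p: "integrable \<nu> (poisson \<eta>)"
    by (rule integrable_const_bound[of _ "1 / \<eta>"]) (use poisson_bounds[OF \<eta>] in \<open>auto simp: less_imp_le abs_of_pos\<close>)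
  have eq: "1 / (\<i> * of_real \<eta> - of_real x) = - of_real (q x) - \<i> * of_real (poisson \<eta> x)" for x
  proof -
    have "\<i> * of_real \<eta> - of_real x \<noteq> (0::complex)" using \<eta> by (auto simp: complex_eq_iff)
    moreover have "\<eta> * poisson \<eta> x + x * q x = 1" "\<eta> * q x = x * poisson \<eta> x"
      using pos[of x] \<eta> by (simp_all add: q_def poisson_def add_divide_distrib[symmetric] power2_eq_square)
    then have "(\<i> * of_real \<eta> - of_real x) * (- of_real (q x) - \<i> * of_real (poisson \<eta> x)) = (1::complex)"
      by (simp add: complex_eq_iff algebra_simps)
    ultimately show ?thesis by (simp add: field_simps)
  qed
  have "integral\<^sup>L \<nu> (\<lambda>x. q (- x)) = integral\<^sup>L \<nu> q"
    by (rule symmetric_integral) (use \<nu> in auto)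
  moreover have "(\<lambda>x. q (- x)) = (\<lambda>x. - q x)" by (simp add: q_def)
  ultimately have q0: "integral\<^sup>L \<nu> q = 0" by simp
  have "stieltjes \<nu> (\<i> * of_real \<eta>) = integral\<^sup>L \<nu> (\<lambda>x. - of_real (q x) - \<i> * of_real (poisson \<eta> x))"
    by (simp add: stieltjes_def eq)
  also have "\<dots> = - of_real (integral\<^sup>L \<nu> q) - \<i> * of_real (integral\<^sup>L \<nu> (poisson \<eta>))"
    using int_q int_p by (subst Bochner_Integration.integral_diff) (auto simp: integral_complex_of_real)
  finally show ?thesis by (simp add: q0)
qed

lemma norm_inverse_stieltjes_kernel:
  assumes "Im \<xi> > 0"
  shows "cmod (1 / (\<xi> - of_real x)) \<le> 1 / Im \<xi>" "\<xi> - of_real x \<noteq> 0"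
proof -
  have "Im \<xi> \<le> cmod (\<xi> - of_real x)" using abs_Im_le_cmod[of "\<xi> - of_real x"] by simp
  then show "cmod (1 / (\<xi> - of_real x)) \<le> 1 / Im \<xi>"
    using assms by (simp add: norm_divide divide_left_mono frac_le)
  show "\<xi> - of_real x \<noteq> 0" using assms by (auto simp: complex_eq_iff)
qed

lemma prob_space_integral_norm_le:
  fixes f :: "'a \<Rightarrow> 'b::{banach, second_countable_topology}"
  assumes "prob_space M" "\<And>x. norm (f x) \<le> c" "f \<in> borel_measurable M"
  shows "norm (integral\<^sup>L M f) \<le> c"
proof -
  interpret prob_space M by fact
  have "integrable M (\<lambda>x. norm (f x))"
    by (intro integrable_norm integrable_const_bound[of _ c]) (use assms in auto)
  then have "integral\<^sup>L M (\<lambda>x. norm (f x)) \<le> c" by (rule integral_le_const) (use assms in auto)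
  then show ?thesis using integral_norm_bound[of M f] by linarith
qed

text \<open>Differentiation under the integral with an explicit error: within \<open>y / 2\<close>
  of \<xi> the kernel is at most \<open>2 / y\<close>, so the difference quotient is off by at most
  \<open>2 / y^3\<close> times the distance.\<close>

lemma holomorphic_stieltjes:
  assumes \<nu>: "prob_space \<nu>" "sets \<nu> = sets borel"
  shows "stieltjes \<nu> holomorphic_on {\<xi>. Im \<xi> > 0}"
proof -
  interpret prob_space \<nu> by fact
  have [measurable_cong]: "sets \<nu> = sets borel" by fact
  note ker = norm_inverse_stieltjes_kernel
  have "(stieltjes \<nu> has_field_derivative - integral\<^sup>L \<nu> (\<lambda>x. (1 / (\<xi> - of_real x))\<^sup>2)) (at \<xi>)"
    if \<xi>: "Im \<xi> > 0" for \<xi>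
  proof -
    define y where "y = Im \<xi>"
    have y: "y > 0" using \<xi> by (simp add: y_def)
    define D where "D = integral\<^sup>L \<nu> (\<lambda>x. (1 / (\<xi> - of_real x))\<^sup>2)"
    have int: "integrable \<nu> (\<lambda>x. 1 / (\<zeta> - of_real x))" if "Im \<zeta> > 0" for \<zeta>
      by (rule integrable_const_bound[of _ "1 / Im \<zeta>"]) (use ker[OF that] in auto)
    have int2: "integrable \<nu> (\<lambda>x. (1 / (\<xi> - of_real x))\<^sup>2)"
    proof (rule integrable_const_bound[of _ "(1 / y)\<^sup>2"])
      show "AE x in \<nu>. norm ((1 / (\<xi> - of_real x))\<^sup>2) \<le> (1 / y)\<^sup>2"
        unfolding norm_power using ker[OF \<xi>] by (intro AE_I2 power_mono) (auto simp: y_def)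
    qed auto
    have bound: "cmod ((stieltjes \<nu> \<zeta> - stieltjes \<nu> \<xi>) / (\<zeta> - \<xi>) - - D) \<le> cmod (\<zeta> - \<xi>) * (2 / y^3)"
      if \<zeta>: "\<zeta> \<noteq> \<xi>" "cmod (\<zeta> - \<xi>) < y / 2" for \<zeta>
    proof -
      have "\<bar>Im \<zeta> - Im \<xi>\<bar> \<le> cmod (\<zeta> - \<xi>)" using abs_Im_le_cmod[of "\<zeta> - \<xi>"] by simp
      then have Im\<zeta>: "Im \<zeta> \<ge> y / 2" using \<zeta> by (simp add: y_def abs_le_iff)
      then have Im\<zeta>0: "Im \<zeta> > 0" using y by linarith
      have eq: "(1 / (\<zeta> - of_real x) - 1 / (\<xi> - of_real x)) / (\<zeta> - \<xi>) + (1 / (\<xi> - of_real x))\<^sup>2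
          = (\<zeta> - \<xi>) * (1 / (\<zeta> - of_real x)) * (1 / (\<xi> - of_real x))\<^sup>2" for x
      proof -
        have nz: "\<zeta> - of_real x \<noteq> 0" "\<xi> - of_real x \<noteq> 0" "\<zeta> - \<xi> \<noteq> 0"
          using ker(2)[OF Im\<zeta>0] ker(2)[OF \<xi>] \<zeta> by auto
        define u v where "u = \<zeta> - of_real x" and "v = \<xi> - of_real x"
        have uv: "\<zeta> - \<xi> = u - v" "u \<noteq> 0" "v \<noteq> 0" "u - v \<noteq> 0" using nz by (auto simp: u_def v_def)
        have "(1 / u - 1 / v) / (u - v) + (1 / v)\<^sup>2 = (u - v) * (1 / u) * (1 / v)\<^sup>2"
          using uv by (simp add: field_simps power2_eq_square)
        then show ?thesis unfolding uv(1) u_def v_def by simp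
      qed
      have "(stieltjes \<nu> \<zeta> - stieltjes \<nu> \<xi>) / (\<zeta> - \<xi>) - - D
          = integral\<^sup>L \<nu> (\<lambda>x. (1 / (\<zeta> - of_real x) - 1 / (\<xi> - of_real x)) / (\<zeta> - \<xi>) + (1 / (\<xi> - of_real x))\<^sup>2)"
        unfolding stieltjes_def D_def
        using int[OF Im\<zeta>0] int[OF \<xi>] int2 by simp
      also have "cmod \<dots> \<le> cmod (\<zeta> - \<xi>) * (2 / y^3)"
        unfolding eq
      proof (rule prob_space_integral_norm_le[OF \<nu>(1)])
        fix x
        have "cmod (1 / (\<zeta> - of_real x)) \<le> 2 / y"
          using ker(1)[OF Im\<zeta>0, of x] Im\<zeta> y frac_le[of 1 1 "y / 2" "Im \<zeta>"] by simp
        moreover have "cmod ((1 / (\<xi> - of_real x))\<^sup>2) \<le> (1 / y)\<^sup>2"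
          unfolding norm_power using ker(1)[OF \<xi>, of x] by (intro power_mono) (auto simp: y_def)
        ultimately have "cmod ((\<zeta> - \<xi>) * (1 / (\<zeta> - of_real x)) * (1 / (\<xi> - of_real x))\<^sup>2) \<le> cmod (\<zeta> - \<xi>) * (2 / y) * (1 / y)\<^sup>2"
          using y unfolding norm_mult by (intro mult_mono) auto
        then show "cmod ((\<zeta> - \<xi>) * (1 / (\<zeta> - of_real x)) * (1 / (\<xi> - of_real x))\<^sup>2) \<le> cmod (\<zeta> - \<xi>) * (2 / y^3)"
          by (simp add: power2_eq_square power3_eq_cube)
      qed measurable
      finally show ?thesis .
    qed
    have "((\<lambda>\<zeta>. (stieltjes \<nu> \<zeta> - stieltjes \<nu> \<xi>) / (\<zeta> - \<xi>)) \<longlongrightarrow> - D) (at \<xi>)"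
    proof (rule LIM_zero_cancel, rule Lim_null_comparison)
      show "\<forall>\<^sub>F \<zeta> in at \<xi>. norm ((stieltjes \<nu> \<zeta> - stieltjes \<nu> \<xi>) / (\<zeta> - \<xi>) - - D) \<le> cmod (\<zeta> - \<xi>) * (2 / y^3)"
        unfolding eventually_at by (rule exI[of _ "y / 2"]) (use y bound in \<open>auto simp: dist_norm\<close>)
      have "((\<lambda>\<zeta>. cmod (\<zeta> - \<xi>) * (2 / y^3)) \<longlongrightarrow> cmod (\<xi> - \<xi>) * (2 / y^3)) (at \<xi>)"
        by (intro tendsto_intros)
      then show "((\<lambda>\<zeta>. cmod (\<zeta> - \<xi>) * (2 / y^3)) \<longlongrightarrow> 0) (at \<xi>)" by simp
    qed
    then show ?thesis unfolding D_def has_field_derivative_iff by simp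
  qed
  then show ?thesis
    by (intro holomorphic_onI) (auto simp: field_differentiable_def intro: has_field_derivative_at_within)
qed

text \<open>\<open>m_inf\<close> demands the equation on the whole half-plane, whereas Poisson
  integrals give it on the imaginary axis. The axis has a limit point in the half-plane, so the
  identity theorem applies.\<close>

lemma cubic_on_upper_half_plane:
  assumes \<nu>: "prob_space \<nu>" "sets \<nu> = sets borel" "distr \<nu> borel uminus = \<nu>"
    and root: "\<And>\<eta>. \<eta> > 0 \<Longrightarrow> cubic (1 - (cmod z)\<^sup>2) \<eta> (integral\<^sup>L \<nu> (poisson \<eta>)) = 0"
    and \<xi>: "Im \<xi> > 0"
  defines "m \<equiv> stieltjes \<nu>"
  shows "m \<xi> * (\<xi> - m \<xi>)^2 + m \<xi> * (1 - complex_of_real ((cmod z)^2)) - \<xi> = 0"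
proof (rule analytic_continuation[where w = \<xi> and
      f = "\<lambda>\<xi>. m \<xi> * (\<xi> - m \<xi>)^2 + m \<xi> * (1 - complex_of_real ((cmod z)^2)) - \<xi>" and S = "{\<xi>. Im \<xi> > 0}" and U = "(\<lambda>t. \<i> * of_real t) ` {0<..}" and \<xi> = \<i>])
  show "(\<lambda>\<xi>. m \<xi> * (\<xi> - m \<xi>)^2 + m \<xi> * (1 - complex_of_real ((cmod z)^2)) - \<xi>) holomorphic_on {\<xi>. Im \<xi> > 0}"
    unfolding m_def by (intro holomorphic_intros holomorphic_stieltjes \<nu>)
  show "open {\<xi>. 0 < Im \<xi>}" by (rule open_halfspace_Im_gt)
  show "connected {\<xi>. 0 < Im \<xi>}" by (intro convex_connected convex_halfspace_Im_gt)
  show "\<i> islimpt (\<lambda>t. \<i> * of_real t) ` {0<..}"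
    unfolding islimpt_approachable
  proof (intro allI impI)
    fix e :: real assume e: "e > 0"
    have "dist (\<i> * of_real (1 + e / 2)) \<i> = cmod (\<i> * of_real (e / 2))"
      by (simp add: dist_norm algebra_simps)
    also have "\<dots> = e / 2" using e by (simp only: norm_mult norm_of_real norm_ii)
    finally show "\<exists>x'\<in>(\<lambda>t. \<i> * of_real t) ` {0<..}. x' \<noteq> \<i> \<and> dist x' \<i> < e"
      using e by (intro bexI[of _ "\<i> * of_real (1 + e / 2)"] conjI imageI) (auto simp: complex_eq_iff)
  qed
  fix \<zeta> assume "\<zeta> \<in> (\<lambda>t. \<i> * complex_of_real t) ` {0<..}"
  then obtain t where t: "t > 0" "\<zeta> = \<i> * of_real t" by auto
  define h where "h = integral\<^sup>L \<nu> (poisson t)"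
  have m: "m (\<i> * of_real t) = - (\<i> * of_real h)" unfolding m_def h_def by (rule stieltjes_imaginary[OF \<nu> t(1)])
  have "m \<zeta> * (\<zeta> - m \<zeta>)^2 + m \<zeta> * (1 - complex_of_real ((cmod z)^2)) - \<zeta> = \<i> * of_real (cubic (1 - (cmod z)\<^sup>2) t h)"
    unfolding t(2) m by (simp add: cubic_def complex_eq_iff power2_eq_square algebra_simps)
  then show "m \<zeta> * (\<zeta> - m \<zeta>)^2 + m \<zeta> * (1 - complex_of_real ((cmod z)^2)) - \<zeta> = 0"
    using root[OF t(1)] by (simp add: h_def)
qed (use \<xi> in auto)

section \<open>Uniqueness of a symmetric law with given Poisson integrals\<close>

lemma integrable_bounded_borel:
  fixes f :: "real \<Rightarrow> 'b::{banach, second_countable_topology}"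
  assumes "real_distribution \<nu>" "f \<in> borel_measurable borel" "\<And>x. norm (f x) \<le> B"
  shows "integrable \<nu> f"
proof -
  interpret real_distribution \<nu> by fact
  show ?thesis by (rule integrable_const_bound[of _ B]) (use assms in auto)
qed

lemma char_cos_sin:
  assumes "real_distribution \<nu>"
  shows "char \<nu> t = Complex (integral\<^sup>L \<nu> (\<lambda>x. cos (t * x))) (integral\<^sup>L \<nu> (\<lambda>x. sin (t * x)))"
proof -
  have cos: "integrable \<nu> (\<lambda>x. cos (t * x))" and sin: "integrable \<nu> (\<lambda>x. sin (t * x))"
    by (rule integrable_bounded_borel[OF assms, of _ 1], auto)+
  have "char \<nu> t = integral\<^sup>L \<nu> (\<lambda>x. of_real (cos (t * x)) + \<i> * of_real (sin (t * x)))"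
    unfolding char_def by (simp add: exp_Euler cos_of_real sin_of_real flip: of_real_mult)
  also have "\<dots> = of_real (integral\<^sup>L \<nu> (\<lambda>x. cos (t * x))) + \<i> * of_real (integral\<^sup>L \<nu> (\<lambda>x. sin (t * x)))"
    using cos sin by (subst Bochner_Integration.integral_add) (auto simp: integral_complex_of_real)
  finally show ?thesis by (simp add: complex_eq_iff)
qed

text \<open>This is \<open>poisson 1\<close>. It identifies \<open>x\<close> with \<open>- x\<close>
  and maps the line into [0, 1], a compact interval on which polynomials are dense.\<close>

definition ubump :: "real \<Rightarrow> real" where "ubump x = 1 / (1 + x\<^sup>2)"

lemma ubump_pos: "0 < ubump x" "ubump x \<le> 1"
  by (auto simp: ubump_def add_pos_nonneg)

lemma ubump_measurable [measurable]: "ubump \<in> borel_measurable borel"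
  unfolding ubump_def by measurable

text \<open>In the variable \<open>u = 1 / (1 + x\<^sup>2)\<close> the Poisson kernels become \<open>u / (1 + s u)\<close> up to a factor, whose Taylor
  coefficients at \<open>s = 0\<close> are the powers of \<open>u\<close>; these are extracted one at a time.\<close>

lemma ubump_resolvent_moments:
  assumes \<nu>: "real_distribution \<nu>1" "real_distribution \<nu>2"
    and eq: "\<And>\<eta>. \<eta> > 0 \<Longrightarrow> integral\<^sup>L \<nu>1 (poisson \<eta>) = integral\<^sup>L \<nu>2 (poisson \<eta>)"
    and s: "\<bar>s\<bar> < 1 / 2"
  shows "integral\<^sup>L \<nu>1 (\<lambda>x. ubump x ^ Suc k / (1 + s * ubump x)) = integral\<^sup>L \<nu>2 (\<lambda>x. ubump x ^ Suc k / (1 + s * ubump x))"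
  using s
proof (induction k arbitrary: s)
  case 0
  \<comment> \<open>With \<open>\<eta>\<^sup>2 = 1 + s\<close> the quotient
    \<open>u / (1 + s * u)\<close> is \<open>1 / (\<eta>\<^sup>2 + x\<^sup>2)\<close>.\<close>
  define \<eta> where "\<eta> = sqrt (1 + s)"
  have \<eta>: "\<eta> > 0" "\<eta>\<^sup>2 = 1 + s" using 0 by (auto simp: \<eta>_def)
  have "ubump x ^ Suc 0 / (1 + s * ubump x) = poisson \<eta> x / \<eta>" for x
  proof -
    have p: "1 + x\<^sup>2 > 0" by (simp add: add_pos_nonneg)
    have "1 + s * ubump x = (1 + x\<^sup>2 + s) * ubump x"
      using p by (simp add: ubump_def add_divide_distrib)
    then have "ubump x ^ Suc 0 / (1 + s * ubump x) = 1 / (1 + x\<^sup>2 + s)" using ubump_pos(1)[of x] by simp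
    also have "\<dots> = poisson \<eta> x / \<eta>" using \<eta> by (simp add: poisson_def add_ac)
    finally show ?thesis .
  qed
  then show ?case using eq[OF \<eta>(1)] by simp
next
  case (Suc k)
  define J where "J k s x = ubump x ^ Suc k / (1 + s * ubump x)" for k s x
  have su: "\<bar>s * ubump x\<bar> \<le> \<bar>s\<bar>" for s x
    using ubump_pos[of x] by (simp add: abs_mult mult_left_le)
  have den: "1 + s * ubump x \<ge> 1 / 2" if "\<bar>s\<bar> < 1 / 2" for s x
    using su[of s x] that by (auto simp: abs_le_iff)
  have pow: "0 \<le> ubump x ^ k" "ubump x ^ k \<le> 1" for x k
    using ubump_pos[of x] by (auto intro: power_le_one less_imp_le)
  have J_bound: "\<bar>J k s x\<bar> \<le> 2" if "\<bar>s\<bar> < 1 / 2" for k s x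
  proof -
    have "\<bar>J k s x\<bar> = ubump x ^ Suc k / (1 + s * ubump x)"
      using den[OF that, of x] pow(1)[of x "Suc k"] by (simp add: J_def)
    also have "\<dots> \<le> 1 / (1 / 2)" using den[OF that, of x] pow[of x "Suc k"] by (intro frac_le) auto
    finally show ?thesis by simp
  qed
  have J_meas [measurable]: "J k s \<in> borel_measurable borel" for k s unfolding J_def by measurable
  have int: "integrable \<nu>1 (J k s)" "integrable \<nu>2 (J k s)" if "\<bar>s\<bar> < 1 / 2" for k s
    using J_bound[OF that] by (auto intro!: integrable_bounded_borel[OF \<nu>(1), of _ 2] integrable_bounded_borel[OF \<nu>(2), of _ 2])
  have IH: "integral\<^sup>L \<nu>1 (J k s) = integral\<^sup>L \<nu>2 (J k s)" if "\<bar>s\<bar> < 1 / 2" for s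
    unfolding J_def by (rule Suc.IH[OF that])
  \<comment> \<open>A divided difference in \<open>s\<close>: each one gains a power of
    \<open>u\<close>.\<close>
  have J_rec: "J k 0 x - J k s x = s * J (Suc k) s x" if "\<bar>s\<bar> < 1 / 2" for k s x
    using den[OF that, of x] by (simp add: J_def field_simps)
  have J_step: "J (Suc k) s x = (J k 0 x - J k s x) / s" if "\<bar>s\<bar> < 1 / 2" "s \<noteq> 0" for s x
    unfolding J_rec[OF that(1)] using that(2) by simp
  have nonzero: "integral\<^sup>L \<nu>1 (J (Suc k) s) = integral\<^sup>L \<nu>2 (J (Suc k) s)" if s: "\<bar>s\<bar> < 1 / 2" "s \<noteq> 0" for s
  proof -
    have "J (Suc k) s = (\<lambda>x. (J k 0 x - J k s x) / s)" using J_step[OF s] by auto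
    then show ?thesis using int(1)[of 0] int(2)[of 0] int(1)[OF s(1)] int(2)[OF s(1)] IH[of 0] IH[OF s(1)] by simp
  qed
  \<comment> \<open>At \<open>s = 0\<close> one cannot divide, so this value is reached as a limit
    of nonzero \<open>s\<close>; the rate \<open>2 * \<bar>s\<bar>\<close> is the same for both
    laws.\<close>
  have zero: "integral\<^sup>L \<nu>1 (J (Suc k) 0) = integral\<^sup>L \<nu>2 (J (Suc k) 0)"
  proof -
    define D where "D = integral\<^sup>L \<nu>1 (J (Suc k) 0) - integral\<^sup>L \<nu>2 (J (Suc k) 0)"
    have J_diff: "\<bar>J (Suc k) 0 x - J (Suc k) s x\<bar> \<le> 2 * \<bar>s\<bar>" if "\<bar>s\<bar> < 1 / 2" for s x
    proof -
      have "J (Suc k) 0 x - J (Suc k) s x = s * J (Suc (Suc k)) s x"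
        by (rule J_rec[OF that])
      then show ?thesis using mult_left_mono[OF J_bound[OF that, of "Suc (Suc k)" x], of "\<bar>s\<bar>"] by (simp add: abs_mult)
    qed
    have close: "\<bar>integral\<^sup>L \<nu> (J (Suc k) 0) - integral\<^sup>L \<nu> (J (Suc k) s)\<bar> \<le> 2 * \<bar>s\<bar>"
      if \<nu>: "real_distribution \<nu>" "\<bar>s\<bar> < 1 / 2" for \<nu> s
    proof -
      interpret real_distribution \<nu> by fact
      have "integrable \<nu> (J (Suc k) 0)" "integrable \<nu> (J (Suc k) s)"
        using J_bound[OF \<nu>(2)] J_bound[of 0] by (auto intro!: integrable_bounded_borel[OF \<nu>(1), of _ 2])
      then have "integral\<^sup>L \<nu> (J (Suc k) 0) - integral\<^sup>L \<nu> (J (Suc k) s) = integral\<^sup>L \<nu> (\<lambda>x. J (Suc k) 0 x - J (Suc k) s x)" by simp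
      moreover have "norm (integral\<^sup>L \<nu> (\<lambda>x. J (Suc k) 0 x - J (Suc k) s x)) \<le> 2 * \<bar>s\<bar>"
        by (rule prob_space_integral_norm_le[OF prob_space_axioms]) (use J_diff[OF \<nu>(2)] in auto)
      ultimately show ?thesis by simp
    qed
    have D_le: "\<bar>D\<bar> \<le> 4 * s" if "0 < s" "s < 1 / 2" for s
      using close[OF \<nu>(1), of s] close[OF \<nu>(2), of s] nonzero[of s] that unfolding D_def by auto
    have "D = 0"
    proof (rule ccontr)
      assume "D \<noteq> 0"
      then have "0 < min (\<bar>D\<bar> / 8) (1 / 4)" by simp
      from D_le[OF this] have "\<bar>D\<bar> \<le> 4 * min (\<bar>D\<bar> / 8) (1 / 4)" by simp
      also have "\<dots> \<le> \<bar>D\<bar> / 2" by simp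
      finally show False using \<open>D \<noteq> 0\<close> by simp
    qed
    then show ?thesis by (simp add: D_def)
  qed
  show ?case using zero nonzero[of s] Suc.prems unfolding J_def by (cases "s = 0") auto
qed

text \<open>All moments of a variable with values in [0, 1] agree. Weierstrass approximation extends
  this to bounded continuous functions, and cosines and sines give the characteristic
  functions.\<close>

lemma ubump_law_unique:
  assumes \<nu>: "real_distribution \<nu>1" "real_distribution \<nu>2"
    and eq: "\<And>\<eta>. \<eta> > 0 \<Longrightarrow> integral\<^sup>L \<nu>1 (poisson \<eta>) = integral\<^sup>L \<nu>2 (poisson \<eta>)"
  shows "distr \<nu>1 borel ubump = distr \<nu>2 borel ubump"
proof -
  interpret N1: real_distribution \<nu>1 by fact
  interpret N2: real_distribution \<nu>2 by fact
  have pow: "\<bar>ubump x ^ k\<bar> \<le> 1" for x k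
    using ubump_pos[of x] by (auto intro: power_le_one less_imp_le simp: power_abs)
  have int_pow: "integrable \<nu>1 (\<lambda>x. ubump x ^ k)" "integrable \<nu>2 (\<lambda>x. ubump x ^ k)" for k
    using pow by (auto intro!: integrable_bounded_borel[OF \<nu>(1), of _ 1] integrable_bounded_borel[OF \<nu>(2), of _ 1])
  have moments: "integral\<^sup>L \<nu>1 (\<lambda>x. ubump x ^ k) = integral\<^sup>L \<nu>2 (\<lambda>x. ubump x ^ k)" for k
  proof (cases k)
    case 0
    then show ?thesis using N1.prob_space N2.prob_space by simp
  next
    case (Suc j)
    then show ?thesis using ubump_resolvent_moments[OF \<nu> eq, of 0 j] by simp
  qed
  have cont: "integral\<^sup>L \<nu>1 (\<lambda>x. f (ubump x)) = integral\<^sup>L \<nu>2 (\<lambda>x. f (ubump x))"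
    if f: "continuous_on UNIV f" "\<And>x. \<bar>f x\<bar> \<le> 1" for f :: "real \<Rightarrow> real"
  proof -
    have [measurable]: "f \<in> borel_measurable borel" using f(1) by (rule borel_measurable_continuous_onI)
    have int_f: "integrable \<nu>1 (\<lambda>x. f (ubump x))" "integrable \<nu>2 (\<lambda>x. f (ubump x))"
      using f(2) by (auto intro!: integrable_bounded_borel[OF \<nu>(1), of _ 1] integrable_bounded_borel[OF \<nu>(2), of _ 1])
    define D where "D = integral\<^sup>L \<nu>1 (\<lambda>x. f (ubump x)) - integral\<^sup>L \<nu>2 (\<lambda>x. f (ubump x))"
    have "\<bar>D\<bar> \<le> 2 * e" if e: "e > 0" for e
    proof -
      obtain p where p: "real_polynomial_function p" "\<And>x. x \<in> {0..1::real} \<Longrightarrow> \<bar>f x - p x\<bar> < e"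
        using Stone_Weierstrass_real_polynomial_function[of "{0..1}" f e] e f(1) continuous_on_subset by blast
      obtain a m where pa: "p = (\<lambda>x. \<Sum>i\<le>m. a i * x ^ i)"
        using p(1) real_polynomial_function_iff_sum by blast
      have int_p: "integrable \<nu>1 (\<lambda>x. p (ubump x))" "integrable \<nu>2 (\<lambda>x. p (ubump x))"
        unfolding pa using int_pow by auto
      have p_eq: "integral\<^sup>L \<nu>1 (\<lambda>x. p (ubump x)) = integral\<^sup>L \<nu>2 (\<lambda>x. p (ubump x))"
        unfolding pa using int_pow moments by (simp add: Bochner_Integration.integral_sum)
      have fp: "norm (f (ubump x) - p (ubump x)) \<le> e" for x
        using p(2)[of "ubump x"] ubump_pos[of x] by (simp add: less_imp_le)
      have "norm (integral\<^sup>L \<nu>1 (\<lambda>x. f (ubump x) - p (ubump x))) \<le> e"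
        by (rule prob_space_integral_norm_le[OF N1.prob_space_axioms fp]) (simp add: pa)
      moreover have "norm (integral\<^sup>L \<nu>2 (\<lambda>x. f (ubump x) - p (ubump x))) \<le> e"
        by (rule prob_space_integral_norm_le[OF N2.prob_space_axioms fp]) (simp add: pa)
      ultimately show ?thesis using int_f int_p p_eq unfolding D_def by (simp add: abs_le_iff)
    qed
    from this[of "\<bar>D\<bar> / 4"] have "D = 0" by (cases "D = 0") auto
    then show ?thesis by (simp add: D_def)
  qed
  have rd: "real_distribution (distr \<nu>1 borel ubump)" "real_distribution (distr \<nu>2 borel ubump)"
    by (auto intro!: N1.real_distribution_distr N2.real_distribution_distr)
  show ?thesis
  proof (rule Levy_uniqueness[OF rd], rule ext)
    fix t
    have "integral\<^sup>L \<nu>1 (\<lambda>x. cos (t * ubump x)) = integral\<^sup>L \<nu>2 (\<lambda>x. cos (t * ubump x))"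
      by (rule cont[of "\<lambda>u. cos (t * u)"]) (auto intro!: continuous_intros)
    moreover have "integral\<^sup>L \<nu>1 (\<lambda>x. sin (t * ubump x)) = integral\<^sup>L \<nu>2 (\<lambda>x. sin (t * ubump x))"
      by (rule cont[of "\<lambda>u. sin (t * u)"]) (auto intro!: continuous_intros)
    ultimately show "char (distr \<nu>1 borel ubump) t = char (distr \<nu>2 borel ubump) t"
      unfolding char_cos_sin[OF rd(1)] char_cos_sin[OF rd(2)] by (simp add: integral_distr)
  qed
qed

text \<open>The cosine part of the characteristic function integrates an even function of
  \<open>x\<close>, hence a function of \<open>ubump x\<close>; the sine part vanishes by
  symmetry.\<close>

lemma symmetric_law_unique:
  assumes \<nu>: "real_distribution \<nu>1" "real_distribution \<nu>2"
    and sym: "distr \<nu>1 borel uminus = \<nu>1" "distr \<nu>2 borel uminus = \<nu>2"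
    and eq: "\<And>\<eta>. \<eta> > 0 \<Longrightarrow> integral\<^sup>L \<nu>1 (poisson \<eta>) = integral\<^sup>L \<nu>2 (poisson \<eta>)"
  shows "\<nu>1 = \<nu>2"
proof (rule Levy_uniqueness[OF \<nu>], rule ext)
  fix t
  interpret N1: real_distribution \<nu>1 by fact
  interpret N2: real_distribution \<nu>2 by fact
  define f where "f u = cos (t * sqrt (1 / u - 1))" for u :: real
  have [measurable]: "f \<in> borel_measurable borel" unfolding f_def by measurable
  have f: "f (ubump x) = cos (t * x)" for x
  proof -
    have "sqrt (1 / ubump x - 1) = \<bar>x\<bar>" by (simp add: ubump_def)
    then show ?thesis by (cases "x \<ge> 0") (auto simp: f_def)
  qed
  have "integral\<^sup>L \<nu>1 (\<lambda>x. cos (t * x)) = integral\<^sup>L (distr \<nu>1 borel ubump) f"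
    by (subst integral_distr) (auto simp: f)
  also have "\<dots> = integral\<^sup>L (distr \<nu>2 borel ubump) f" by (simp only: ubump_law_unique[OF \<nu> eq])
  also have "\<dots> = integral\<^sup>L \<nu>2 (\<lambda>x. cos (t * x))"
    by (subst integral_distr) (auto simp: f)
  finally have cos: "integral\<^sup>L \<nu>1 (\<lambda>x. cos (t * x)) = integral\<^sup>L \<nu>2 (\<lambda>x. cos (t * x))" .
  have "integral\<^sup>L \<nu>1 (\<lambda>x. sin (t * x)) = 0" "integral\<^sup>L \<nu>2 (\<lambda>x. sin (t * x)) = 0"
    using symmetric_integral[OF sym(1), of "\<lambda>x. sin (t * x)"] symmetric_integral[OF sym(2), of "\<lambda>x. sin (t * x)"] by simp_all
  then show "char \<nu>1 t = char \<nu>2 t"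
    unfolding char_cos_sin[OF \<nu>(1)] char_cos_sin[OF \<nu>(2)] by (simp add: cos)
qed

text \<open>Every competing law has nonnegative Poisson integrals that solve the cubic; they are
  nonzero because the cubic is \<open>- \<eta>\<close> at 0, hence equal to the unique positive
  root, and \<open>symmetric_law_unique\<close> identifies the laws.\<close>

lemma m_inf_eqI:
  assumes \<nu>: "real_distribution \<nu>" "distr \<nu> borel uminus = \<nu>"
    and root: "\<And>\<eta>. \<eta> > 0 \<Longrightarrow> integral\<^sup>L \<nu> (poisson \<eta>) = cubic_root (1 - (cmod z)\<^sup>2) \<eta>"
  shows "m_inf z = stieltjes \<nu>"
  unfolding m_inf_def
proof (rule the_equality)
  interpret N: real_distribution \<nu> by fact
  show "\<exists>\<nu>'. prob_space \<nu>' \<and> sets \<nu>' = sets borel \<and> distr \<nu>' borel uminus = \<nu>' \<and> stieltjes \<nu> = stieltjes \<nu>' \<and>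
      (\<forall>\<xi>. Im \<xi> > 0 \<longrightarrow> stieltjes \<nu> \<xi> * (\<xi> - stieltjes \<nu> \<xi>)^2 + stieltjes \<nu> \<xi> * (1 - complex_of_real ((cmod z)^2)) - \<xi> = 0)"
    using cubic_on_upper_half_plane[of \<nu> z] \<nu> N.prob_space_axioms root cubic_root(2)
    by (intro exI[of _ \<nu>]) auto
  fix m
  assume "\<exists>\<nu>. prob_space \<nu> \<and> sets \<nu> = sets borel \<and> distr \<nu> borel uminus = \<nu> \<and> m = stieltjes \<nu> \<and>
      (\<forall>\<xi>. Im \<xi> > 0 \<longrightarrow> m \<xi> * (\<xi> - m \<xi>)^2 + m \<xi> * (1 - complex_of_real ((cmod z)^2)) - \<xi> = 0)"
  then obtain \<nu>' where \<nu>': "prob_space \<nu>'" "sets \<nu>' = sets borel" "distr \<nu>' borel uminus = \<nu>'" "m = stieltjes \<nu>'"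
    and eqn: "\<And>\<xi>. Im \<xi> > 0 \<Longrightarrow> m \<xi> * (\<xi> - m \<xi>)^2 + m \<xi> * (1 - complex_of_real ((cmod z)^2)) - \<xi> = 0" by auto
  interpret N': prob_space \<nu>' by fact
  have rd': "real_distribution \<nu>'" using \<nu>' by (simp add: real_distribution_def real_distribution_axioms_def)
  have "integral\<^sup>L \<nu>' (poisson \<eta>) = cubic_root (1 - (cmod z)\<^sup>2) \<eta>" if \<eta>: "\<eta> > 0" for \<eta>
  proof (rule cubic_root_unique[OF \<eta>])
    define h where "h = integral\<^sup>L \<nu>' (poisson \<eta>)"
    have m: "m (\<i> * of_real \<eta>) = - (\<i> * of_real h)"
      unfolding h_def \<nu>'(4) by (rule stieltjes_imaginary[OF \<nu>'(1-3) \<eta>])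
    have "\<i> * of_real (cubic (1 - (cmod z)\<^sup>2) \<eta> h) = 0"
      using eqn[of "\<i> * of_real \<eta>"] \<eta> unfolding m
      by (simp add: cubic_def complex_eq_iff power2_eq_square algebra_simps)
    then show "cubic (1 - (cmod z)\<^sup>2) \<eta> (integral\<^sup>L \<nu>' (poisson \<eta>)) = 0" by (simp add: h_def)
    have "h \<ge> 0" unfolding h_def using poisson_bounds[OF \<eta>] by (intro integral_nonneg_AE) (auto simp: less_imp_le)
    moreover have "h \<noteq> 0"
      using \<open>\<i> * of_real (cubic (1 - (cmod z)\<^sup>2) \<eta> h) = 0\<close> \<eta> by (auto simp: cubic_def)
    ultimately show "0 < integral\<^sup>L \<nu>' (poisson \<eta>)" by (simp add: h_def)
  qed
  then have "\<nu>' = \<nu>"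
    using root by (intro symmetric_law_unique[OF rd' \<nu>(1) \<nu>'(3) \<nu>(2)]) auto
  then show "m = stieltjes \<nu>" using \<nu>'(4) by simp
qed

section \<open>Existence of the limiting law\<close>

lemma mat_trace_mult_comm:
  assumes "A \<in> carrier_mat N N" "B \<in> carrier_mat N N"
  shows "mat_trace (A * B) = mat_trace (B * A)"
proof -
  have "mat_trace (A * B) = (\<Sum>i<N. \<Sum>j<N. A $$ (i, j) * B $$ (j, i))"
    using assms by (simp add: mat_trace_def scalar_prod_def atLeast0LessThan)
  also have "\<dots> = (\<Sum>j<N. \<Sum>i<N. B $$ (j, i) * A $$ (i, j))"
    by (subst sum.swap) (simp add: mult.commute)
  also have "\<dots> = mat_trace (B * A)"
    using assms by (simp add: mat_trace_def scalar_prod_def atLeast0LessThan)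
  finally show ?thesis .
qed

text \<open>By induction on the column, \<open>K a b\<close> vanishes for \<open>b < a\<close>,
  because the triangular shape leaves only the term \<open>c = b\<close>. At \<open>b = a\<close>
  the same reduction leaves \<open>K a a * B a a = 1\<close>.\<close>

lemma triangular_left_inverse_diag:
  fixes K B :: "nat \<Rightarrow> nat \<Rightarrow> complex"
  assumes inv: "\<And>a b. a < N \<Longrightarrow> b < N \<Longrightarrow> (\<Sum>c<N. K a c * B c b) = of_bool (a = b)"
    and tri: "\<And>b c. b < c \<Longrightarrow> c < N \<Longrightarrow> B c b = 0" and diag: "\<And>b. b < N \<Longrightarrow> B b b \<noteq> 0" and a: "a < N"
  shows "K a a = 1 / B a a"
proof -
  have reduce: "(\<Sum>c<N. K a c * B c b) = K a b * B b b" if b: "b < N" and z: "\<And>c. c < b \<Longrightarrow> K a c = 0" for b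
  proof -
    have "(\<Sum>c<N. K a c * B c b) = (\<Sum>c<N. if c = b then K a b * B b b else 0)"
      using tri z by (intro sum.cong refl) (metis lessThan_iff linorder_neqE_nat mult_zero_left mult_zero_right)
    then show ?thesis using b by simp
  qed
  have zero: "K a b = 0" if "b < a" for b
    using that
  proof (induction b rule: less_induct)
    case (less b)
    then have "K a b * B b b = 0" using inv[OF a, of b] reduce[of b] a by auto
    then show ?case using diag[of b] less.prems a by simp
  qed
  have "K a a * B a a = 1" using reduce[OF a zero] inv[OF a a] by simp
  then show ?thesis using diag[OF a] by (simp add: field_simps)
qed

lemma hermitian_eigenvalue_real:
  assumes H: "hermitian N H" and "eigenvalue (mat N N (\<lambda>(a, b). H a b)) e"
  shows "Im e = 0"
proof -
  let ?M = "mat N N (\<lambda>(a, b). H a b)"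
  obtain v where v: "v \<in> carrier_vec N" "v \<noteq> 0\<^sub>v N" "?M *\<^sub>v v = e \<cdot>\<^sub>v v"
    using assms(2) by (auto simp: eigenvalue_def eigenvector_def)
  have Mv: "(\<Sum>c<N. H a c * v $ c) = e * v $ a" if "a < N" for a
  proof -
    have "(?M *\<^sub>v v) $ a = (\<Sum>c<N. H a c * v $ c)"
      using that v(1) by (simp add: scalar_prod_def atLeast0LessThan)
    then show ?thesis using v that by simp
  qed
  let ?S = "\<Sum>a<N. (cmod (v $ a))\<^sup>2"
  have "(\<Sum>a<N. \<Sum>c<N. cnj (v $ a) * H a c * v $ c) = (\<Sum>a<N. cnj (v $ a) * (e * v $ a))"
    using Mv by (intro sum.cong refl) (simp add: sum_distrib_left[symmetric] mult.assoc)
  also have "\<dots> = (\<Sum>a<N. e * of_real ((cmod (v $ a))\<^sup>2))"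
    by (intro sum.cong refl) (simp only: complex_norm_square mult_ac)
  also have "\<dots> = e * of_real ?S" by (simp add: sum_distrib_left)
  finally have "Im (e * of_real ?S) = 0" using hermitian_form_real[OF H, of "\<lambda>a. v $ a"] by simp
  then have "Im e * ?S = 0" by simp
  moreover have "?S \<noteq> 0"
  proof
    assume "?S = 0"
    then have "v $ a = 0" if "a < N" for a
      using that by (subst (asm) sum_nonneg_eq_0_iff) auto
    then have "v = 0\<^sub>v N" using v(1) by auto
    with v(2) show False by simp
  qed
  ultimately show ?thesis by simp
qed

text \<open>For a trace, Schur triangularization is enough: conjugation turns the resolvent into the
  inverse of a triangular matrix, whose diagonal is known. The eigenvalues are fixed before \<eta>,
  so that one law represents the trace at every height.\<close>

lemma hermitian_resolvent_trace:
  assumes H: "hermitian N H"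
  obtains ev :: "nat \<Rightarrow> real" where
    "\<And>\<eta>. \<eta> > 0 \<Longrightarrow> (\<Sum>a<N. resolvent N H \<eta> a a) = (\<Sum>k<N. 1 / (\<i> * of_real \<eta> - of_real (ev k)))"
proof -
  let ?M = "mat N N (\<lambda>(a, b). H a b)"
  have M: "?M \<in> carrier_mat N N" by simp
  obtain es where es: "char_poly ?M = (\<Prod>e\<leftarrow>es. [:- e, 1:])" "length es = N"
    using char_poly_factorized[OF M] by blast
  obtain B P Q where "schur_decomposition ?M es = (B, P, Q)" by (metis prod_cases3)
  from schur_decomposition[OF M es(1) this]
  have sim: "similar_mat_wit ?M B P Q" and ut: "upper_triangular B" and dg: "diag_mat B = es" by auto
  from similar_mat_witD2[OF M sim] have PQ: "P * Q = 1\<^sub>m N" "Q * P = 1\<^sub>m N" "?M = P * B * Q"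
    and car: "B \<in> carrier_mat N N" "P \<in> carrier_mat N N" "Q \<in> carrier_mat N N" by auto
  define ev where "ev k = Re (B $$ (k, k))" for k
  have ev: "B $$ (k, k) = of_real (ev k)" if k: "k < N" for k
  proof -
    have "B $$ (k, k) = es ! k" using dg k car by (auto simp: diag_mat_def)
    then have "B $$ (k, k) \<in> set es" using k es(2) by simp
    then have "poly (char_poly ?M) (B $$ (k, k)) = 0"
      unfolding es(1) by (induction es) auto
    then have "eigenvalue ?M (B $$ (k, k))" using eigenvalue_root_char_poly[OF M] by simp
    then have "Im (B $$ (k, k)) = 0" by (rule hermitian_eigenvalue_real[OF H])
    then show ?thesis by (simp add: ev_def complex_eq_iff)
  qed
  have "(\<Sum>a<N. resolvent N H \<eta> a a) = (\<Sum>k<N. 1 / (\<i> * of_real \<eta> - of_real (ev k)))" if \<eta>: "\<eta> > 0" for \<eta>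
  proof -
    let ?S = "mat N N (\<lambda>(a, b). shifted H \<eta> a b)"
    let ?T = "mat N N (\<lambda>(a, b). shifted (\<lambda>a b. B $$ (a, b)) \<eta> a b)"
    let ?R = "the (mat_inverse ?S)"
    note R = resolvent_inverse_mat[OF H \<eta>]
    have S_eq: "?S = (\<i> * of_real \<eta>) \<cdot>\<^sub>m 1\<^sub>m N - ?M" by (rule eq_matI) (auto simp: shifted_def)
    have T_eq: "?T = (\<i> * of_real \<eta>) \<cdot>\<^sub>m 1\<^sub>m N - B" by (rule eq_matI) (use car in \<open>auto simp: shifted_def\<close>)
    have T: "?T \<in> carrier_mat N N" and S: "?S \<in> carrier_mat N N" by simp_all
    define K where "K = Q * (?R * P)"
    have K: "K \<in> carrier_mat N N" unfolding K_def using car R(1) by (meson mult_carrier_mat)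
    have PT: "P * ?T = ?S * P"
    proof -
      have "P * ?T = P * ((\<i> * of_real \<eta>) \<cdot>\<^sub>m 1\<^sub>m N) - P * B"
        unfolding T_eq using car by (intro mult_minus_distrib_mat) auto
      also have "P * ((\<i> * of_real \<eta>) \<cdot>\<^sub>m 1\<^sub>m N) = ((\<i> * of_real \<eta>) \<cdot>\<^sub>m 1\<^sub>m N) * P"
        using car by (simp add: mult_smult_distrib[of _ N N _ N] mult_smult_assoc_mat[of _ N N _ N])
      also have "P * B = ?M * P"
      proof -
        have "?M * P = P * B * (Q * P)" 
          unfolding PQ(3) by (rule assoc_mult_mat[OF mult_carrier_mat[OF car(2,1)] car(3,2)])
        then show ?thesis unfolding PQ(2) using car by (simp add: right_mult_one_mat[of _ N N])
      qed
      also have "((\<i> * of_real \<eta>) \<cdot>\<^sub>m 1\<^sub>m N) * P - ?M * P = ?S * P"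
        unfolding S_eq using car by (intro minus_mult_distrib_mat[symmetric]) auto
      finally show ?thesis .
    qed
    have "K * ?T = Q * (?R * (P * ?T))"
      unfolding K_def assoc_mult_mat[OF car(3) mult_carrier_mat[OF R(1) car(2)] T] assoc_mult_mat[OF R(1) car(2) T] ..
    also have "\<dots> = Q * ((?R * ?S) * P)" unfolding PT assoc_mult_mat[OF R(1) S car(2)] ..
    also have "\<dots> = 1\<^sub>m N" unfolding R(3) using car PQ(2) by (simp add: left_mult_one_mat[of _ N N])
    finally have KT: "K * ?T = 1\<^sub>m N" .
    have K_diag: "K $$ (a, a) = 1 / (\<i> * of_real \<eta> - of_real (ev a))" if a: "a < N" for a
    proof -
      have "K $$ (a, a) = 1 / shifted (\<lambda>a b. B $$ (a, b)) \<eta> a a"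
      proof (rule triangular_left_inverse_diag[where K = "\<lambda>a b. K $$ (a, b)" and B = "shifted (\<lambda>a b. B $$ (a, b)) \<eta>" and N = N])
        fix a b assume ab: "a < N" "b < N"
        have "(K * ?T) $$ (a, b) = (\<Sum>c<N. K $$ (a, c) * shifted (\<lambda>a b. B $$ (a, b)) \<eta> c b)"
          using K ab by (simp add: scalar_prod_def atLeast0LessThan)
        then show "(\<Sum>c<N. K $$ (a, c) * shifted (\<lambda>a b. B $$ (a, b)) \<eta> c b) = of_bool (a = b)"
          unfolding KT using ab by (auto split: if_splits)
      next
        fix b c assume "b < c" "c < N"
        then show "shifted (\<lambda>a b. B $$ (a, b)) \<eta> c b = 0"
          using ut car by (auto simp: shifted_def upper_triangular_def)
      next
        fix b assume "b < N"
        then show "shifted (\<lambda>a b. B $$ (a, b)) \<eta> b b \<noteq> 0"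
          using ev[of b] \<eta> by (simp add: shifted_def complex_eq_iff)
      qed (rule a)
      then show ?thesis using ev[OF a] by (simp add: shifted_def)
    qed
    have "(\<Sum>a<N. resolvent N H \<eta> a a) = mat_trace ?R" using R(1) by (simp add: mat_trace_def resolvent_def)
    also have "?R = (?R * P) * Q"
      unfolding assoc_mult_mat[OF R(1) car(2,3)] PQ(1) right_mult_one_mat[OF R(1)] ..
    also have "mat_trace \<dots> = mat_trace K"
      unfolding K_def using car R(1) by (intro mat_trace_mult_comm) auto
    also have "\<dots> = (\<Sum>k<N. 1 / (\<i> * of_real \<eta> - of_real (ev k)))" using K K_diag by (simp add: mat_trace_def)
    finally show ?thesis .
  qed
  then show ?thesis by (rule that)
qed

lemma Im_inverse_poisson:
  assumes "\<eta> > 0"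
  shows "Im (1 / (\<i> * of_real \<eta> - of_real x)) = - poisson \<eta> x"
  by (simp add: poisson_def Im_divide power2_eq_square add.commute)

lemma poisson_measurable [measurable]: "poisson \<eta> \<in> borel_measurable borel"
  unfolding poisson_def by measurable

lemma poisson_minus: "poisson \<eta> (- x) = poisson \<eta> x"
  by (simp add: poisson_def)

lemma g_spectral:
  assumes nd: "n \<ge> 2" "d \<ge> 1" and w: "w \<in> PiE {..<d} (\<lambda>_. perms {..<n})"
  shows "\<exists>ev :: nat \<Rightarrow> real. \<forall>\<eta>>0. perm_model.g n d z \<eta> w = avg {..<2*n} (\<lambda>k. poisson \<eta> (ev k))"
proof -
  have H: "hermitian (2*n) (hfun n {..<d} (1 / sqrt (real d)) z w)"
    using w by (intro hermitian_hfun) (auto simp: PiE_iff)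
  obtain ev :: "nat \<Rightarrow> real" where ev: "\<And>\<eta>. \<eta> > 0 \<Longrightarrow>
      (\<Sum>a<2*n. resolvent (2*n) (hfun n {..<d} (1 / sqrt (real d)) z w) \<eta> a a) = (\<Sum>k<2*n. 1 / (\<i> * of_real \<eta> - of_real (ev k)))"
    using hermitian_resolvent_trace[OF H] by blast
  have "perm_model.g n d z \<eta> w = avg {..<2*n} (\<lambda>k. poisson \<eta> (ev k))" if \<eta>: "\<eta> > 0" for \<eta>
  proof -
    interpret perm_model n d z \<eta> by unfold_locales (use nd \<eta> in auto)
    have "T 0 (G w) = (\<Sum>a<2*n. G w a a) / of_nat (2*n)" using T_full_trace[OF w] by simp
    also have "\<dots> = (\<Sum>k<2*n. 1 / (\<i> * of_real \<eta> - of_real (ev k))) / of_nat (2*n)"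
      unfolding G_def green_def r_def by (simp only: ev[OF \<eta>])
    finally have "g w = - Im ((\<Sum>k<2*n. 1 / (\<i> * of_real \<eta> - of_real (ev k))) / of_nat (2*n))"
      by (simp only: g_def)
    also have "\<dots> = - ((\<Sum>k<2*n. Im (1 / (\<i> * of_real \<eta> - of_real (ev k)))) / real (2*n))"
      by (simp only: Im_divide_of_nat Im_sum)
    also have "\<dots> = avg {..<2*n} (\<lambda>k. poisson \<eta> (ev k))"
      by (simp add: Im_inverse_poisson[OF \<eta>] sum_negf avg_def del: of_nat_mult)
    finally show ?thesis .
  qed
  then show ?thesis by blast
qed

text \<open>A fair sign attached to each eigenvalue makes the law symmetric by construction and
  leaves integrals of the even Poisson kernels unchanged. Symmetry is recorded by sine integrals
  because these pass to weak limits.\<close>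

lemma averaged_spectral_law:
  assumes nd: "n \<ge> 2" "d \<ge> 1"
  shows "\<exists>\<mu>. real_distribution \<mu> \<and> (\<forall>t. integral\<^sup>L \<mu> (\<lambda>x. sin (t * x)) = 0)
    \<and> (\<forall>\<eta>>0. integral\<^sup>L \<mu> (poisson \<eta>) = perm_model.gbar n d z \<eta>)"
proof -
  let ?W = "PiE {..<d} (\<lambda>_. perms {..<n})"
  obtain EV :: "(nat \<Rightarrow> nat \<Rightarrow> nat) \<Rightarrow> nat \<Rightarrow> real" where EV:
    "\<And>w \<eta>. w \<in> ?W \<Longrightarrow> \<eta> > 0 \<Longrightarrow> perm_model.g n d z \<eta> w = avg {..<2*n} (\<lambda>k. poisson \<eta> (EV w k))"
    using g_spectral[OF nd, where z = z] by metis
  let ?\<Omega> = "?W \<times> ({..<2*n} \<times> (UNIV :: bool set))"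
  define X where "X = (\<lambda>(w, k, s). if s then EV w k else - EV w k)"
  have "{..<2*n} \<noteq> {}" using nd by (simp add: lessThan_empty_iff)
  then have \<Omega>: "finite ?\<Omega>" "?\<Omega> \<noteq> {}"
    using PiE_perms_nonempty[of "{..<d}" "{..<n}"] finite_PiE_perms[of "{..<d}" "{..<n}"] by auto
  define \<mu> where "\<mu> = distr (measure_pmf (pmf_of_set ?\<Omega>)) borel X"
  have rd: "real_distribution \<mu>"
    unfolding \<mu>_def by (rule prob_space.real_distribution_distr[OF measure_pmf.prob_space_axioms]) simp
  have int: "integral\<^sup>L \<mu> f = avg ?W (\<lambda>w. avg {..<2*n} (\<lambda>k. (f (EV w k) + f (- EV w k)) / 2))"
    if [measurable]: "f \<in> borel_measurable borel" for f :: "real \<Rightarrow> real"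
  proof -
    have "integral\<^sup>L \<mu> f = measure_pmf.expectation (pmf_of_set ?\<Omega>) (\<lambda>x. f (X x))"
      unfolding \<mu>_def by (rule integral_distr) auto
    also have "\<dots> = avg ?\<Omega> (\<lambda>x. f (X x))" by (rule expectation_pmf_of_set[OF \<Omega>])
    also have "\<dots> = avg ?W (\<lambda>w. avg {..<2*n} (\<lambda>k. avg UNIV (\<lambda>s. f (X (w, k, s)))))"
      by (simp only: avg_product)
    also have "\<dots> = avg ?W (\<lambda>w. avg {..<2*n} (\<lambda>k. (f (EV w k) + f (- EV w k)) / 2))"
      by (intro avg_cong) (simp add: avg_def X_def UNIV_bool add.commute)
    finally show ?thesis .
  qed
  have "integral\<^sup>L \<mu> (\<lambda>x. sin (t * x)) = 0" for t
    by (subst int) (auto simp: avg_def)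
  moreover have "integral\<^sup>L \<mu> (poisson \<eta>) = perm_model.gbar n d z \<eta>" if \<eta>: "\<eta> > 0" for \<eta>
  proof -
    interpret perm_model n d z \<eta> by unfold_locales (use nd \<eta> in auto)
    have "integral\<^sup>L \<mu> (poisson \<eta>) = avg ?W (\<lambda>w. avg {..<2*n} (\<lambda>k. poisson \<eta> (EV w k)))"
      by (subst int) (simp_all add: poisson_minus)
    also have "\<dots> = gbar" unfolding gbar_def by (intro avg_cong) (simp add: EV \<eta>)
    finally show ?thesis .
  qed
  ultimately show ?thesis using rd by blast
qed

lemma (in perm_model) gbar_le: "gbar \<le> 1 / \<eta>"
proof -
  have "norm (avg W g) \<le> 1 / \<eta>"
  proof (rule norm_avg_le[OF finite_W PiE_perms_nonempty])
    fix w assume w: "w \<in> W"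
    have "cmod (T 0 (G w)) \<le> 1 / \<eta>" by (rule cmod_T_le[OF opb_entry[OF opb_G[OF w]]]) auto
    then show "norm (g w) \<le> 1 / \<eta>" using abs_Im_le_cmod[of "T 0 (G w)"] by (simp add: g_def)
  qed
  then show ?thesis by (simp add: gbar_def)
qed

text \<open>With \<open>d = n\<close> every part of \<open>err'\<close> is of order
  \<open>1 / sqrt n\<close> at fixed \<eta>; the constant 20 is 3 + 17.\<close>

lemma diagonal_cubic_bound:
  fixes z :: complex
  assumes n: "n \<ge> 2" and \<eta>: "\<eta> > 0" and z: "cmod z \<le> 1"
  shows "\<bar>cubic (1 - (cmod z)\<^sup>2) \<eta> (perm_model.gbar n n z \<eta>)\<bar>
    \<le> (1 / \<eta> + 13 / \<eta>\<^sup>2 + 20 / \<eta>^3) * (\<eta> + 1 / \<eta> + 1) / sqrt n"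
proof -
  interpret perm_model n n z \<eta> by unfold_locales (use n \<eta> in auto)
  have sq: "sqrt n / (n * \<eta>) = 1 / (sqrt n * \<eta>)"
    using n \<eta> by (simp add: divide_simps)
  have err: "err' = (1 / \<eta> + 13 / \<eta>\<^sup>2 + 20 / \<eta>^3) / sqrt n"
  proof -
    have eq: "c / (sqrt n * y) = c * (1 / y / sqrt n)" for c y :: real by (simp add: mult.commute)
    have "err' = 1 * (1 / \<eta> / sqrt n) + 13 * (1 / \<eta>\<^sup>2 / sqrt n) + 3 * (1 / \<eta>^3 / sqrt n) + 17 * (1 / \<eta>^3 / sqrt n)"
      unfolding err'_def err_def sq eq ..
    also have "\<dots> = (1 / \<eta> + 13 / \<eta>\<^sup>2 + 20 / \<eta>^3) / sqrt n"
      by (simp add: add_divide_distrib)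
    finally show ?thesis .
  qed
  have pos: "err' \<ge> 0" unfolding err using \<eta> by simp
  have "\<bar>cubic (1 - (cmod z)\<^sup>2) \<eta> gbar\<bar> \<le> err' * (\<eta> + gbar + cmod z)"
    using gbar_cubic by (simp add: cubic_def algebra_simps)
  also have "\<dots> \<le> err' * (\<eta> + 1 / \<eta> + 1)"
    using pos gbar_le z by (intro mult_left_mono) auto
  finally show ?thesis unfolding err by simp
qed

text \<open>At fixed \<eta> the second bound of \<open>cubic_stability\<close> applies, which covers
  the boundary case \<open>cmod z = 1\<close>. The shift by 2 meets the requirement
  \<open>n \<ge> 2\<close> of the locale.\<close>

lemma gbar_diagonal_tendsto:
  fixes z :: complex
  assumes \<eta>: "\<eta> > 0" and z: "cmod z \<le> 1"
  shows "(\<lambda>k. perm_model.gbar (k + 2) (k + 2) z \<eta>) \<longlonglongrightarrow> cubic_root (1 - (cmod z)\<^sup>2) \<eta>"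
proof -
  define a where "a = 1 - (cmod z)\<^sup>2"
  define h where "h = cubic_root a \<eta>"
  have h: "h > 0" "cubic a \<eta> h = 0" unfolding h_def by (rule cubic_root[OF \<eta>])+
  define A where "A = (1 / \<eta> + 13 / \<eta>\<^sup>2 + 20 / \<eta>^3) * (\<eta> + 1 / \<eta> + 1)"
  have bound: "norm (perm_model.gbar (k + 2) (k + 2) z \<eta> - h) \<le> A * h / \<eta> / sqrt (real (k + 2))" for k
  proof -
    interpret perm_model "k + 2" "k + 2" z \<eta> by unfold_locales (use \<eta> in auto)
    have "\<bar>gbar - h\<bar> * (\<eta> / h) \<le> A / sqrt (real (k + 2))"
      using cubic_stability(2)[OF \<eta> gbar_nonneg h] diagonal_cubic_bound[OF n \<eta> z] unfolding a_def A_def by linarith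
    then have "\<bar>gbar - h\<bar> \<le> A / sqrt (real (k + 2)) / (\<eta> / h)"
      using \<eta> h(1) by (simp only: pos_le_divide_eq divide_pos_pos)
    then show ?thesis by (simp add: mult_ac)
  qed
  have "(\<lambda>k. A * h / \<eta> / sqrt (real (k + 2))) \<longlonglongrightarrow> 0"
    by (intro tendsto_divide_0[OF tendsto_const] filterlim_at_top_imp_at_infinity
        filterlim_compose[OF sqrt_at_top] filterlim_compose[OF filterlim_real_sequentially] filterlim_add_const_nat_at_top)
  then have "(\<lambda>k. perm_model.gbar (k + 2) (k + 2) z \<eta> - h) \<longlonglongrightarrow> 0"
    by (rule Lim_null_comparison[OF always_eventually[OF allI[OF bound]]])
  then show ?thesis unfolding h_def a_def by (rule LIM_zero_cancel)
qed

text \<open>For tightness: \<open>b\<close> times the Poisson integral at height \<open>b\<close>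
  approaches the total mass 1 uniformly in \<open>n\<close>. The cubic is off by at most
  \<open>34 / b * (3 * b) = 102\<close>, and replacing \<open>(b + ?x)\<^sup>2\<close> by
  \<open>b\<^sup>2\<close> costs 3 more.\<close>

lemma gbar_diagonal_large:
  fixes z :: complex
  assumes n: "n \<ge> 2" and z: "cmod z \<le> 1" and b: "b \<ge> 1"
  shows "b * perm_model.gbar n n z b \<ge> 1 - 105 / b"
proof -
  interpret perm_model n n z b by unfold_locales (use n b in auto)
  let ?x = gbar
  have x: "0 \<le> ?x" "?x \<le> 1 / b" using gbar_nonneg gbar_le by auto
  have inv: "1 / b \<le> 1" "1 / b^2 \<le> 1 / b" "1 / b^3 \<le> 1 / b"
    using b by (auto simp: divide_simps power2_eq_square power3_eq_cube mult_le_cancel_left1 intro: order_trans)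
  have "1 / b + 13 / b\<^sup>2 + 20 / b^3 \<le> 34 / b" using inv(2,3) by simp
  moreover have "b + 1 / b + 1 \<le> 3 * b" using inv(1) b by linarith
  ultimately have "(1 / b + 13 / b\<^sup>2 + 20 / b^3) * (b + 1 / b + 1) \<le> 34 / b * (3 * b)"
    using b by (intro mult_mono) auto
  then have "(1 / b + 13 / b\<^sup>2 + 20 / b^3) * (b + 1 / b + 1) / sqrt n \<le> 102 / sqrt n"
    using b by (intro divide_right_mono) auto
  also have "\<dots> \<le> 102" using n by (simp add: divide_simps)
  finally have "\<bar>cubic (1 - (cmod z)\<^sup>2) b ?x\<bar> \<le> 102"
    using diagonal_cubic_bound[OF n _ z, of b] b by simp
  moreover have "cubic (1 - (cmod z)\<^sup>2) b ?x \<le> ?x * (b + ?x)\<^sup>2 - b"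
    using z x by (simp add: cubic_def power_le_one)
  ultimately have 1: "b - 102 \<le> ?x * (b + ?x)\<^sup>2" by linarith
  have "(b + ?x)\<^sup>2 \<le> (b + 1 / b)\<^sup>2" using x b by (intro power_mono) auto
  also have "\<dots> = b\<^sup>2 + 2 + (1 / b)\<^sup>2" using b by (simp add: power2_eq_square field_simps)
  also have "\<dots> \<le> b\<^sup>2 + 3" using power_le_one[of "1 / b" 2] b by simp
  finally have "?x * (b + ?x)\<^sup>2 \<le> ?x * (b\<^sup>2 + 3)" using x(1) by (rule mult_left_mono)
  with 1 have "b - 102 \<le> ?x * b\<^sup>2 + ?x * 3" by (simp add: algebra_simps)
  moreover have "?x * 3 \<le> 3" using x inv(1) by linarith
  ultimately have "b - 105 \<le> (b * ?x) * b" by (simp add: power2_eq_square mult_ac)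
  then have "(b - 105) / b \<le> b * ?x" using b by (simp add: pos_divide_le_eq)
  then show ?thesis using b by (simp add: diff_divide_distrib)
qed

text \<open>\<open>b * poisson b x\<close> is at most 1 everywhere and at most 1/2 outside the
  interval, so \<open>2 * (b * poisson b x) - 1\<close> minorizes the indicator.\<close>

lemma measure_interval_ge_poisson:
  assumes \<mu>: "real_distribution \<mu>" and b: "b > 0"
  shows "measure \<mu> {-b<..b} \<ge> 2 * (b * integral\<^sup>L \<mu> (poisson b)) - 1"
proof -
  interpret real_distribution \<mu> by fact
  have int: "integrable \<mu> (poisson b)"
    by (rule integrable_bounded_borel[OF \<mu>, of _ "1 / b"]) (use poisson_bounds[OF b] in \<open>auto simp: abs_of_pos\<close>)
  have le: "2 * (b * poisson b x) - 1 \<le> indicator {-b<..b} x" for x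
  proof (cases "x \<in> {-b<..b}")
    case True
    have "b * poisson b x \<le> b * (1 / b)" using poisson_bounds[OF b, of x] b by (intro mult_left_mono) auto
    then show ?thesis using True b by simp
  next
    case False
    then have "b \<le> \<bar>x\<bar>" by auto
    then have "b\<^sup>2 \<le> x\<^sup>2" using b by (metis abs_of_pos abs_le_square_iff)
    moreover have "b * poisson b x = b\<^sup>2 / (b\<^sup>2 + x\<^sup>2)" by (simp add: poisson_def power2_eq_square)
    moreover have "b\<^sup>2 / (b\<^sup>2 + x\<^sup>2) \<le> 1 / 2"
      using \<open>b\<^sup>2 \<le> x\<^sup>2\<close> b by (subst pos_divide_le_eq) (auto simp: add_pos_nonneg)
    ultimately show ?thesis using False by (simp add: mult.commute)
  qed
  have "2 * (b * integral\<^sup>L \<mu> (poisson b)) - 1 = integral\<^sup>L \<mu> (\<lambda>x. 2 * (b * poisson b x) - 1)"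
    using int prob_space by simp
  also have "\<dots> \<le> integral\<^sup>L \<mu> (indicator {-b<..b})"
    using int le
    by (intro integral_mono integrable_bounded_borel[OF \<mu>, of "indicator _ :: real \<Rightarrow> real" 1]) (auto simp: indicator_def)
  finally show ?thesis by simp
qed

text \<open>Poisson kernels and sines are bounded and continuous, so both the value of the root and
  the symmetry survive the passage to a weakly convergent subsequence.\<close>

lemma limiting_law_exists:
  fixes z :: complex
  assumes z: "cmod z \<le> 1"
  obtains \<nu> where "real_distribution \<nu>" "distr \<nu> borel uminus = \<nu>"
    "\<And>\<eta>. \<eta> > 0 \<Longrightarrow> integral\<^sup>L \<nu> (poisson \<eta>) = cubic_root (1 - (cmod z)\<^sup>2) \<eta>"
proof -
  have "\<exists>\<mu>. \<forall>k. real_distribution (\<mu> k) \<and> (\<forall>t. integral\<^sup>L (\<mu> k) (\<lambda>x. sin (t * x)) = 0)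
    \<and> (\<forall>\<eta>>0. integral\<^sup>L (\<mu> k) (poisson \<eta>) = perm_model.gbar (k + 2) (k + 2) z \<eta>)"
    using averaged_spectral_law[of "_ + 2" "_ + 2" z] by (intro choice allI) simp
  then obtain \<mu> where \<mu>: "\<And>k. real_distribution (\<mu> k)" "\<And>k t. integral\<^sup>L (\<mu> k) (\<lambda>x. sin (t * x)) = 0"
    "\<And>k \<eta>. \<eta> > 0 \<Longrightarrow> integral\<^sup>L (\<mu> k) (poisson \<eta>) = perm_model.gbar (k + 2) (k + 2) z \<eta>" by blast
  have "tight \<mu>"
    unfolding tight_def
  proof (intro conjI allI impI \<mu>(1))
    fix e :: real assume e: "e > 0"
    \<comment> \<open>The mass outside the interval is at most \<open>210 / b\<close>, with 210 = 2
      * 105; taking 211 makes \<open>210 / b < e\<close> strict.\<close>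
    define b where "b = max 1 (211 / e)"
    have b: "b \<ge> 1" "211 / e \<le> b" by (auto simp: b_def)
    have "210 / b < e" using b e by (simp add: pos_divide_le_eq pos_divide_less_eq mult.commute)
    then have "measure (\<mu> k) {-b<..b} > 1 - e" for k
      using measure_interval_ge_poisson[OF \<mu>(1), of b k] gbar_diagonal_large[of "k + 2" z b] z b \<mu>(3)[of b k] by simp
    moreover have "- b < b" using b by simp
    ultimately show "\<exists>a b. a < b \<and> (\<forall>n. 1 - e < measure (\<mu> n) {a<..b})" by blast
  qed
  from tight_imp_convergent_subsubsequence[OF this strict_mono_id]
  obtain s M where s: "strict_mono (s :: nat \<Rightarrow> nat)" and M: "real_distribution M" and conv: "weak_conv_m (\<mu> \<circ> id \<circ> s) M" by blast
  have lim: "(\<lambda>k. integral\<^sup>L (\<mu> (s k)) f) \<longlonglongrightarrow> integral\<^sup>L M f"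
    if "\<And>x. isCont f x" "\<And>x. norm (f x) \<le> B" for f :: "real \<Rightarrow> real" and B
    using weak_conv_imp_integral_bdd_continuous_conv[of "\<mu> \<circ> id \<circ> s" M f B] \<mu>(1) M conv that by simp
  have "(\<lambda>k. integral\<^sup>L (\<mu> (s k)) (\<lambda>x. sin (t * x))) \<longlonglongrightarrow> integral\<^sup>L M (\<lambda>x. sin (t * x))" for t
    by (rule lim[where B = 1]) (auto intro!: continuous_intros)
  then have sin0: "integral\<^sup>L M (\<lambda>x. sin (t * x)) = 0" for t
    unfolding \<mu>(2) using LIMSEQ_unique tendsto_const by blast
  interpret M: real_distribution M by fact
  have rd: "real_distribution (distr M borel uminus)" by (rule M.real_distribution_distr) simp
  have "distr M borel uminus = M"
  proof (rule Levy_uniqueness[OF rd M], rule ext)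
    fix t
    show "char (distr M borel uminus) t = char M t"
      unfolding char_cos_sin[OF rd] char_cos_sin[OF M] by (simp add: integral_distr sin0)
  qed
  moreover have "integral\<^sup>L M (poisson \<eta>) = cubic_root (1 - (cmod z)\<^sup>2) \<eta>" if \<eta>: "\<eta> > 0" for \<eta>
  proof -
    have "(\<lambda>k. integral\<^sup>L (\<mu> (s k)) (poisson \<eta>)) \<longlonglongrightarrow> integral\<^sup>L M (poisson \<eta>)"
    proof (rule lim[where B = "1 / \<eta>"])
      show "isCont (poisson \<eta>) x" for x
      proof -
        have "\<eta>\<^sup>2 + x\<^sup>2 \<noteq> 0" using \<eta> by (simp add: add_pos_nonneg less_imp_neq[THEN not_sym])
        then show ?thesis unfolding poisson_def by (intro continuous_intros)
      qed
      show "norm (poisson \<eta> x) \<le> 1 / \<eta>" for x using poisson_bounds[OF \<eta>, of x] by simp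
    qed
    moreover have "(\<lambda>k. integral\<^sup>L (\<mu> (s k)) (poisson \<eta>)) \<longlonglongrightarrow> cubic_root (1 - (cmod z)\<^sup>2) \<eta>"
      unfolding \<mu>(3)[OF \<eta>] using LIMSEQ_subseq_LIMSEQ[OF gbar_diagonal_tendsto[OF \<eta> z] s] by (simp add: o_def)
    ultimately show ?thesis by (rule LIMSEQ_unique)
  qed
  ultimately show ?thesis using that M by blast
qed

lemma m_inf_imaginary:
  assumes z: "cmod z \<le> 1" and \<eta>: "\<eta> > 0"
  shows "m_inf z (\<i> * of_real \<eta>) = - (\<i> * of_real (cubic_root (1 - (cmod z)\<^sup>2) \<eta>))"
proof -
  obtain \<nu> where \<nu>: "real_distribution \<nu>" "distr \<nu> borel uminus = \<nu>"
    "\<And>\<eta>. \<eta> > 0 \<Longrightarrow> integral\<^sup>L \<nu> (poisson \<eta>) = cubic_root (1 - (cmod z)\<^sup>2) \<eta>"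
    using limiting_law_exists[OF z] by blast
  interpret real_distribution \<nu> by fact
  have "m_inf z = stieltjes \<nu>" by (rule m_inf_eqI[OF \<nu>(1,2)]) (rule \<nu>(3))
  then show ?thesis
    using stieltjes_imaginary[OF prob_space_axioms _ \<nu>(2) \<eta>] \<nu>(3)[OF \<eta>] by simp
qed

section \<open>The local law\<close>

text \<open>\<open>sqrt D\<close> comes from \<open>sqrt d / n \<le> sqrt D / sqrt n\<close>, and 33
  = 13 + 3 + 17 collects the constants of \<open>err'\<close>. The bound decreases in the height, so
  smallness at \<eta> yields smallness on [\<eta>, 1], as \<open>cubic_bulk_stability\<close>
  demands.\<close>

lemma gbar_close_to_root:
  fixes z :: complex
  assumes n3: "n \<ge> 3" and dD: "d \<ge> 1" "real d \<le> D * n"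
    and \<epsilon>: "0 < \<epsilon>" "\<epsilon> \<le> 1" "cmod z \<le> 1 - \<epsilon>" and eta: "0 < \<eta>" "\<eta> \<le> 1"
    and \<delta>: "1 / sqrt d \<le> \<delta>" "1 / sqrt n \<le> \<delta>"
    and small: "(sqrt D + 33) * \<delta> / \<eta>^3 < \<epsilon>\<^sup>2 / 32"
  shows "\<bar>perm_model.gbar n d z \<eta> - cubic_root (1 - (cmod z)\<^sup>2) \<eta>\<bar> \<le> (sqrt D + 33) * \<delta> / \<eta>^3 * (48 / \<epsilon>\<^sup>2)"
proof (rule cubic_bulk_stability[where e = "\<lambda>s. (sqrt D + 33) * \<delta> / s^3" and x = "perm_model.gbar n d z"
      and \<eta> = \<eta> and \<epsilon> = \<epsilon> and a = "1 - (cmod z)\<^sup>2"])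
  have "0 < 1 / sqrt (real n)" using n3 by simp
  then have \<delta>0: "\<delta> > 0" using \<delta>(2) by linarith
  have "0 < D * n" using dD by linarith
  then have D: "D > 0" using n3 by (simp add: zero_less_mult_iff)
  have z1: "cmod z \<le> 1" using \<epsilon> by linarith
  have "(cmod z)\<^sup>2 \<le> cmod z" using z1 by (simp add: power2_eq_square mult_left_le)
  then show "\<epsilon> \<le> 1 - (cmod z)\<^sup>2" using \<epsilon> by linarith
  show "0 < \<eta>" "\<eta> \<le> 1" "0 < \<epsilon>" "\<epsilon> \<le> 1" by fact+
  have pm: "perm_model n d s" if "s \<in> {\<eta>..1}" for s
    using that n3 dD eta by unfold_locales auto
  show "continuous_on {\<eta>..1} (perm_model.gbar n d z)"
  proof (rule lipschitz_on_continuous_on[of "1 / (\<eta> * \<eta>)"], rule lipschitz_onI)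
    fix s t assume st: "s \<in> {\<eta>..1}" "t \<in> {\<eta>..1}"
    have "\<bar>perm_model.gbar n d z s - perm_model.gbar n d z t\<bar> \<le> \<bar>s - t\<bar> / (s * t)"
      by (rule gbar_lipschitz) (use n3 dD st eta in auto)
    also have "\<dots> \<le> \<bar>s - t\<bar> / (\<eta> * \<eta>)"
      using st eta by (intro divide_left_mono mult_mono mult_pos_pos) auto
    finally show "dist (perm_model.gbar n d z s) (perm_model.gbar n d z t) \<le> 1 / (\<eta> * \<eta>) * dist s t"
      by (simp add: dist_real_def)
  qed (use eta in auto)
  fix s assume s: "s \<in> {\<eta>..1}"
  then have s0: "s > 0" "s \<le> 1" using eta by auto
  interpret perm_model n d z s by (rule pm[OF s])
  show "perm_model.gbar n d z s \<ge> 0" by (rule gbar_nonneg)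
  have K: "0 \<le> (sqrt D + 33) * \<delta>" using \<delta>0 D by simp
  show "0 \<le> (sqrt D + 33) * \<delta> / s^3 \<and> (sqrt D + 33) * \<delta> / s^3 < \<epsilon>\<^sup>2 / 32"
  proof
    show "0 \<le> (sqrt D + 33) * \<delta> / s^3" using K s0 by simp
    have "(sqrt D + 33) * \<delta> / s^3 \<le> (sqrt D + 33) * \<delta> / \<eta>^3"
      using K s eta by (intro divide_left_mono power_mono mult_pos_pos zero_less_power) auto
    then show "(sqrt D + 33) * \<delta> / s^3 < \<epsilon>\<^sup>2 / 32" using small by linarith
  qed
  have err: "err' \<le> (sqrt D + 33) * \<delta> / s^3"
  proof -
    have i1: "1 / s \<le> 1 / s^3" and i2: "1 / s\<^sup>2 \<le> 1 / s^3"
      using s0 power_decreasing[of 1 3 s] power_decreasing[of 2 3 s] by (auto intro!: divide_left_mono mult_pos_pos)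
    have "sqrt d \<le> sqrt (D * n)" using dD(2) by (rule real_sqrt_le_mono)
    then have "sqrt d / n \<le> sqrt D * sqrt n / n" by (simp add: real_sqrt_mult divide_right_mono)
    also have "\<dots> = sqrt D * (1 / sqrt n)" using n3 by (simp add: field_simps)
    also have "\<dots> \<le> sqrt D * \<delta>" using \<delta>(2) D by (intro mult_left_mono) auto
    finally have t1: "sqrt d / n * (1 / s) \<le> sqrt D * \<delta> * (1 / s^3)"
      using i1 D \<delta>0 s0 by (intro mult_mono) auto
    have t2: "13 * ((1 / sqrt n) * (1 / s\<^sup>2)) \<le> 13 * (\<delta> * (1 / s^3))"
      using \<delta>(2) \<delta>0 i2 s0 by (intro mult_left_mono mult_mono) auto
    have t3: "3 * ((1 / sqrt d) * (1 / s^3)) \<le> 3 * (\<delta> * (1 / s^3))"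
      using \<delta>(1) \<delta>0 s0 by (intro mult_left_mono mult_right_mono) auto
    have t4: "17 * ((1 / sqrt n) * (1 / s^3)) \<le> 17 * (\<delta> * (1 / s^3))"
      using \<delta>(2) \<delta>0 s0 by (intro mult_left_mono mult_right_mono) auto
    have "err' = sqrt d / n * (1 / s) + 13 * ((1 / sqrt n) * (1 / s\<^sup>2)) + 3 * ((1 / sqrt d) * (1 / s^3)) + 17 * ((1 / sqrt n) * (1 / s^3))"
      by (simp add: err'_def err_def)
    also have "\<dots> \<le> sqrt D * \<delta> * (1 / s^3) + 13 * (\<delta> * (1 / s^3)) + 3 * (\<delta> * (1 / s^3)) + 17 * (\<delta> * (1 / s^3))"
      by (intro add_mono t1 t2 t3 t4)
    also have "\<dots> = (sqrt D + 33) * \<delta> / s^3" by (simp add: algebra_simps add_divide_distrib)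
    finally show ?thesis .
  qed
  have "\<bar>cubic (1 - (cmod z)\<^sup>2) s gbar\<bar> \<le> err' * (s + gbar + cmod z)"
    using gbar_cubic by (simp add: cubic_def algebra_simps)
  also have "\<dots> \<le> (sqrt D + 33) * \<delta> / s^3 * (s + gbar + 1)"
    using err z1 s0 gbar_nonneg K by (intro mult_mono) auto
  finally show "\<bar>cubic (1 - (cmod z)\<^sup>2) s gbar\<bar> \<le> (sqrt D + 33) * \<delta> / s^3 * (s + gbar + 1)" .
qed

text \<open>Calibrated so that \<open>g_tail\<close> at height \<open>k / n\<close> has exponent
  \<open>2 * (ln n)\<^sup>2\<close>: one square pays for the union over the grid, the other
  remains.\<close>

definition grid_dev :: "nat \<Rightarrow> nat \<Rightarrow> real" where
  "grid_dev n k = 8 * ln (real n) / (sqrt n * (real k / real n)\<^sup>2)"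

text \<open>For \<open>n < 3\<close> the event is everything, so the probability bound holds
  trivially there.\<close>

definition good_event :: "nat \<Rightarrow> nat \<Rightarrow> complex \<Rightarrow> (nat \<Rightarrow> nat \<Rightarrow> nat) set" where
  "good_event n d z = {w. n < 3 \<or> (\<forall>k\<in>{1..n}.
     \<bar>perm_model.g n d z (real k / real n) w - perm_model.gbar n d z (real k / real n)\<bar> < grid_dev n k)}"

text \<open>A union bound over the grid. The number of points is \<open>exp (ln n)\<close>, absorbed
  through \<open>L - 2 * L\<^sup>2 \<le> 1 - L\<^sup>2\<close> at the price of a factor
  \<open>exp 1\<close>.\<close>

lemma good_event_prob:
  assumes d: "d \<ge> 1"
  shows "measure_pmf.prob (perm_pmf n d) (perm_space n d - good_event n d z) \<le> 2 * exp 1 * exp (- (ln (real n))\<^sup>2)"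
proof (cases "n < 3")
  case True
  then show ?thesis by (simp add: good_event_def)
next
  case False
  then have n: "n \<ge> 3" by simp
  note n3 = n
  let ?W = "PiE {..<d} (\<lambda>_. perms {..<n})"
  let ?bad = "\<lambda>k w. \<bar>perm_model.g n d z (real k / real n) w - perm_model.gbar n d z (real k / real n)\<bar> \<ge> grid_dev n k"
  have W: "perm_space n d = ?W" by (simp add: perm_space_def)
  have fin: "finite ?W" "?W \<noteq> {}" by (simp add: finite_PiE_perms, rule PiE_perms_nonempty)
  have tail: "avg ?W (\<lambda>w. of_bool (?bad k w)) \<le> 2 * exp (- (2 * (ln (real n))\<^sup>2))" if k: "k \<in> {1..n}" for k
  proof -
    have kn: "real k / real n > 0" using k n by auto
    interpret perm_model n d z "real k / real n" by unfold_locales (use n d kn in auto)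
    have dev: "grid_dev n k > 0" unfolding grid_dev_def
      by (intro divide_pos_pos mult_pos_pos zero_less_power) (use n3 k in auto)
    have "avg ?W (\<lambda>w. of_bool (?bad k w)) \<le> 2 * exp (- ((grid_dev n k)\<^sup>2 * n * (real k / real n)^4 / 32))"
      by (rule g_tail[OF dev])
    also have "(grid_dev n k)\<^sup>2 * n * (real k / real n)^4 / 32 = 2 * (ln (real n))\<^sup>2"
    proof -
      define q where "q = real k / real n"
      have "(8 * ln (real n) / (sqrt n * q\<^sup>2))\<^sup>2 = 64 * (ln (real n))\<^sup>2 / (n * q^4)"
        by (simp add: power_divide power_mult_distrib)
      then show ?thesis unfolding grid_dev_def q_def[symmetric] using n3 kn by (simp add: q_def[symmetric])
    qed
    finally show ?thesis .
  qed
  have "measure_pmf.prob (perm_pmf n d) (perm_space n d - good_event n d z)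
      = avg ?W (\<lambda>w. of_bool (w \<in> perm_space n d - good_event n d z))"
    unfolding perm_pmf_def W using fin by (simp add: measure_pmf_of_set avg_def Int_def conj_ac)
  also have "\<dots> \<le> avg ?W (\<lambda>w. \<Sum>k\<in>{1..n}. of_bool (?bad k w))"
  proof (rule avg_mono)
    fix w assume "w \<in> ?W"
    show "of_bool (w \<in> perm_space n d - good_event n d z) \<le> (\<Sum>k\<in>{1..n}. of_bool (?bad k w) :: real)"
    proof (cases "w \<in> good_event n d z")
      case False
      then obtain k where k: "k \<in> {1..n}" "?bad k w" using n by (auto simp: good_event_def not_less)
      have "(1::real) = of_bool (?bad k w)" using k(2) by simp
      also have "\<dots> \<le> (\<Sum>k\<in>{1..n}. of_bool (?bad k w))" using k(1) by (intro member_le_sum) auto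
      finally show ?thesis by (auto simp: of_bool_def)
    qed (simp add: sum_nonneg)
  qed
  also have "\<dots> = (\<Sum>k\<in>{1..n}. avg ?W (\<lambda>w. of_bool (?bad k w)))" by (rule avg_sum)
  also have "\<dots> \<le> (\<Sum>k\<in>{1..n}. 2 * exp (- (2 * (ln (real n))\<^sup>2)))" by (intro sum_mono tail)
  also have "\<dots> = 2 * (exp (ln (real n)) * exp (- (2 * (ln (real n))\<^sup>2)))" using n by simp
  also have "\<dots> \<le> 2 * (exp 1 * exp (- (ln (real n))\<^sup>2))"
  proof -
    define L where "L = ln (real n)"
    have "0 \<le> (2 * L - 1)\<^sup>2" by simp
    then have "L - 2 * L\<^sup>2 \<le> 1 - L\<^sup>2" by (simp add: power2_eq_square algebra_simps)
    then show ?thesis by (simp add: L_def flip: exp_add)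
  qed
  finally show ?thesis by simp
qed

lemma good_event_dev:
  fixes z :: complex
  assumes n: "n \<ge> 3" and d: "d \<ge> 1" and w: "w \<in> good_event n d z" "w \<in> PiE {..<d} (\<lambda>_. perms {..<n})"
    and \<eta>: "0 < \<eta>" "\<eta> \<le> 1"
  shows "\<bar>perm_model.g n d z \<eta> w - perm_model.gbar n d z \<eta>\<bar> \<le> (2 / n + 8 * ln (real n) / sqrt n) / \<eta>^3"
proof -
  \<comment> \<open>Rounding up: the grid point is at least \<eta>, where \<open>grid_dev\<close> is
    no larger than its value at \<eta>, at most 1 because \<eta> \<le> 1, and within
    \<open>1 / n\<close> of \<eta>.\<close>
  define k where "k = nat \<lceil>\<eta> * n\<rceil>"
  have pos: "\<eta> * n > 0" using \<eta> n by simp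
  then have c0: "\<lceil>\<eta> * n\<rceil> > 0" by simp
  then have k_eq: "real k = of_int \<lceil>\<eta> * n\<rceil>" by (simp add: k_def)
  have "\<eta> * n \<le> n" using \<eta> by (simp add: mult_left_le_one_le)
  then have "\<lceil>\<eta> * n\<rceil> \<le> int n" by (simp add: ceiling_le_iff)
  moreover have "int k = \<lceil>\<eta> * n\<rceil>" using c0 by (simp add: k_def)
  ultimately have "1 \<le> k" "k \<le> n" using c0 by linarith+
  then have k: "k \<in> {1..n}" by simp
  define s where "s = real k / real n"
  have "\<eta> * n \<le> k" "k \<le> \<eta> * n + 1" unfolding k_eq by linarith+
  then have "\<eta> \<le> s" "s \<le> (\<eta> * n + 1) / n"
    using n by (simp_all add: s_def pos_le_divide_eq divide_right_mono)
  then have s: "\<eta> \<le> s" "s - \<eta> \<le> 1 / n" using n by (simp_all add: add_divide_distrib)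
  have s0: "s > 0" using s(1) \<eta> by linarith
  have lip: "\<bar>\<eta> - s\<bar> / (\<eta> * s) \<le> 1 / n / \<eta>\<^sup>2"
    unfolding power2_eq_square using s \<eta> s0 by (intro frac_le mult_mono mult_pos_pos) auto
  have "\<bar>perm_model.g n d z \<eta> w - perm_model.g n d z s w\<bar> \<le> \<bar>\<eta> - s\<bar> / (\<eta> * s)"
    by (rule g_lipschitz) (use n d \<eta> s0 w in auto)
  moreover have "\<bar>perm_model.gbar n d z \<eta> - perm_model.gbar n d z s\<bar> \<le> \<bar>\<eta> - s\<bar> / (\<eta> * s)"
    by (rule gbar_lipschitz) (use n d \<eta> s0 in auto)
  moreover have "\<bar>perm_model.g n d z s w - perm_model.gbar n d z s\<bar> < 8 * ln (real n) / (sqrt n * s\<^sup>2)"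
    using w(1) k n unfolding good_event_def grid_dev_def s_def by auto
  moreover have "8 * ln (real n) / (sqrt n * s\<^sup>2) \<le> 8 * ln (real n) / (sqrt n * \<eta>\<^sup>2)"
    using s(1) \<eta> n s0 by (intro divide_left_mono mult_left_mono power_mono mult_pos_pos) auto
  ultimately have "\<bar>perm_model.g n d z \<eta> w - perm_model.gbar n d z \<eta>\<bar> \<le> 2 * (1 / n / \<eta>\<^sup>2) + 8 * ln (real n) / (sqrt n * \<eta>\<^sup>2)"
    using lip by linarith
  also have "\<dots> = (2 / n + 8 * ln (real n) / sqrt n) / \<eta>\<^sup>2" by (simp add: add_divide_distrib)
  also have "\<dots> \<le> (2 / n + 8 * ln (real n) / sqrt n) / \<eta>^3"
    using n \<eta> power_decreasing[of 2 3 \<eta>] by (intro divide_left_mono) auto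
  finally show ?thesis .
qed

text \<open>Two contributions to the constant: the deviation of \<open>g\<close> from its mean gives
  10 = 2 + 8 (grid spacing and \<open>grid_dev\<close>), the distance of the mean from the root
  gives \<open>(sqrt D + 33) * (48 / \<epsilon>\<^sup>2)\<close>.\<close>

lemma local_law:
  fixes z :: complex and d :: "nat \<Rightarrow> nat" and w :: "nat \<Rightarrow> real"
  assumes D: "D > 0" and \<epsilon>: "0 < \<epsilon> \<and> \<epsilon> < 1" and z: "cmod z \<le> 1 - \<epsilon>"
    and d: "\<forall>n\<ge>1. 1 \<le> d n \<and> real (d n) \<le> D * real n" and w: "filterlim w at_top sequentially"
  shows "\<exists>\<Omega> :: nat \<Rightarrow> (nat \<Rightarrow> nat \<Rightarrow> nat) set.
             (\<forall>n\<ge>1. measure_pmf.prob (perm_pmf n (d n)) (perm_space n (d n) - \<Omega> n)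
                 \<le> 2 * exp 1 * exp (- 1 * (ln (real n))^2) + exp (- 1 * real (d n))) \<and>
             (\<forall>\<^sub>F n in sequentially.
                \<forall>\<omega> \<in> \<Omega> n \<inter> perm_space n (d n). \<forall>\<eta>::real.
                  (0 < \<eta> \<and> \<eta> \<le> 1 \<and>
                   \<eta>^3 * min (sqrt (real (d n))) (real n powr (1/4) / ln (real n)) \<ge> w n) \<longrightarrow>
                  cmod (m_n n (d n) z \<omega> (\<i> * complex_of_real \<eta>) - m_inf z (\<i> * complex_of_real \<eta>))
                    \<le> ((sqrt D + 33) * (48 / \<epsilon>\<^sup>2) + 10) * max (1 / sqrt (real (d n))) (ln (real n) / real n powr (1/4)) / \<eta>^3)"
proof -
  define K where "K = sqrt D + 33"
  have K: "K > 0" using D by (simp add: K_def add_pos_pos)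
  \<comment> \<open>The spectral window amounts to \<open>w n * \<delta> \<le> \<eta>^3\<close>.
    Beyond this threshold it forces
    \<open>K * \<delta> / \<eta>^3 < \<epsilon>\<^sup>2 / 32\<close>; the added 1 makes the
    inequality strict.\<close>
  have "eventually (\<lambda>n. w n \<ge> 32 * K / \<epsilon>\<^sup>2 + 1) sequentially"
    using w by (simp add: filterlim_at_top)
  then have ev: "eventually (\<lambda>n. w n \<ge> 32 * K / \<epsilon>\<^sup>2 + 1 \<and> n \<ge> 3) sequentially"
    using eventually_ge_at_top[of 3] by (rule eventually_conj)
  have bound: "cmod (m_n n (d n) z \<omega> (\<i> * complex_of_real \<eta>) - m_inf z (\<i> * complex_of_real \<eta>))
      \<le> (K * (48 / \<epsilon>\<^sup>2) + 10) * max (1 / sqrt (real (d n))) (ln (real n) / real n powr (1/4)) / \<eta>^3"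
    if wn: "w n \<ge> 32 * K / \<epsilon>\<^sup>2 + 1" and n: "n \<ge> 3" and \<omega>: "\<omega> \<in> good_event n (d n) z" "\<omega> \<in> perm_space n (d n)"
      and eta: "0 < \<eta>" "\<eta> \<le> 1" and eta_w: "\<eta>^3 * min (sqrt (real (d n))) (real n powr (1/4) / ln (real n)) \<ge> w n" for n \<omega> \<eta>
  proof -
    define \<delta> where "\<delta> = max (1 / sqrt (real (d n))) (ln (real n) / real n powr (1/4))"
    have dn: "d n \<ge> 1" "real (d n) \<le> D * n" using d n by auto
    have "exp 1 \<le> (3::real)" by (rule exp_le)
    also have "\<dots> \<le> n" using n by simp
    finally have ln1: "1 \<le> ln (real n)" using n by (subst ln_ge_iff) auto
    have rn: "real n powr (1/4) > 0" "sqrt n = real n powr (1/2)" using n by (auto simp: powr_half_sqrt)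
    \<comment> \<open>Rates in \<open>1 / sqrt n\<close> are relaxed to the quarter power of the
      statement, so that a single \<delta> dominates all errors.\<close>
    have quarter: "real n powr (1/4) \<le> sqrt n" unfolding rn(2) using n by (intro powr_mono) auto
    have ln_le: "ln (real n) / sqrt n \<le> \<delta>"
    proof -
      have "ln (real n) / sqrt n \<le> ln (real n) / real n powr (1/4)"
        using quarter rn(1) ln1 n by (intro divide_left_mono) auto
      then show ?thesis by (simp add: \<delta>_def)
    qed
    have inv_le: "1 / sqrt n \<le> \<delta>"
      using ln_le ln1 divide_right_mono[of 1 "ln (real n)" "sqrt n"] by simp
    have "1 / real n \<le> 1 / sqrt n"
      using n by (intro divide_left_mono) (auto simp: real_le_lsqrt power2_eq_square)
    then have inv_n: "1 / real n \<le> \<delta>" using inv_le by linarith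
    have "0 < 1 / real n" using n by simp
    then have del0: "\<delta> > 0" using inv_n by linarith
    have "\<eta>^3 * min (sqrt (real (d n))) (real n powr (1/4) / ln (real n)) \<le> \<eta>^3 * sqrt (d n)"
      "\<eta>^3 * min (sqrt (real (d n))) (real n powr (1/4) / ln (real n)) \<le> \<eta>^3 * (real n powr (1/4) / ln (real n))"
      using eta by (intro mult_left_mono; simp)+
    then have wd: "w n \<le> \<eta>^3 * sqrt (d n)" and wl: "w n \<le> \<eta>^3 * (real n powr (1/4) / ln (real n))"
      using eta_w by linarith+
    have "w n * (1 / sqrt (d n)) \<le> \<eta>^3" using wd dn by (simp add: field_simps)
    moreover have "w n * (ln (real n) / real n powr (1/4)) \<le> \<eta>^3" using wl rn(1) ln1 by (simp add: field_simps)
    ultimately have wdel: "w n * \<delta> \<le> \<eta>^3" by (auto simp: \<delta>_def max_def)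
    have small: "K * \<delta> / \<eta>^3 < \<epsilon>\<^sup>2 / 32"
    proof -
      have "32 * K / \<epsilon>\<^sup>2 * \<delta> < w n * \<delta>" using wn del0 by (intro mult_strict_right_mono) auto
      then have "32 * K / \<epsilon>\<^sup>2 * \<delta> < \<eta>^3" using wdel by linarith
      then have "K * \<delta> * 32 < \<epsilon>\<^sup>2 * \<eta>^3" using \<epsilon> by (simp add: pos_divide_less_eq mult_ac)
      then show ?thesis using eta by (simp add: pos_divide_less_eq pos_less_divide_eq)
    qed
    interpret perm_model n "d n" z \<eta> by unfold_locales (use n dn eta in auto)
    have omW: "\<omega> \<in> W" using \<omega>(2) by (simp add: perm_space_def)
    have 1: "\<bar>gbar - cubic_root (1 - (cmod z)\<^sup>2) \<eta>\<bar> \<le> K * \<delta> / \<eta>^3 * (48 / \<epsilon>\<^sup>2)"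
      unfolding K_def
      by (rule gbar_close_to_root[OF _ dn])
         (use \<open>n \<ge> 3\<close> z \<epsilon> eta inv_le small in \<open>auto simp: \<delta>_def K_def\<close>)
    have "\<bar>g \<omega> - gbar\<bar> \<le> (2 / n + 8 * ln (real n) / sqrt n) / \<eta>^3"
      by (rule good_event_dev[OF \<open>n \<ge> 3\<close> dn(1) \<omega>(1) omW eta])
    also have "\<dots> \<le> 10 * \<delta> / \<eta>^3"
      using inv_n ln_le eta by (intro divide_right_mono) auto
    finally have 2: "\<bar>g \<omega> - gbar\<bar> \<le> 10 * \<delta> / \<eta>^3" .
    have z1: "cmod z \<le> 1" using z \<epsilon> by linarith
    have "m_n n (d n) z \<omega> (\<i> * of_real \<eta>) - m_inf z (\<i> * of_real \<eta>)
        = - (\<i> * of_real (g \<omega> - cubic_root (1 - (cmod z)\<^sup>2) \<eta>))"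
      unfolding m_n_eq[OF omW] m_inf_imaginary[OF z1 eta(1)] by (simp add: algebra_simps)
    then have "cmod (m_n n (d n) z \<omega> (\<i> * of_real \<eta>) - m_inf z (\<i> * of_real \<eta>)) = \<bar>g \<omega> - cubic_root (1 - (cmod z)\<^sup>2) \<eta>\<bar>"
      by (simp only: norm_minus_cancel norm_mult norm_ii norm_of_real mult_1_left)
    also have "\<dots> \<le> K * \<delta> / \<eta>^3 * (48 / \<epsilon>\<^sup>2) + 10 * \<delta> / \<eta>^3" using 1 2 by linarith
    also have "\<dots> = (K * (48 / \<epsilon>\<^sup>2) + 10) * \<delta> / \<eta>^3"
      by (simp add: algebra_simps add_divide_distrib)
    finally show ?thesis by (simp only: \<delta>_def)
  qed
  show ?thesis
    unfolding K_def[symmetric]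
  proof (rule exI[of _ "\<lambda>n. good_event n (d n) z"], intro conjI allI impI)
    fix n :: nat assume "n \<ge> 1"
    then have "measure_pmf.prob (perm_pmf n (d n)) (perm_space n (d n) - good_event n (d n) z)
        \<le> 2 * exp 1 * exp (- (ln (real n))\<^sup>2)" using d by (intro good_event_prob) auto
    then show "measure_pmf.prob (perm_pmf n (d n)) (perm_space n (d n) - good_event n (d n) z)
        \<le> 2 * exp 1 * exp (- 1 * (ln (real n))\<^sup>2) + exp (- 1 * real (d n))"
      by (intro add_increasing2) simp_all
  next
    show "\<forall>\<^sub>F n in sequentially. \<forall>\<omega> \<in> good_event n (d n) z \<inter> perm_space n (d n). \<forall>\<eta>::real.
        (0 < \<eta> \<and> \<eta> \<le> 1 \<and> \<eta>^3 * min (sqrt (real (d n))) (real n powr (1/4) / ln (real n)) \<ge> w n) \<longrightarrow>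
        cmod (m_n n (d n) z \<omega> (\<i> * complex_of_real \<eta>) - m_inf z (\<i> * complex_of_real \<eta>))
          \<le> (K * (48 / \<epsilon>\<^sup>2) + 10) * max (1 / sqrt (real (d n))) (ln (real n) / real n powr (1/4)) / \<eta>^3"
      using ev by eventually_elim (use bound in blast)
  qed
qed

theorem theorem2p6:
  "\<exists>\<epsilon>0::real. \<epsilon>0 > 0 \<and>
   (\<forall>D::real. D > 0 \<longrightarrow>
    (\<exists>c Cbar C :: real. c > 0 \<and> Cbar > 0 \<and> C > 0 \<and>
     (\<forall>\<epsilon>. 0 < \<epsilon> \<and> \<epsilon> < \<epsilon>0 \<longrightarrow>
      (\<exists>Ct::real. Ct > 0 \<and>
       (\<forall>z::complex. cmod z \<le> 1 - \<epsilon> \<longrightarrow>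
        (\<forall>(d::nat \<Rightarrow> nat) (w::nat \<Rightarrow> real).
          (\<forall>n\<ge>1. 1 \<le> d n \<and> real (d n) \<le> D * real n) \<longrightarrow>
          filterlim w at_top sequentially \<longrightarrow>
          (\<exists>\<Omega> :: nat \<Rightarrow> (nat \<Rightarrow> nat \<Rightarrow> nat) set.
             (\<forall>n\<ge>1. measure_pmf.prob (perm_pmf n (d n)) (perm_space n (d n) - \<Omega> n)
                 \<le> C * exp (- c * (ln (real n))^2) + exp (- c * real (d n))) \<and>
             (\<forall>\<^sub>F n in sequentially.
                \<forall>\<omega> \<in> \<Omega> n \<inter> perm_space n (d n). \<forall>\<eta>::real.
                  (0 < \<eta> \<and> \<eta> \<le> Cbar \<and>
                   \<eta>^3 * min (sqrt (real (d n))) (real n powr (1/4) / ln (real n)) \<ge> w n) \<longrightarrow>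
                  cmod (m_n n (d n) z \<omega> (\<i> * complex_of_real \<eta>) - m_inf z (\<i> * complex_of_real \<eta>))
                    \<le> Ct * max (1 / sqrt (real (d n))) (ln (real n) / real n powr (1/4)) / \<eta>^3))))))))"
\<comment> \<open>The witnesses are 1 for \<open>\<epsilon>0\<close>, \<open>c\<close> and
  \<open>Cbar\<close>, and \<open>2 * exp 1\<close> for \<open>C\<close>. The height is capped at 1
  because the stability argument starts from \<eta> = 1 and the grid covers (0, 1].\<close>
proof (rule exI[of _ 1], intro conjI allI impI, simp, rule exI[of _ 1], rule exI[of _ 1], rule exI[of _ "2 * exp 1"],
    intro conjI allI impI, goal_cases)
  case (4 D \<epsilon>)
  then have "0 < (sqrt D + 33) * (48 / \<epsilon>\<^sup>2) + 10" by (simp add: add_pos_pos)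
  with 4 show ?case
    by (intro exI[of _ "(sqrt D + 33) * (48 / \<epsilon>\<^sup>2) + 10"] conjI allI impI local_law) auto
qed simp_all

end
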